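(* Let $X$ be a subshift and let $R$ be a field. Then there exists a directed graph $E$ such that the Leavitt path algebra $L_R(E)$ and $\mathrm{Soc}(\widetilde{\mathcal A}_R(X))$ are isomorphic as $\mathbb Z$-graded algebras (with their natural $\mathbb Z$-gradings).
   Context: Notation: $\mathbb N=\{0,1,2,\dots\}$. Let $\mathfrak A$ be a nonempty set (the alphabet) and let $\mathfrak A^*$ be the set of finite words over $\mathfrak A$, including the empty word $\omega$; $|\alpha|$ is the length of $\alpha$. A subshift over $\mathfrak A$ is a set $X\subseteq\mathfrak A^{\mathbb N}$ of the form $X=X_F$ for some $F\subseteq\mathfrak A^*$, where $X_F$ is the set of all sequences in which no word of $F$ occurs as a block. Every letter of $\mathfrak A$ is assumed to occur in some element of $X$. The language $\mathcal L_X$ is the set of all finite words (including $\omega$) occurring in some element of $X$. For $\alpha,\beta\in\mathcal L_X$ put $C(\alpha,\beta)=\{\beta x\in X:\alpha x\in X\}$. Let $\mathcal U$ be the Boolean algebra of subsets of $X$ generated by all $C(\alpha,\beta)$, $\alpha,\beta\in\mathcal L_X$ (closed under finite unions, finite intersections and complements in $X$). The unital subshift algebra $\widetilde{\mathcal A}_R(X)$ is the universal unital (associative) $R$-algebra with generators $\{p_A:A\in\mathcal U\}$ and $\{s_a,s_a^*:a\in\mathfrak A\}$ subject to: (i) $p_X=1$, $p_{A\cap B}=p_Ap_B$, $p_{A\cup B}=p_A+p_B-p_{A\cap B}$, $p_\emptyset=0$ for all $A,B\in\mathcal U$; (ii) $s_as_a^*s_a=s_a$ and $s_a^*s_as_a^*=s_a^*$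 for all $a\in\mathfrak A$; (iii) $s_\beta s_\alpha^*s_\alpha s_\beta^*=p_{C(\alpha,\beta)}$ for all $\alpha,\beta\in\mathcal L_X$, where $s_\omega=s_\omega^*=1$, $s_\alpha=s_{\alpha_1}\cdots s_{\alpha_n}$ and $s_\alpha^*=s_{\alpha_n}^*\cdots s_{\alpha_1}^*$ for $\alpha=\alpha_1\cdots\alpha_n$. It is $\mathbb Z$-graded by $\widetilde{\mathcal A}_R(X)_n=\mathrm{span}_R\{s_\alpha p_As_\beta^*:\alpha,\beta\in\mathcal L_X,\ A\in\mathcal U,\ |\alpha|-|\beta|=n\}$. The socle $\mathrm{Soc}(B)$ of an algebra $B$ is the sum of all minimal left ideals of $B$ (zero if there are none). The socle of $\widetilde{\mathcal A}_R(X)$ is a graded two-sided ideal, with grading $\mathrm{Soc}_n=\mathrm{Soc}\cap\widetilde{\mathcal A}_R(X)_n$. For a directed graph $E=(E^0,E^1,s,r)$ (the empty graph is allowed), $L_R(E)$ is the Leavitt path algebra: the universal $R$-algebra generated by pairwise orthogonal idempotents $v\in E^0$ and elements $e,e^*$ ($e\in E^1$) with $s(e)e=e=e\,r(e)$, $r(e)e^*=e^*=e^*s(e)$, $e^*f=\delta_{e,f}r(e)$, and $v=\sum_{s(e)=v}ee^*$ whenever $0<|s^{-1}(v)|<\infty$; it is $\mathbb Z$-graded by $\deg v=0$, $\deg e=1$, $\deg e^*=-1$. *)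

theory Defs
  imports
    "HOL-Algebra.Module"
    "HOL-Algebra.QuotRing"
    "HOL-Library.Omega_Words_Fun"
    "HOL-Library.Poly_Mapping"
    "Graph_Theory.Digraph"
begin

section \<open>Algebras over a field\<close>

text \<open>
  An algebra over a field \<open>'r\<close> is a record \<open>('r, 'm) module\<close>; it need not be commutative.
  The field \<open>one\<close> carries no meaning when the algebra has no unit.
\<close>

definition subspace :: "('r::field, 'm) module \<Rightarrow> 'm set \<Rightarrow> bool" where
  "subspace A V \<longleftrightarrow> V \<subseteq> carrier A \<and> \<zero>\<^bsub>A\<^esub> \<in> V \<and>
     (\<forall>x\<in>V. \<forall>y\<in>V. x \<oplus>\<^bsub>A\<^esub> y \<in> V) \<and> (\<forall>c. \<forall>x\<in>V. c \<odot>\<^bsub>A\<^esub> x \<in> V)"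

definition lin_span :: "('r::field, 'm) module \<Rightarrow> 'm set \<Rightarrow> 'm set" where
  "lin_span A S = \<Inter>{V. subspace A V \<and> S \<subseteq> V}"

definition left_ideal :: "('r::field, 'm) module \<Rightarrow> 'm set \<Rightarrow> bool" where
  "left_ideal A J \<longleftrightarrow> subspace A J \<and> (\<forall>a\<in>carrier A. \<forall>x\<in>J. a \<otimes>\<^bsub>A\<^esub> x \<in> J)"

definition two_sided_ideal :: "('r::field, 'm) module \<Rightarrow> 'm set \<Rightarrow> bool" where
  "two_sided_ideal A J \<longleftrightarrow> left_ideal A J \<and> (\<forall>a\<in>carrier A. \<forall>x\<in>J. x \<otimes>\<^bsub>A\<^esub> a \<in> J)"

definition gen_ideal :: "('r::field, 'm) module \<Rightarrow> 'm set \<Rightarrow> 'm set" where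
  "gen_ideal A S = \<Inter>{J. two_sided_ideal A J \<and> S \<subseteq> J}"

definition minimal_left_ideal :: "('r::field, 'm) module \<Rightarrow> 'm set \<Rightarrow> bool" where
  "minimal_left_ideal A J \<longleftrightarrow> left_ideal A J \<and> J \<noteq> {\<zero>\<^bsub>A\<^esub>} \<and>
     (\<forall>K. left_ideal A K \<and> K \<subseteq> J \<longrightarrow> K = {\<zero>\<^bsub>A\<^esub>} \<or> K = J)"

text \<open>The sum of a family of subspaces is the span of their union; it is zero for the empty family.\<close>

definition socle :: "('r::field, 'm) module \<Rightarrow> 'm set" where
  "socle A = lin_span A (\<Union>{J. minimal_left_ideal A J})"

text \<open>The quotient consists of the cosets of \<open>I\<close>; its ring part is \<^term>\<open>A Quot I\<close>.\<close>

definition quotient_algebra :: "('r::field, 'm) module \<Rightarrow> 'm set \<Rightarrow> ('r, 'm set) module" where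
  "quotient_algebra A I =
     \<lparr>carrier = a_rcosets\<^bsub>A\<^esub> I, mult = rcoset_mult A I, one = I +>\<^bsub>A\<^esub> \<one>\<^bsub>A\<^esub>, zero = I,
      add = set_add A, smult = (\<lambda>c B. \<Union>b\<in>B. I +>\<^bsub>A\<^esub> (c \<odot>\<^bsub>A\<^esub> b))\<rparr>"

definition graded_algebra_iso ::
  "('r::field, 'm) module \<Rightarrow> (int \<Rightarrow> 'm set) \<Rightarrow> ('r, 'n) module \<Rightarrow> (int \<Rightarrow> 'n set) \<Rightarrow> ('m \<Rightarrow> 'n) \<Rightarrow> bool"
where
  "graded_algebra_iso A gA B gB \<phi> \<longleftrightarrow>
     bij_betw \<phi> (carrier A) (carrier B) \<and>
     (\<forall>x\<in>carrier A. \<forall>y\<in>carrier A. \<phi> (x \<oplus>\<^bsub>A\<^esub> y) = \<phi> x \<oplus>\<^bsub>B\<^esub> \<phi> y) \<and>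
     (\<forall>x\<in>carrier A. \<forall>y\<in>carrier A. \<phi> (x \<otimes>\<^bsub>A\<^esub> y) = \<phi> x \<otimes>\<^bsub>B\<^esub> \<phi> y) \<and>
     (\<forall>c. \<forall>x\<in>carrier A. \<phi> (c \<odot>\<^bsub>A\<^esub> x) = c \<odot>\<^bsub>B\<^esub> \<phi> x) \<and>
     (\<forall>n. \<phi> ` gA n = gB n)"

section \<open>Free algebras and presentations\<close>

text \<open>
  A copy of the type of lists, made a monoid under concatenation (written additively, as
  required for the convolution product on \<open>\<Rightarrow>\<^sub>0\<close>).
\<close>

datatype 'g free_monoid = Word (letters: "'g list")

instantiation free_monoid :: (type) monoid_add
begin

definition zero_free_monoid :: "'a free_monoid" where
  "0 = Word []"

definition plus_free_monoid :: "'a free_monoid \<Rightarrow> 'a free_monoid \<Rightarrow> 'a free_monoid" where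
  "u + v = Word (letters u @ letters v)"

instance
  by standard (simp_all add: zero_free_monoid_def plus_free_monoid_def)

end

text \<open>Noncommutative polynomials with coefficients in \<open>'r\<close> and indeterminates in \<open>'g\<close>.\<close>

type_synonym ('r, 'g) ncpoly = "'g free_monoid \<Rightarrow>\<^sub>0 'r"

definition gen :: "'g \<Rightarrow> ('r::field, 'g) ncpoly" where
  "gen g = Poly_Mapping.single (Word [g]) 1"

text \<open>The free unital algebra on a set \<open>G\<close> of generators.\<close>

definition free_algebra :: "'g set \<Rightarrow> ('r::field, ('r, 'g) ncpoly) module" where
  "free_algebra G =
     \<lparr>carrier = {f. \<forall>w\<in>Poly_Mapping.keys f. set (letters w) \<subseteq> G}, mult = (*), one = 1, zero = 0,
      add = (+), smult = (\<lambda>c f. Poly_Mapping.single 0 c * f)\<rparr>"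

text \<open>The free not necessarily unital algebra on \<open>G\<close>: no constant terms.\<close>

definition free_nonunital_algebra :: "'g set \<Rightarrow> ('r::field, ('r, 'g) ncpoly) module" where
  "free_nonunital_algebra G =
     (free_algebra G)\<lparr>carrier := {f \<in> carrier (free_algebra G). Poly_Mapping.lookup f 0 = 0}\<rparr>"

text \<open>
  For a free algebra \<open>F\<close> and a set \<open>S\<close> of relators, the algebra presented by the
  relations \<open>f = 0\<close> for \<open>f \<in> S\<close>, and the class of an element of \<open>F\<close> in it.
\<close>

definition presented_algebra :: "('r::field, 'm) module \<Rightarrow> 'm set \<Rightarrow> ('r, 'm set) module" where
  "presented_algebra F S = quotient_algebra F (gen_ideal F S)"

definition pres_class :: "('r::field, 'm) module \<Rightarrow> 'm set \<Rightarrow> 'm \<Rightarrow> 'm set" where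
  "pres_class F S f = gen_ideal F S +>\<^bsub>F\<^esub> f"

section \<open>Subshifts\<close>

definition occurs_in :: "'a list \<Rightarrow> (nat \<Rightarrow> 'a) \<Rightarrow> bool" where
  "occurs_in \<alpha> x \<longleftrightarrow> (\<exists>i j. \<alpha> = x [i \<rightarrow> j])"

definition forbidding :: "'a list set \<Rightarrow> (nat \<Rightarrow> 'a) set" where
  "forbidding F = {x. \<forall>\<alpha>\<in>F. \<not> occurs_in \<alpha> x}"

definition subshift :: "(nat \<Rightarrow> 'a) set \<Rightarrow> bool" where
  "subshift X \<longleftrightarrow> (\<exists>F. X = forbidding F)"

definition lang :: "(nat \<Rightarrow> 'a) set \<Rightarrow> 'a list set" where
  "lang X = {\<alpha>. \<exists>x\<in>X. occurs_in \<alpha> x}"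

definition C_set :: "(nat \<Rightarrow> 'a) set \<Rightarrow> 'a list \<Rightarrow> 'a list \<Rightarrow> (nat \<Rightarrow> 'a) set" where
  "C_set X \<alpha> \<beta> = {\<beta> \<frown> x |x. \<beta> \<frown> x \<in> X \<and> \<alpha> \<frown> x \<in> X}"

inductive_set bool_alg :: "(nat \<Rightarrow> 'a) set \<Rightarrow> (nat \<Rightarrow> 'a) set set" for X where
  basic: "\<alpha> \<in> lang X \<Longrightarrow> \<beta> \<in> lang X \<Longrightarrow> C_set X \<alpha> \<beta> \<in> bool_alg X"
| Un: "A \<in> bool_alg X \<Longrightarrow> B \<in> bool_alg X \<Longrightarrow> A \<union> B \<in> bool_alg X"
| Int: "A \<in> bool_alg X \<Longrightarrow> B \<in> bool_alg X \<Longrightarrow> A \<inter> B \<in> bool_alg X"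
| compl: "A \<in> bool_alg X \<Longrightarrow> X - A \<in> bool_alg X"

section \<open>The unital subshift algebra\<close>

datatype 'a subshift_gen = Proj "(nat \<Rightarrow> 'a) set" | Shift 'a | ShiftStar 'a

definition subshift_gens :: "(nat \<Rightarrow> 'a) set \<Rightarrow> 'a subshift_gen set" where
  "subshift_gens X = Proj ` bool_alg X \<union> range Shift \<union> range ShiftStar"

abbreviation p_gen :: "(nat \<Rightarrow> 'a) set \<Rightarrow> ('r::field, 'a subshift_gen) ncpoly" where
  "p_gen A \<equiv> gen (Proj A)"

definition s_word :: "'a list \<Rightarrow> ('r::field, 'a subshift_gen) ncpoly" where
  "s_word \<alpha> = prod_list (map (\<lambda>a. gen (Shift a)) \<alpha>)"

definition s_star_word :: "'a list \<Rightarrow> ('r::field, 'a subshift_gen) ncpoly" where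
  "s_star_word \<alpha> = prod_list (map (\<lambda>a. gen (ShiftStar a)) (rev \<alpha>))"

definition subshift_relators :: "(nat \<Rightarrow> 'a) set \<Rightarrow> ('r::field, 'a subshift_gen) ncpoly set" where
  "subshift_relators X =
     {p_gen X - 1, p_gen {}} \<union>
     {p_gen (A \<inter> B) - p_gen A * p_gen B |A B. A \<in> bool_alg X \<and> B \<in> bool_alg X} \<union>
     {p_gen (A \<union> B) - (p_gen A + p_gen B - p_gen (A \<inter> B)) |A B. A \<in> bool_alg X \<and> B \<in> bool_alg X} \<union>
     {gen (Shift a) * gen (ShiftStar a) * gen (Shift a) - gen (Shift a) |a. True} \<union>
     {gen (ShiftStar a) * gen (Shift a) * gen (ShiftStar a) - gen (ShiftStar a) |a. True} \<union>
     {s_word \<beta> * s_star_word \<alpha> * s_word \<alpha> * s_star_word \<beta> - p_gen (C_set X \<alpha> \<beta>) |\<alpha> \<beta>.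
        \<alpha> \<in> lang X \<and> \<beta> \<in> lang X}"

definition subshift_algebra ::
  "(nat \<Rightarrow> 'a) set \<Rightarrow> ('r::field, ('r, 'a subshift_gen) ncpoly set) module" where
  "subshift_algebra X = presented_algebra (free_algebra (subshift_gens X)) (subshift_relators X)"

definition subshift_algebra_grading ::
  "(nat \<Rightarrow> 'a) set \<Rightarrow> int \<Rightarrow> ('r::field, 'a subshift_gen) ncpoly set set" where
  "subshift_algebra_grading X n =
     lin_span (subshift_algebra X)
       {pres_class (free_algebra (subshift_gens X)) (subshift_relators X)
          (s_word \<alpha> * p_gen A * s_star_word \<beta>) |\<alpha> A \<beta>.
        \<alpha> \<in> lang X \<and> \<beta> \<in> lang X \<and> A \<in> bool_alg X \<and> int (length \<alpha>) - int (length \<beta>) = n}"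

definition subshift_socle_algebra ::
  "(nat \<Rightarrow> 'a) set \<Rightarrow> ('r::field, ('r, 'a subshift_gen) ncpoly set) module" where
  "subshift_socle_algebra X = (subshift_algebra X)\<lparr>carrier := socle (subshift_algebra X)\<rparr>"

definition subshift_socle_grading ::
  "(nat \<Rightarrow> 'a) set \<Rightarrow> int \<Rightarrow> ('r::field, 'a subshift_gen) ncpoly set set" where
  "subshift_socle_grading X n = socle (subshift_algebra X) \<inter> subshift_algebra_grading X n"

section \<open>Leavitt path algebras\<close>

text \<open>The source and range maps are \<^const>\<open>tail\<close> and \<^const>\<open>head\<close>.\<close>

datatype ('v, 'e) leavitt_gen = Vertex 'v | Edge 'e | Ghost 'e

definition leavitt_gens :: "('v, 'e) pre_digraph \<Rightarrow> ('v, 'e) leavitt_gen set" where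
  "leavitt_gens E = Vertex ` verts E \<union> Edge ` arcs E \<union> Ghost ` arcs E"

definition leavitt_relators ::
  "('v, 'e) pre_digraph \<Rightarrow> ('r::field, ('v, 'e) leavitt_gen) ncpoly set" where
  "leavitt_relators E =
     {gen (Vertex v) * gen (Vertex w) - (if v = w then gen (Vertex v) else 0) |v w.
        v \<in> verts E \<and> w \<in> verts E} \<union>
     {gen (Vertex (tail E e)) * gen (Edge e) - gen (Edge e) |e. e \<in> arcs E} \<union>
     {gen (Edge e) * gen (Vertex (head E e)) - gen (Edge e) |e. e \<in> arcs E} \<union>
     {gen (Vertex (head E e)) * gen (Ghost e) - gen (Ghost e) |e. e \<in> arcs E} \<union>
     {gen (Ghost e) * gen (Vertex (tail E e)) - gen (Ghost e) |e. e \<in> arcs E} \<union>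
     {gen (Ghost e) * gen (Edge f) - (if e = f then gen (Vertex (head E e)) else 0) |e f.
        e \<in> arcs E \<and> f \<in> arcs E} \<union>
     {gen (Vertex v) - (\<Sum>e\<in>out_arcs E v. gen (Edge e) * gen (Ghost e)) |v.
        v \<in> verts E \<and> finite (out_arcs E v) \<and> out_arcs E v \<noteq> {}}"

definition leavitt_algebra ::
  "('v, 'e) pre_digraph \<Rightarrow> ('r::field, ('r, ('v, 'e) leavitt_gen) ncpoly set) module" where
  "leavitt_algebra E =
     presented_algebra (free_nonunital_algebra (leavitt_gens E)) (leavitt_relators E)"

primrec leavitt_degree :: "('v, 'e) leavitt_gen \<Rightarrow> int" where
  "leavitt_degree (Vertex v) = 0"
| "leavitt_degree (Edge e) = 1"
| "leavitt_degree (Ghost e) = -1"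

text \<open>The degree-\<open>n\<close> part is spanned by the nonempty products of generators of total degree \<open>n\<close>.\<close>

definition leavitt_grading ::
  "('v, 'e) pre_digraph \<Rightarrow> int \<Rightarrow> ('r::field, ('v, 'e) leavitt_gen) ncpoly set set" where
  "leavitt_grading E n =
     lin_span (leavitt_algebra E)
       {pres_class (free_nonunital_algebra (leavitt_gens E)) (leavitt_relators E)
          (prod_list (map gen w)) |w.
        w \<noteq> [] \<and> set w \<subseteq> leavitt_gens E \<and> sum_list (map leavitt_degree w) = n}"

end

theory Submission
  imports Defs
begin

text \<open>
  The subshift algebra acts on functions on \<open>X \<times> \<int>\<close>: \<open>p\<^sub>A\<close> by restriction to \<open>A\<close>, and \<open>s\<^sub>a\<close>, \<open>s\<^sub>a\<^sup>*\<close>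
  by the shift, which moves the integer coordinate by one. The action is faithful: modulo the
  relations every element is a sum of terms \<open>p\<^sub>B s\<^sub>\<alpha> s\<^sub>\<beta>\<^sup>*\<close>, and after cutting \<open>X\<close> into finitely
  many pieces the terms over a piece containing \<open>x = \<alpha> z\<close> depend only on \<open>(\<beta> z, |\<alpha>| - |\<beta>|)\<close> and
  are told apart by the coefficients of the operator at \<open>x\<close>.

  Call \<open>x\<close> a line point if \<open>{x}\<close> lies in the Boolean algebra and \<open>x\<close> is not eventually
  periodic. The graph has the line points as vertices and one edge from every \<open>x\<close> to its shift.
  Its Leavitt path algebra acts on the same functions, faithfully and with image the span \<open>N\<close> of
  the matrix units between tail equivalent line points.

  The columns of \<open>N\<close> are minimal left ideals. Conversely, a nonzero element \<open>f\<close> of a minimal left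
  ideal can be multiplied from both sides to give either a multiple of some \<open>p\<^sub>W\<close> or a nonzero
  element of the corner at an isolated eventually periodic point. In the first case \<open>W\<close> has to be
  a singleton, and a line point puts \<open>f\<close> into \<open>N\<close>; otherwise the corner is a Laurent
  polynomial ring, which is a domain but not a field, contradicting minimality. So \<open>N\<close> is the
  socle, and the gradings agree because both record the shift of the integer coordinate.
\<close>

\<comment> \<open>Both algebras are quotients of free algebras, where it is hard to see that an
  element is nonzero. Acting on the same functions, they become subalgebras of one ring of
  operators, and the theorem becomes an equality of spans for the socle and one in each degree; only
  faithfulness has to be argued inside the presentations. Aperiodicity of a line point serves both
  sides. It makes the degree of a matrix unit a function of its row and column, so that each tail
  class contributes an ordinary algebra of finite matrices. It also excludes cycles from the graph,
  and since every vertex emits exactly one edge, each edge-ghost product collapses to a vertex; a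
  path followed by a ghost path then depends only on its end points and its degree.\<close>
alias lookup = Poly_Mapping.lookup
alias keys = Poly_Mapping.keys
alias single = Poly_Mapping.single

section \<open>Evaluation of noncommutative polynomials\<close>

lemma poly_mapping_sum_monomials:
  "(\<Sum>w\<in>keys f. single w (lookup f w)) = f"
  by (rule poly_mapping_eqI) (simp add: lookup_sum lookup_single when_def sum.delta in_keys_iff)

text \<open>An associative algebra carried by a whole type. The two instances are noncommutative
  polynomials (\<open>pm\<close>) and operators (\<open>lo\<close>).\<close>

locale scaled_ring = vector_space scale
  for scale :: "'r::field \<Rightarrow> 'b::ring \<Rightarrow> 'b" (infixr \<open>*s\<close> 75) +
  assumes scale_mult_left: "(c *s x) * y = c *s (x * y)"
    and scale_mult_right: "x * (c *s y) = c *s (x * y)"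
begin

text \<open>Linear extension from monomials. Nothing is asked of \<open>\<theta>\<close> at the
  neutral element, which \<open>word_op\<close> sends to an idempotent different from the unit
  operator in general.\<close>

definition ev :: "('m::monoid_add \<Rightarrow> 'b) \<Rightarrow> ('m \<Rightarrow>\<^sub>0 'r) \<Rightarrow> 'b" where
  "ev \<theta> f = (\<Sum>w\<in>keys f. lookup f w *s \<theta> w)"

lemma ev_superset:
  assumes "finite K" "keys f \<subseteq> K"
  shows "ev \<theta> f = (\<Sum>w\<in>K. lookup f w *s \<theta> w)"
  unfolding ev_def by (rule sum.mono_neutral_left) (use assms in \<open>auto simp: in_keys_iff\<close>)

lemma ev_zero [simp]: "ev \<theta> 0 = 0"
  by (simp add: ev_def)

lemma ev_single [simp]: "ev \<theta> (single w c) = c *s \<theta> w"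
  by (simp add: ev_def)

lemma ev_add: "ev \<theta> (f + g) = ev \<theta> f + ev \<theta> g"
proof -
  let ?K = "keys f \<union> keys g"
  have "ev \<theta> (f + g) = (\<Sum>w\<in>?K. lookup (f + g) w *s \<theta> w)"
    by (rule ev_superset) (use Poly_Mapping.keys_add[of f g] in auto)
  also have "\<dots> = (\<Sum>w\<in>?K. lookup f w *s \<theta> w) + (\<Sum>w\<in>?K. lookup g w *s \<theta> w)"
    by (simp add: lookup_add scale_left_distrib sum.distrib)
  also have "\<dots> = ev \<theta> f + ev \<theta> g"
    by (simp add: ev_superset[of ?K])
  finally show ?thesis .
qed

lemma ev_uminus: "ev \<theta> (- f) = - ev \<theta> f"
  using ev_add[of \<theta> f "- f"] by (simp add: eq_neg_iff_add_eq_0 add.commute)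

lemma ev_diff: "ev \<theta> (f - g) = ev \<theta> f - ev \<theta> g"
  using ev_add[of \<theta> f "- g"] by (simp add: ev_uminus)

lemma ev_sum: "ev \<theta> (sum f A) = (\<Sum>i\<in>A. ev \<theta> (f i))"
  by (induction A rule: infinite_finite_induct) (simp_all add: ev_add)

lemma ev_mult:
  assumes \<theta>: "\<And>u v. \<theta> (u + v) = \<theta> u * \<theta> v"
  shows "ev \<theta> (f * g) = ev \<theta> f * ev \<theta> g"
proof -
  have single: "ev \<theta> (single u a * single v b) = (a *s \<theta> u) * (b *s \<theta> v)" for u v a b
    by (simp add: mult_single \<theta> scale_mult_left scale_mult_right)
  have "f * g = (\<Sum>u\<in>keys f. \<Sum>v\<in>keys g.
      single u (lookup f u) * single v (lookup g v))"
    by (simp add: poly_mapping_sum_monomials flip: sum_product)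
  then show ?thesis
    by (simp add: ev_sum single) (simp add: ev_def sum_product)
qed

text \<open>From an operator one can read off only the total coefficient of all terms with the same
  key. This turns vanishing totals into a vanishing sum once each term has been replaced by a
  representative of its key.\<close>

lemma sum_group_eq_0:
  assumes "finite t" "\<And>\<kappa>. (\<Sum>i | i \<in> t \<and> key i = \<kappa>. c i) = 0"
  shows "(\<Sum>i\<in>t. c i *s w (key i)) = 0"
proof -
  have "(\<Sum>i\<in>t. c i *s w (key i)) = (\<Sum>\<kappa>\<in>key ` t. \<Sum>i | i \<in> t \<and> key i = \<kappa>. c i *s w (key i))"
    by (rule sum.image_gen) fact
  also have "\<dots> = (\<Sum>\<kappa>\<in>key ` t. (\<Sum>i | i \<in> t \<and> key i = \<kappa>. c i) *s w \<kappa>)"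
    by (intro sum.cong refl) (simp add: scale_sum_left)
  finally show ?thesis
    by (simp add: assms)
qed

end

definition pscale :: "'r::field \<Rightarrow> ('m::monoid_add \<Rightarrow>\<^sub>0 'r) \<Rightarrow> ('m \<Rightarrow>\<^sub>0 'r)" where
  "pscale c f = single 0 c * f"

lemma pscale_sum_monomials:
  "pscale c f = (\<Sum>u\<in>keys f. single u (c * lookup f u))"
  by (simp add: pscale_def poly_mapping_sum_monomials mult_single[of 0, simplified, symmetric]
      flip: sum_distrib_left)

lemma single_0_central:
  fixes f :: "'m::monoid_add \<Rightarrow>\<^sub>0 'r::field"
  shows "f * single 0 c = single 0 c * f"
proof -
  have f: "f = (\<Sum>u\<in>keys f. single u (lookup f u))"
    by (simp add: poly_mapping_sum_monomials)
  show ?thesis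
    unfolding arg_cong[OF f, of "\<lambda>g. g * single 0 c"] arg_cong[OF f, of "(*) (single 0 c)"]
    by (simp add: sum_distrib_left sum_distrib_right mult_single mult.commute)
qed

interpretation pm: scaled_ring "pscale :: 'r::field \<Rightarrow> ('m::monoid_add \<Rightarrow>\<^sub>0 'r) \<Rightarrow> _"
proof
  fix a b :: 'r and x y :: "'m \<Rightarrow>\<^sub>0 'r"
  show "pscale a (x + y) = pscale a x + pscale a y" by (simp add: pscale_def distrib_left)
  show "pscale (a + b) x = pscale a x + pscale b x" by (simp add: pscale_def single_add distrib_right)
  show "pscale a (pscale b x) = pscale (a * b) x"
    by (simp add: pscale_def mult_single flip: mult.assoc)
  show "pscale 1 x = x" by (simp add: pscale_def)
  show "pscale a x * y = pscale a (x * y)" by (simp add: pscale_def mult.assoc)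
  show "x * pscale a y = pscale a (x * y)"
    unfolding pscale_def by (metis mult.assoc single_0_central)
qed

context scaled_ring
begin

lemma ev_pscale: "ev \<theta> (pscale c f) = c *s ev \<theta> f"
  unfolding pscale_sum_monomials by (simp add: ev_sum scale_sum_right) (simp add: ev_def scale_sum_right)

end

lemma lookup_pscale: "lookup (pscale c f) w = c * lookup f w"
  unfolding pscale_sum_monomials by (simp add: lookup_sum lookup_single when_def sum.delta in_keys_iff)

section \<open>Linear operators on function spaces\<close>

text \<open>A type of its own, so that operators form a type-class ring. The functions may have
  infinite support, which makes the constant function 1 available as a test vector.\<close>

typedef (overloaded) ('b, 'r::field) linop =
  "{T :: ('b \<Rightarrow> 'r) \<Rightarrow> 'b \<Rightarrow> 'r.
     (\<forall>f g. T (\<lambda>p. f p + g p) = (\<lambda>p. T f p + T g p)) \<and> (\<forall>c f. T (\<lambda>p. c * f p) = (\<lambda>p. c * T f p))}"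
  morphisms app Linop
  by (rule exI[of _ id]) simp

setup_lifting type_definition_linop

lemma linop_eqI: "(\<And>h p. app S h p = app T h p) \<Longrightarrow> S = T"
  by (rule app_inject[THEN iffD1]) blast

instantiation linop :: (type, field) ring_1
begin

lift_definition zero_linop :: "('a, 'b) linop" is "\<lambda>h p. 0" by simp
lift_definition one_linop :: "('a, 'b) linop" is "\<lambda>h. h" by simp
lift_definition plus_linop :: "('a, 'b) linop \<Rightarrow> ('a, 'b) linop \<Rightarrow> ('a, 'b) linop"
  is "\<lambda>S T h p. S h p + T h p" by (simp add: algebra_simps)
lift_definition minus_linop :: "('a, 'b) linop \<Rightarrow> ('a, 'b) linop \<Rightarrow> ('a, 'b) linop"
  is "\<lambda>S T h p. S h p - T h p" by (simp add: algebra_simps)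
lift_definition uminus_linop :: "('a, 'b) linop \<Rightarrow> ('a, 'b) linop"
  is "\<lambda>T h p. - T h p" by (simp add: algebra_simps)
lift_definition times_linop :: "('a, 'b) linop \<Rightarrow> ('a, 'b) linop \<Rightarrow> ('a, 'b) linop"
  is "\<lambda>S T h. S (T h)" by simp

instance
proof
  fix S T U :: "('a, 'b) linop"
  show "S + T + U = S + (T + U)" "S + T = T + S" "0 + T = T" "- T + T = 0" "S - T = S + - T"
    "S * T * U = S * (T * U)" "1 * T = T" "T * 1 = T" "(S + T) * U = S * U + T * U"
    by (transfer; simp add: fun_eq_iff)+
  show "S * (T + U) = S * T + S * U"
    by transfer simp
  show "(0::('a, 'b) linop) \<noteq> 1"
    by transfer (auto simp: fun_eq_iff intro!: exI[of _ "\<lambda>_. 1"])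
qed

end

lift_definition oscale :: "'r::field \<Rightarrow> ('b, 'r) linop \<Rightarrow> ('b, 'r) linop"
  is "\<lambda>c T h p. c * T h p" by (simp add: algebra_simps)

text \<open>Operators act by precomposition, so in a product the left factor moves the point first,
  in the reading order of words.\<close>

lift_definition pcomp :: "'b set \<Rightarrow> ('b \<Rightarrow> 'b) \<Rightarrow> ('b, 'r::field) linop"
  is "\<lambda>D \<phi> h p. if p \<in> D then h (\<phi> p) else 0" by (simp add: fun_eq_iff)

lemma app_simps [simp]:
  "app 0 h p = 0" "app 1 h = h" "app (S + T) h p = app S h p + app T h p"
  "app (S - T) h p = app S h p - app T h p" "app (- T) h p = - app T h p"
  "app (S * T) h = app S (app T h)" "app (oscale c T) h p = c * app T h p"
  "app (pcomp D \<phi>) h p = (if p \<in> D then h (\<phi> p) else 0)"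
  by (transfer; simp)+

lemma app_sum: "app (sum T A) h p = (\<Sum>i\<in>A. app (T i) h p)"
  by (induction A rule: infinite_finite_induct) simp_all

interpretation lo: scaled_ring "oscale :: 'r::field \<Rightarrow> ('b, 'r) linop \<Rightarrow> _"
proof
  fix a b :: 'r and x y :: "('b, 'r) linop"
  show "x * oscale a y = oscale a (x * y)"
    by transfer simp
qed (rule linop_eqI, simp add: algebra_simps)+

lemma pcomp_mult: "pcomp D \<phi> * pcomp D' \<psi> = pcomp {p \<in> D. \<phi> p \<in> D'} (\<lambda>p. \<psi> (\<phi> p))"
  by (rule linop_eqI) simp

lemma pcomp_cong: "D = D' \<Longrightarrow> (\<And>p. p \<in> D' \<Longrightarrow> \<phi> p = \<psi> p) \<Longrightarrow> pcomp D \<phi> = pcomp D' \<psi>"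
  by (rule linop_eqI) simp

lemma pcomp_empty [simp]: "pcomp {} \<phi> = 0"
  by (rule linop_eqI) simp

section \<open>Algebras given by subsets of a ring\<close>

definition alg :: "('r::field \<Rightarrow> 'b::ring \<Rightarrow> 'b) \<Rightarrow> 'b set \<Rightarrow> ('r, 'b) module" where
  "alg sc N = \<lparr>carrier = N, mult = (*), one = 0, zero = 0, add = (+), smult = sc\<rparr>"

lemma alg_simps [simp]:
  "carrier (alg sc N) = N" "mult (alg sc N) = (*)" "zero (alg sc N) = 0"
  "add (alg sc N) = (+)" "smult (alg sc N) = sc"
  by (simp_all add: alg_def)

text \<open>Closure of \<open>A\<close> under its operations is part of the notion, so that the
  inverse map is again such an isomorphism without further assumptions.\<close>

definition alg_iso :: "('r::field, 'm) module \<Rightarrow> ('r, 'n) module \<Rightarrow> ('m \<Rightarrow> 'n) \<Rightarrow> bool" where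
  "alg_iso A B \<psi> \<longleftrightarrow> bij_betw \<psi> (carrier A) (carrier B) \<and>
     (\<forall>x\<in>carrier A. \<forall>y\<in>carrier A. x \<oplus>\<^bsub>A\<^esub> y \<in> carrier A \<and> \<psi> (x \<oplus>\<^bsub>A\<^esub> y) = \<psi> x \<oplus>\<^bsub>B\<^esub> \<psi> y) \<and>
     (\<forall>x\<in>carrier A. \<forall>y\<in>carrier A. x \<otimes>\<^bsub>A\<^esub> y \<in> carrier A \<and> \<psi> (x \<otimes>\<^bsub>A\<^esub> y) = \<psi> x \<otimes>\<^bsub>B\<^esub> \<psi> y) \<and>
     (\<forall>c. \<forall>x\<in>carrier A. c \<odot>\<^bsub>A\<^esub> x \<in> carrier A \<and> \<psi> (c \<odot>\<^bsub>A\<^esub> x) = c \<odot>\<^bsub>B\<^esub> \<psi> x) \<and>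
     \<zero>\<^bsub>A\<^esub> \<in> carrier A \<and> \<psi> \<zero>\<^bsub>A\<^esub> = \<zero>\<^bsub>B\<^esub>"

lemma alg_isoD:
  assumes "alg_iso A B \<psi>"
  shows "bij_betw \<psi> (carrier A) (carrier B)"
    and "x \<in> carrier A \<Longrightarrow> y \<in> carrier A \<Longrightarrow> x \<oplus>\<^bsub>A\<^esub> y \<in> carrier A"
    and "x \<in> carrier A \<Longrightarrow> y \<in> carrier A \<Longrightarrow> x \<otimes>\<^bsub>A\<^esub> y \<in> carrier A"
    and "x \<in> carrier A \<Longrightarrow> c \<odot>\<^bsub>A\<^esub> x \<in> carrier A"
    and "x \<in> carrier A \<Longrightarrow> y \<in> carrier A \<Longrightarrow> \<psi> (x \<oplus>\<^bsub>A\<^esub> y) = \<psi> x \<oplus>\<^bsub>B\<^esub> \<psi> y"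
    and "x \<in> carrier A \<Longrightarrow> y \<in> carrier A \<Longrightarrow> \<psi> (x \<otimes>\<^bsub>A\<^esub> y) = \<psi> x \<otimes>\<^bsub>B\<^esub> \<psi> y"
    and "x \<in> carrier A \<Longrightarrow> \<psi> (c \<odot>\<^bsub>A\<^esub> x) = c \<odot>\<^bsub>B\<^esub> \<psi> x"
    and "\<zero>\<^bsub>A\<^esub> \<in> carrier A" and "\<psi> \<zero>\<^bsub>A\<^esub> = \<zero>\<^bsub>B\<^esub>"
    and "x \<in> carrier A \<Longrightarrow> \<psi> x \<in> carrier B"
  using assms by (auto simp: alg_iso_def bij_betw_def)

lemma alg_iso_inv:
  assumes "alg_iso A B \<psi>"
  shows "alg_iso B A (inv_into (carrier A) \<psi>)" (is "alg_iso B A ?\<chi>")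
proof -
  note D = alg_isoD[OF assms]
  have inj: "inj_on \<psi> (carrier A)" using D(1) by (rule bij_betw_imp_inj_on)
  have B: "carrier B = \<psi> ` carrier A" using D(1) by (simp add: bij_betw_def)
  have inv: "?\<chi> (\<psi> x) = x" if "x \<in> carrier A" for x
    using inj that by (rule inv_into_f_f)
  show ?thesis
    unfolding alg_iso_def
    using bij_betw_inv_into[OF D(1)] D(2-4,8) D(5-7,9)[symmetric] inv
    by (auto simp: B simp del: D(9) simp flip: D(9))
qed

lemma subspace_iso:
  assumes "alg_iso A B \<psi>" "subspace A V"
  shows "subspace B (\<psi> ` V)"
proof -
  note D = alg_isoD[OF assms(1)]
  from assms(2) have V: "V \<subseteq> carrier A" by (simp add: subspace_def)
  then have [simp]: "x \<in> V \<Longrightarrow> x \<in> carrier A" for x by blast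
  show ?thesis
    using assms(2) unfolding subspace_def
    by (auto simp: D(10) simp flip: D(5,7,9))
qed

lemma left_ideal_iso:
  assumes "alg_iso A B \<psi>" "left_ideal A V"
  shows "left_ideal B (\<psi> ` V)"
proof -
  note D = alg_isoD[OF assms(1)]
  have B: "carrier B = \<psi> ` carrier A" using D(1) by (simp add: bij_betw_def)
  from assms(2) have V: "V \<subseteq> carrier A" by (simp add: left_ideal_def subspace_def)
  then have [simp]: "x \<in> V \<Longrightarrow> x \<in> carrier A" for x by blast
  show ?thesis
    using assms(2) subspace_iso[OF assms(1)] unfolding left_ideal_def
    by (auto simp: B simp flip: D(6))
qed

lemma iso_inv_image:
  assumes "alg_iso A B \<psi>" "V \<subseteq> carrier A"
  shows "inv_into (carrier A) \<psi> ` \<psi> ` V = V"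
  using assms alg_isoD(1)[OF assms(1)] by (simp add: bij_betw_def image_inv_into_cancel inv_into_image_cancel)

lemma iso_image_inv:
  assumes "alg_iso A B \<psi>" "V \<subseteq> carrier B"
  shows "\<psi> ` inv_into (carrier A) \<psi> ` V = V"
  using assms alg_isoD(1)[OF assms(1)] by (simp add: bij_betw_def image_inv_into_cancel)

lemma minimal_left_ideal_subset_carrier: "minimal_left_ideal A J \<Longrightarrow> J \<subseteq> carrier A"
  by (simp add: minimal_left_ideal_def left_ideal_def subspace_def)

lemma minimal_left_ideal_iso:
  assumes iso: "alg_iso A B \<psi>" and J: "minimal_left_ideal A J"
  shows "minimal_left_ideal B (\<psi> ` J)"
proof -
  let ?\<chi> = "inv_into (carrier A) \<psi>"
  have JA: "J \<subseteq> carrier A"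
    using J by (rule minimal_left_ideal_subset_carrier)
  have zero: "?\<chi> ` {\<zero>\<^bsub>B\<^esub>} = {\<zero>\<^bsub>A\<^esub>}" "\<psi> ` {\<zero>\<^bsub>A\<^esub>} = {\<zero>\<^bsub>B\<^esub>}"
    using alg_isoD(9)[OF alg_iso_inv[OF iso]] alg_isoD(9)[OF iso] by simp_all
  have "K = {\<zero>\<^bsub>B\<^esub>} \<or> K = \<psi> ` J" if K: "left_ideal B K" "K \<subseteq> \<psi> ` J" for K
  proof -
    have KB: "K \<subseteq> carrier B" using K by (simp add: left_ideal_def subspace_def)
    have "?\<chi> ` K \<subseteq> J" using K(2) iso_inv_image[OF iso JA] by blast
    then have "?\<chi> ` K = {\<zero>\<^bsub>A\<^esub>} \<or> ?\<chi> ` K = J"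
      using left_ideal_iso[OF alg_iso_inv[OF iso] K(1)] J by (simp add: minimal_left_ideal_def)
    then show ?thesis
      using iso_image_inv[OF iso KB] zero by metis
  qed
  moreover have "\<psi> ` J \<noteq> {\<zero>\<^bsub>B\<^esub>}"
    using J iso_inv_image[OF iso JA] zero unfolding minimal_left_ideal_def by metis
  ultimately show ?thesis
    using J left_ideal_iso[OF iso] by (auto simp: minimal_left_ideal_def)
qed

lemma lin_span_iso_subset:
  assumes iso: "alg_iso A B \<psi>" and S: "S \<subseteq> carrier A"
  shows "lin_span B (\<psi> ` S) \<subseteq> \<psi> ` lin_span A S"
proof -
  have "subspace A (carrier A)"
    using alg_isoD[OF iso] by (simp add: subspace_def)
  then have "subspace A (lin_span A S)" "S \<subseteq> lin_span A S"
    using S by (auto simp: lin_span_def subspace_def)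
  then show ?thesis
    using subspace_iso[OF iso] unfolding lin_span_def[of B] by blast
qed

lemma lin_span_iso:
  assumes iso: "alg_iso A B \<psi>" and S: "S \<subseteq> carrier A"
  shows "\<psi> ` lin_span A S = lin_span B (\<psi> ` S)"
proof -
  let ?\<chi> = "inv_into (carrier A) \<psi>"
  have "?\<chi> ` \<psi> ` S = S" by (rule iso_inv_image[OF iso S])
  moreover have SB: "\<psi> ` S \<subseteq> carrier B" using S alg_isoD(10)[OF iso] by blast
  ultimately have 1: "lin_span A S \<subseteq> ?\<chi> ` lin_span B (\<psi> ` S)"
    using lin_span_iso_subset[OF alg_iso_inv[OF iso] SB] by simp
  have "subspace B (carrier B)"
    using alg_isoD[OF alg_iso_inv[OF iso]] by (simp add: subspace_def)
  then have "lin_span B (\<psi> ` S) \<subseteq> carrier B"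
    using SB by (auto simp: lin_span_def)
  then show ?thesis
    using 1 lin_span_iso_subset[OF iso S] iso_image_inv[OF iso] by blast
qed

lemma socle_iso:
  assumes iso: "alg_iso A B \<psi>"
  shows "\<psi> ` socle A = socle B"
proof -
  have "image \<psi> ` {J. minimal_left_ideal A J} = {J. minimal_left_ideal B J}"
  proof (intro equalityI subsetI)
    fix J assume "J \<in> {J. minimal_left_ideal B J}"
    then have J: "minimal_left_ideal B J" by simp
    have "J = \<psi> ` inv_into (carrier A) \<psi> ` J"
      using iso_image_inv[OF iso minimal_left_ideal_subset_carrier[OF J]] by simp
    then show "J \<in> image \<psi> ` {J. minimal_left_ideal A J}"
      using minimal_left_ideal_iso[OF alg_iso_inv[OF iso] J] by blast
  qed (use minimal_left_ideal_iso[OF iso] in blast)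
  then have "\<psi> ` \<Union>{J. minimal_left_ideal A J} = \<Union>{J. minimal_left_ideal B J}"
    by (metis image_Union)
  moreover have "\<Union>{J. minimal_left_ideal A J} \<subseteq> carrier A"
    using minimal_left_ideal_subset_carrier by fast
  ultimately show ?thesis
    unfolding socle_def using lin_span_iso[OF iso, of "\<Union>{J. minimal_left_ideal A J}"] by simp
qed

lemma (in scaled_ring) subspace_alg:
  "Defs.subspace (alg scale N) V \<longleftrightarrow> V \<subseteq> N \<and> subspace V"
  by (auto simp: Defs.subspace_def subspace_def)

section \<open>Presented algebras\<close>

lemma free_algebra_simps [simp]:
  "mult (free_algebra G) = (*)" "one (free_algebra G) = 1" "zero (free_algebra G) = 0"
  "add (free_algebra G) = (+)" "smult (free_algebra G) = pscale"
  by (auto simp: free_algebra_def pscale_def fun_eq_iff)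

lemma keys_pscale: "keys (pscale c f) \<subseteq> keys f"
  by (auto simp: in_keys_iff lookup_pscale)

lemma free_algebra_closed:
  shows "0 \<in> carrier (free_algebra G)" and "1 \<in> carrier (free_algebra G)"
    and "f \<in> carrier (free_algebra G) \<Longrightarrow> g \<in> carrier (free_algebra G) \<Longrightarrow> f + g \<in> carrier (free_algebra G)"
    and "f \<in> carrier (free_algebra G) \<Longrightarrow> g \<in> carrier (free_algebra G) \<Longrightarrow> f - g \<in> carrier (free_algebra G)"
    and "f \<in> carrier (free_algebra G) \<Longrightarrow> g \<in> carrier (free_algebra G) \<Longrightarrow> f * g \<in> carrier (free_algebra G)"
    and "f \<in> carrier (free_algebra G) \<Longrightarrow> pscale c f \<in> carrier (free_algebra G)"
    and "a \<in> G \<Longrightarrow> gen a \<in> carrier (free_algebra G)"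
proof -
  show "0 \<in> carrier (free_algebra G)" "1 \<in> carrier (free_algebra G)"
    by (auto simp: free_algebra_def zero_free_monoid_def)
  show "f + g \<in> carrier (free_algebra G)" "f - g \<in> carrier (free_algebra G)"
    if "f \<in> carrier (free_algebra G)" "g \<in> carrier (free_algebra G)"
    using that Poly_Mapping.keys_add[of f g] keys_diff[of f g] by (fastforce simp: free_algebra_def)+
  show "f * g \<in> carrier (free_algebra G)"
    if "f \<in> carrier (free_algebra G)" "g \<in> carrier (free_algebra G)"
    using that Poly_Mapping.keys_mult[of f g] by (fastforce simp: free_algebra_def plus_free_monoid_def)
  show "pscale c f \<in> carrier (free_algebra G)" if "f \<in> carrier (free_algebra G)"
    using that keys_pscale[of c f] by (fastforce simp: free_algebra_def)
  show "gen a \<in> carrier (free_algebra G)" if "a \<in> G"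
    using that by (simp add: free_algebra_def gen_def)
qed

lemma prod_list_gen: "prod_list (map gen w) = single (Word w) 1"
  by (induction w) (simp_all add: gen_def mult_single plus_free_monoid_def zero_free_monoid_def flip: single_one)

section \<open>Congruence modulo an ideal of a free algebra\<close>

text \<open>The retraction onto the free algebra over \<open>G\<close> that kills every word
  containing a foreign letter; it is multiplicative because a concatenation lies over
  \<open>G\<close> exactly if both parts do.\<close>

definition ret :: "'g set \<Rightarrow> ('r::field, 'g) ncpoly \<Rightarrow> ('r, 'g) ncpoly" where
  "ret G = pm.ev (\<lambda>w. if set (letters w) \<subseteq> G then single w 1 else 0)"

lemma ret_add: "ret G (f + g) = ret G f + ret G g"
  and ret_diff: "ret G (f - g) = ret G f - ret G g"
  and ret_pscale: "ret G (pscale c f) = pscale c (ret G f)"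
  by (simp_all add: ret_def pm.ev_add pm.ev_diff pm.ev_pscale)

lemma ret_mult: "ret G (f * g) = ret G f * ret G g"
  unfolding ret_def by (rule pm.ev_mult) (simp add: mult_single plus_free_monoid_def)

lemma ret_carrier: "f \<in> carrier (free_algebra G) \<Longrightarrow> ret G f = f"
proof -
  assume f: "f \<in> carrier (free_algebra G)"
  have "ret G f = (\<Sum>w\<in>keys f. single w (lookup f w))"
    unfolding ret_def pm.ev_def
    by (intro sum.cong refl) (use f in \<open>auto simp: free_algebra_def pscale_def mult_single\<close>)
  then show ?thesis by (simp add: poly_mapping_sum_monomials)
qed

lemma ret_in_carrier:
  fixes f :: "('b::field, 'a) ncpoly"
  shows "ret G f \<in> carrier (free_algebra G)"
proof -
  have sum: "finite A \<Longrightarrow> (\<And>i. i \<in> A \<Longrightarrow> h i \<in> carrier (free_algebra G)) \<Longrightarrow> sum h A \<in> carrier (free_algebra G)"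
    for h :: "_ \<Rightarrow> ('b, 'a) ncpoly" and A :: "'a free_monoid set"
    by (induction A rule: finite_induct) (auto simp: free_algebra_closed)
  show ?thesis
    unfolding ret_def pm.ev_def
  proof (rule sum)
    fix w
    have "(if set (letters w) \<subseteq> G then single w 1 else 0) \<in> carrier (free_algebra G)"
      by (auto simp: free_algebra_def)
    then show "pscale (lookup f w) (if set (letters w) \<subseteq> G then single w 1 else 0)
        \<in> carrier (free_algebra G)"
      by (rule free_algebra_closed)
  qed simp
qed

locale free_algebra_ideal =
  fixes G :: "'g set" and J :: "('r::field, 'g) ncpoly set"
  assumes J_0: "0 \<in> J" and J_add: "f \<in> J \<Longrightarrow> g \<in> J \<Longrightarrow> f + g \<in> J"
    and J_scale: "f \<in> J \<Longrightarrow> pscale c f \<in> J"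
    and J_left: "f \<in> J \<Longrightarrow> g \<in> carrier (free_algebra G) \<Longrightarrow> g * f \<in> J"
    and J_right: "f \<in> J \<Longrightarrow> g \<in> carrier (free_algebra G) \<Longrightarrow> f * g \<in> J"
begin

text \<open>Applying \<^const>\<open>ret\<close> first frees the congruence rules from side conditions.\<close>

definition cong :: "('r, 'g) ncpoly \<Rightarrow> ('r, 'g) ncpoly \<Rightarrow> bool" (infix \<open>\<approx>\<close> 50) where
  "f \<approx> g \<longleftrightarrow> ret G (f - g) \<in> J"

lemma cong_refl [simp]: "f \<approx> f"
  using J_0 by (simp add: cong_def ret_def)

lemma cong_sym: "f \<approx> g \<Longrightarrow> g \<approx> f"
  using J_scale[of "ret G (f - g)" "-1"] by (simp add: cong_def ret_diff)

lemma cong_trans [trans]: "f \<approx> g \<Longrightarrow> g \<approx> h \<Longrightarrow> f \<approx> h"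
  using J_add[of "ret G (f - g)" "ret G (g - h)"] by (simp add: cong_def ret_diff)

lemma cong_add: "f \<approx> f' \<Longrightarrow> g \<approx> g' \<Longrightarrow> f + g \<approx> f' + g'"
  using J_add[of "ret G (f - f')" "ret G (g - g')"] by (simp add: cong_def ret_diff ret_add algebra_simps)

lemma cong_scale: "f \<approx> f' \<Longrightarrow> pscale c f \<approx> pscale c f'"
  using J_scale[of "ret G (f - f')" c]
  by (simp add: cong_def ret_diff ret_pscale pm.scale_right_diff_distrib)

lemma cong_mult_left: "f \<approx> f' \<Longrightarrow> h * f \<approx> h * f'"
  using J_left[of "ret G (f - f')", OF _ ret_in_carrier, of h]
  by (simp add: cong_def ret_diff ret_mult algebra_simps)

lemma cong_mult_right: "f \<approx> f' \<Longrightarrow> f * h \<approx> f' * h"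
  using J_right[of "ret G (f - f')", OF _ ret_in_carrier, of h]
  by (simp add: cong_def ret_diff ret_mult algebra_simps)

lemma cong_mult: "f \<approx> f' \<Longrightarrow> g \<approx> g' \<Longrightarrow> f * g \<approx> f' * g'"
  using cong_mult_left cong_mult_right cong_trans by blast

lemmas cong_intros = cong_mult cong_refl

lemma cong_diff: "f \<approx> f' \<Longrightarrow> g \<approx> g' \<Longrightarrow> f - g \<approx> f' - g'"
  using cong_add[of f f' "pscale (-1) g" "pscale (-1) g'"] cong_scale[of g g' "-1"] by simp

lemma cong_sum: "(\<And>i. i \<in> A \<Longrightarrow> f i \<approx> g i) \<Longrightarrow> sum f A \<approx> sum g A"
  by (induction A rule: infinite_finite_induct) (simp_all add: cong_add)

lemma cong_0_iff: "f \<in> carrier (free_algebra G) \<Longrightarrow> f \<approx> 0 \<longleftrightarrow> f \<in> J"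
  by (simp add: cong_def ret_carrier)

lemma cong_relator: "f - g \<in> J \<Longrightarrow> f - g \<in> carrier (free_algebra G) \<Longrightarrow> f \<approx> g"
  by (simp add: cong_def ret_carrier)

end

text \<open>Covers the unital and the non-unital free algebra at once: by
  \<open>carrier_unit\<close>, the carrier of \<open>F\<close> together with the constants is the
  whole free algebra.\<close>

locale algebra_presentation =
  fixes F :: "('r::field, ('r, 'g) ncpoly) module" and G :: "'g set" and S :: "('r, 'g) ncpoly set"
  assumes F: "F = (free_algebra G)\<lparr>carrier := carrier F\<rparr>"
    and closed: "0 \<in> carrier F"
      "f \<in> carrier F \<Longrightarrow> g \<in> carrier F \<Longrightarrow> f + g \<in> carrier F"
      "f \<in> carrier F \<Longrightarrow> g \<in> carrier F \<Longrightarrow> f * g \<in> carrier F"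
      "f \<in> carrier F \<Longrightarrow> pscale c f \<in> carrier F"
    and relators: "S \<subseteq> carrier F"
    and carrier_subset: "carrier F \<subseteq> carrier (free_algebra G)"
    and carrier_unit: "g \<in> carrier (free_algebra G) \<Longrightarrow> \<exists>c. g - pscale c 1 \<in> carrier F"
begin

lemma F_simps [simp]:
  "mult F = (*)" "zero F = 0" "add F = (+)" "smult F = pscale"
  by (subst F; simp)+

lemma diff_closed: "f \<in> carrier F \<Longrightarrow> g \<in> carrier F \<Longrightarrow> f - g \<in> carrier F"
  using closed(2)[of f "pscale (-1) g"] closed(4)[of g "-1"] by simp

lemma gen_ideal_subset: "gen_ideal F S \<subseteq> carrier F"
proof -
  have "two_sided_ideal F (carrier F)"
    using closed by (simp add: two_sided_ideal_def left_ideal_def Defs.subspace_def)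
  then show ?thesis
    using relators by (auto simp: gen_ideal_def)
qed

lemma gen_ideal_two_sided: "two_sided_ideal F (gen_ideal F S)"
  using gen_ideal_subset
  by (auto simp: two_sided_ideal_def left_ideal_def Defs.subspace_def gen_ideal_def)

sublocale free_algebra_ideal G "gen_ideal F S"
proof
  note ideal = gen_ideal_two_sided[unfolded two_sided_ideal_def left_ideal_def Defs.subspace_def, simplified]
  fix f g assume f: "f \<in> gen_ideal F S"
  show "g \<in> gen_ideal F S \<Longrightarrow> f + g \<in> gen_ideal F S" using ideal f by blast
  show scale: "pscale c f \<in> gen_ideal F S" for c using ideal f by blast
  assume "g \<in> carrier (free_algebra G)"
  \<comment> \<open>An ideal of \<open>F\<close> is closed under scalars, so the constant part of
    the multiplier can be split off and treated as a scalar.\<close>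
  then obtain c where c: "g - pscale c 1 \<in> carrier F" using carrier_unit by blast
  have "(g - pscale c 1) * f + pscale c f \<in> gen_ideal F S" "f * (g - pscale c 1) + pscale c f \<in> gen_ideal F S"
    using ideal f c scale by blast+
  then show "g * f \<in> gen_ideal F S" "f * g \<in> gen_ideal F S"
    by (simp_all add: algebra_simps pm.scale_mult_left pm.scale_mult_right)
qed (use gen_ideal_two_sided in \<open>auto simp: two_sided_ideal_def left_ideal_def Defs.subspace_def\<close>)

notation cong (infix \<open>\<approx>\<close> 50)

lemma relator_cong: "f - g \<in> S \<Longrightarrow> f \<approx> g"
  by (rule cong_relator) (use relators carrier_subset in \<open>auto simp: gen_ideal_def\<close>)

end

locale evaluation = scaled_ring scale + algebra_presentation F G S
  for scale :: "'r::field \<Rightarrow> 'b::ring \<Rightarrow> 'b" and F :: "('r, ('r, 'g) ncpoly) module" and G S +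
  fixes \<theta> :: "'g free_monoid \<Rightarrow> 'b"
  assumes \<theta>: "\<theta> (u + v) = \<theta> u * \<theta> v"
    and ev_relator: "f \<in> S \<Longrightarrow> ev \<theta> f = 0"
begin

lemma gen_ideal_ev: "f \<in> gen_ideal F S \<Longrightarrow> ev \<theta> f = 0"
proof -
  have "two_sided_ideal F {f \<in> carrier F. ev \<theta> f = 0}"
    using closed
    by (auto simp: two_sided_ideal_def left_ideal_def Defs.subspace_def ev_add ev_mult[OF \<theta>] ev_pscale)
  then have "gen_ideal F S \<subseteq> {f \<in> carrier F. ev \<theta> f = 0}"
    using relators ev_relator by (auto simp: gen_ideal_def)
  then show "f \<in> gen_ideal F S \<Longrightarrow> ev \<theta> f = 0" by blast
qed

lemma cong_ev:
  assumes "f \<approx> g" "f \<in> carrier (free_algebra G)" "g \<in> carrier (free_algebra G)"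
  shows "ev \<theta> f = ev \<theta> g"
  using gen_ideal_ev[of "f - g"] assms by (simp add: cong_def ret_diff ret_carrier ev_diff)

end

locale faithful_evaluation = evaluation scale F G S \<theta>
  for scale :: "'r::field \<Rightarrow> 'b::ring \<Rightarrow> 'b" (infixr \<open>*s\<close> 75) and F :: "('r, ('r, 'g) ncpoly) module" and G S \<theta> +
  assumes faithful: "f \<in> carrier F \<Longrightarrow> ev \<theta> f = 0 \<Longrightarrow> f \<in> gen_ideal F S"
begin

text \<open>Evaluation is constant on each coset, so the image of a coset is a singleton.\<close>

definition image_map :: "('r, 'g) ncpoly set \<Rightarrow> 'b" where
  "image_map C = the_elem (ev \<theta> ` C)"

lemma gen_ideal_eq: "gen_ideal F S = {f \<in> carrier F. ev \<theta> f = 0}"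
  using gen_ideal_ev faithful gen_ideal_subset by blast

text \<open>By faithfulness the cosets are exactly these fibres; operations on cosets then reduce to
  equations between values.\<close>

definition fibre :: "'b \<Rightarrow> ('r, 'g) ncpoly set" where
  "fibre b = {f \<in> carrier F. ev \<theta> f = b}"

lemma coset_eq:
  assumes "f \<in> carrier F"
  shows "gen_ideal F S +>\<^bsub>F\<^esub> f = fibre (ev \<theta> f)"
proof -
  have "g \<in> (\<lambda>h. h + f) ` {h \<in> carrier F. ev \<theta> h = 0}" if "g \<in> carrier F" "ev \<theta> g = ev \<theta> f" for g
    by (rule image_eqI[of _ _ "g - f"]) (use that assms diff_closed in \<open>auto simp: ev_diff\<close>)
  then show ?thesis
    using assms closed(2) by (auto simp: a_r_coset_def' gen_ideal_eq fibre_def ev_add)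
qed

lemma pres_class_eq: "f \<in> carrier F \<Longrightarrow> pres_class F S f = fibre (ev \<theta> f)"
  by (simp add: pres_class_def coset_eq)

lemma carrier_presented: "carrier (presented_algebra F S) = fibre ` ev \<theta> ` carrier F"
  by (auto simp: presented_algebra_def quotient_algebra_def A_RCOSETS_def' coset_eq)

lemma image_map_fibre: "b \<in> ev \<theta> ` carrier F \<Longrightarrow> image_map (fibre b) = b"
proof -
  assume "b \<in> ev \<theta> ` carrier F"
  then have "ev \<theta> ` fibre b = {b}" by (auto simp: fibre_def)
  then show ?thesis by (simp add: image_map_def)
qed

lemma image_map_pres_class: "f \<in> carrier F \<Longrightarrow> image_map (pres_class F S f) = ev \<theta> f"
  by (simp add: pres_class_eq image_map_fibre)

lemma pres_class_carrier: "f \<in> carrier F \<Longrightarrow> pres_class F S f \<in> carrier (presented_algebra F S)"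
  by (simp add: pres_class_eq carrier_presented)

text \<open>Multiplication and scaling of cosets are unions over representatives. All members of
  such a union are the same fibre, so it suffices that the index sets are nonempty. For sums, a
  given \<open>h\<close> is split as \<open>f + (h - f)\<close>.\<close>

lemma presented_ops:
  assumes "f \<in> carrier F" "g \<in> carrier F"
  shows "fibre (ev \<theta> f) \<oplus>\<^bsub>presented_algebra F S\<^esub> fibre (ev \<theta> g) = fibre (ev \<theta> (f + g))"
    and "fibre (ev \<theta> f) \<otimes>\<^bsub>presented_algebra F S\<^esub> fibre (ev \<theta> g) = fibre (ev \<theta> (f * g))"
    and "c \<odot>\<^bsub>presented_algebra F S\<^esub> fibre (ev \<theta> f) = fibre (ev \<theta> (pscale c f))"
    and "\<zero>\<^bsub>presented_algebra F S\<^esub> = fibre (ev \<theta> 0)"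
proof -
  have "h \<in> fibre (ev \<theta> f) <+>\<^bsub>F\<^esub> fibre (ev \<theta> g)" if "h \<in> fibre (ev \<theta> (f + g))" for h
  proof -
    have "h = f + (h - f)" "f \<in> fibre (ev \<theta> f)" "h - f \<in> fibre (ev \<theta> g)"
      using that assms diff_closed by (auto simp: fibre_def ev_diff ev_add)
    then show ?thesis
      unfolding set_add_def' by (simp, intro bexI[of _ f] bexI[of _ "h - f"]) auto
  qed
  then show "fibre (ev \<theta> f) \<oplus>\<^bsub>presented_algebra F S\<^esub> fibre (ev \<theta> g) = fibre (ev \<theta> (f + g))"
    using closed(2)
    by (auto simp: presented_algebra_def quotient_algebra_def set_add_def' fibre_def ev_add)
  have "rcoset_mult F (gen_ideal F S) (fibre (ev \<theta> f)) (fibre (ev \<theta> g)) =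
      (\<Union>a\<in>fibre (ev \<theta> f). \<Union>b\<in>fibre (ev \<theta> g). fibre (ev \<theta> (f * g)))"
    unfolding rcoset_mult_def
    by (intro SUP_cong refl) (auto simp: coset_eq fibre_def closed(3) ev_mult[OF \<theta>])
  moreover have "f \<in> fibre (ev \<theta> f)" "g \<in> fibre (ev \<theta> g)"
    using assms by (auto simp: fibre_def)
  ultimately show "fibre (ev \<theta> f) \<otimes>\<^bsub>presented_algebra F S\<^esub> fibre (ev \<theta> g) = fibre (ev \<theta> (f * g))"
    by (auto simp: presented_algebra_def quotient_algebra_def)
  have "(\<Union>b\<in>fibre (ev \<theta> f). gen_ideal F S +>\<^bsub>F\<^esub> pscale c b) = (\<Union>b\<in>fibre (ev \<theta> f). fibre (ev \<theta> (pscale c f)))"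
    by (intro SUP_cong refl) (auto simp: coset_eq fibre_def closed(4) ev_pscale)
  with \<open>f \<in> fibre (ev \<theta> f)\<close> show "c \<odot>\<^bsub>presented_algebra F S\<^esub> fibre (ev \<theta> f) = fibre (ev \<theta> (pscale c f))"
    by (auto simp: presented_algebra_def quotient_algebra_def)
  show "\<zero>\<^bsub>presented_algebra F S\<^esub> = fibre (ev \<theta> 0)"
    by (auto simp: presented_algebra_def quotient_algebra_def gen_ideal_eq fibre_def)
qed

lemma presented_alg_iso: "alg_iso (presented_algebra F S) (alg scale (ev \<theta> ` carrier F)) image_map"
proof -
  have "bij_betw image_map (fibre ` ev \<theta> ` carrier F) (ev \<theta> ` carrier F)"
    by (rule bij_betw_byWitness[of _ fibre]) (auto simp: image_map_fibre)
  moreover have "0 \<in> ev \<theta> ` carrier F"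
    using closed(1) by (rule image_eqI[rotated]) simp
  ultimately show ?thesis
    unfolding alg_iso_def carrier_presented
    using closed
    by (auto simp: presented_ops image_map_fibre) (auto simp: ev_add ev_mult[OF \<theta>] ev_pscale)
qed

end

section \<open>The shift space and its Boolean algebra\<close>

type_synonym ('a, 'r) seq_op = "((nat \<Rightarrow> 'a) \<times> int, 'r) linop"

text \<open>What is extracted from a subshift: invariance under deleting the first letter and, as
  every letter occurs, extendability of each letter to a point of \<open>X\<close>.\<close>

locale shift_space =
  fixes X :: "(nat \<Rightarrow> 'a) set"
  assumes shift: "a ## x \<in> X \<Longrightarrow> x \<in> X"
    and letter: "\<exists>x. a ## x \<in> X"
begin

lemma conc_shift: "\<alpha> \<frown> x \<in> X \<Longrightarrow> x \<in> X"
  by (induction \<alpha>) (auto dest: shift)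

lemma suffix_closed: "x \<in> X \<Longrightarrow> suffix n x \<in> X"
  using conc_shift[of "prefix n x" "suffix n x"] by simp

text \<open>Shift invariance moves an occurrence of a word to the front of a point of
  \<open>X\<close>.\<close>

lemma lang_iff: "\<alpha> \<in> lang X \<longleftrightarrow> (\<exists>x. \<alpha> \<frown> x \<in> X)"
proof
  assume "\<alpha> \<in> lang X"
  then obtain x i j where x: "x \<in> X" and \<alpha>: "\<alpha> = subsequence x i j"
    by (auto simp: lang_def occurs_in_def)
  show "\<exists>x. \<alpha> \<frown> x \<in> X"
  proof (cases "i \<le> j")
    case True
    then show ?thesis
      using suffix_closed[OF x, of i] \<alpha> by (intro exI[of _ "suffix j x"]) simp
  next
    \<comment> \<open>For \<open>j < i\<close> the block is the empty word.\<close>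
    case False
    then show ?thesis using x \<alpha> by (intro exI[of _ x]) simp
  qed
next
  assume "\<exists>x. \<alpha> \<frown> x \<in> X"
  then obtain x where "\<alpha> \<frown> x \<in> X" by blast
  moreover have "\<alpha> = subsequence (\<alpha> \<frown> x) 0 (length \<alpha>)" by simp
  ultimately show "\<alpha> \<in> lang X"
    unfolding lang_def occurs_in_def by blast
qed

lemma C_set_empty: "\<alpha> \<notin> lang X \<or> \<beta> \<notin> lang X \<Longrightarrow> C_set X \<alpha> \<beta> = {}"
  by (auto simp: lang_iff C_set_def)

lemma C_set_Nil [simp]: "C_set X [] [] = X"
  by (simp add: C_set_def)

lemma Nil_lang: "[] \<in> lang X"
  using letter by (auto simp: lang_iff)

lemma letter_lang: "[a] \<in> lang X"
  using letter by (simp add: lang_iff)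

lemma bool_alg_space: "X \<in> bool_alg X"
  using bool_alg.basic[OF Nil_lang Nil_lang] by simp

lemma bool_alg_empty: "{} \<in> bool_alg X"
  using bool_alg.compl[OF bool_alg_space] by simp

text \<open>Words outside the language give the empty set, so membership in the language need not be
  carried along.\<close>

lemma bool_alg_C_set: "C_set X \<alpha> \<beta> \<in> bool_alg X"
  using C_set_empty bool_alg_empty bool_alg.basic by metis

lemma bool_alg_subset: "A \<in> bool_alg X \<Longrightarrow> A \<subseteq> X"
  by (induction rule: bool_alg.induct) (auto simp: C_set_def)

lemma bool_alg_Diff: "A \<in> bool_alg X \<Longrightarrow> B \<in> bool_alg X \<Longrightarrow> A - B \<in> bool_alg X"
proof -
  assume "A \<in> bool_alg X" "B \<in> bool_alg X"
  then have "A - B = A \<inter> (X - B)" "A \<inter> (X - B) \<in> bool_alg X"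
    by (auto dest: bool_alg_subset intro: bool_alg.intros)
  then show ?thesis by simp
qed

text \<open>The relative range of \<open>A\<close>: what \<open>p A\<close> becomes when it moves to
  the right past \<open>s a\<close> or to the left past \<open>t a\<close>.\<close>

definition range_set :: "(nat \<Rightarrow> 'a) set \<Rightarrow> 'a \<Rightarrow> (nat \<Rightarrow> 'a) set" where
  "range_set A a = {y. a ## y \<in> A}"

text \<open>What \<open>p A\<close> becomes when it moves to the left past
  \<open>S \<alpha>\<close>. The condition \<open>\<alpha> \<frown> y \<in> X\<close> matters
  because \<open>\<alpha>\<close> need not be allowed in front of every point of
  \<open>A\<close>.\<close>

definition pre :: "'a list \<Rightarrow> (nat \<Rightarrow> 'a) set \<Rightarrow> (nat \<Rightarrow> 'a) set" where
  "pre \<alpha> A = {\<alpha> \<frown> y |y. y \<in> A \<and> \<alpha> \<frown> y \<in> X}"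

lemma pre_Cons: "pre (a # \<alpha>) A = pre [a] (pre \<alpha> A)"
  by (auto simp: pre_def dest: shift)

lemma pre_Nil: "A \<subseteq> X \<Longrightarrow> pre [] A = A"
  by (auto simp: pre_def)

lemma range_set_C_set_Nil: "range_set (C_set X \<alpha> []) a = C_set X (\<alpha> @ [a]) [] \<inter> C_set X [a] []"
  by (auto simp: range_set_def C_set_def dest: shift)

lemma range_set_C_set_Cons:
  "range_set (C_set X \<alpha> (b # \<beta>)) a = (if a = b then C_set X \<alpha> \<beta> \<inter> C_set X [a] [] else {})"
  by (auto simp: range_set_def C_set_def dest: shift)

text \<open>The complement is taken in the set of points that may follow \<open>a\<close>, not in
  \<open>X\<close>.\<close>

lemma range_set_Compl: "range_set (X - A) a = C_set X [a] [] - range_set A a"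
  by (auto simp: range_set_def C_set_def dest: shift)

lemma range_set_Un: "range_set (A \<union> B) a = range_set A a \<union> range_set B a"
  and range_set_Int: "range_set (A \<inter> B) a = range_set A a \<inter> range_set B a"
  by (auto simp: range_set_def)

lemma bool_alg_range_set: "A \<in> bool_alg X \<Longrightarrow> range_set A a \<in> bool_alg X"
proof (induction rule: bool_alg.induct)
  case (basic \<alpha> \<beta>)
  then show ?case
    by (cases \<beta>) (auto simp: range_set_C_set_Nil range_set_C_set_Cons bool_alg_empty
        intro: bool_alg_C_set bool_alg.Int)
qed (auto simp: range_set_Un range_set_Int range_set_Compl intro: bool_alg.intros bool_alg_C_set bool_alg_Diff)

lemma bool_alg_pre_single: "A \<in> bool_alg X \<Longrightarrow> pre [a] A \<in> bool_alg X"
proof (induction rule: bool_alg.induct)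
  case (basic \<alpha> \<beta>)
  have "pre [a] (C_set X \<alpha> \<beta>) = C_set X \<alpha> (a # \<beta>)"
    by (auto simp: pre_def C_set_def dest: shift)
  then show ?case by (simp add: bool_alg_C_set)
next
  case (Un A B)
  have "pre [a] (A \<union> B) = pre [a] A \<union> pre [a] B" by (auto simp: pre_def)
  then show ?case using Un by (auto intro: bool_alg.Un)
next
  case (Int A B)
  have "pre [a] (A \<inter> B) = pre [a] A \<inter> pre [a] B" by (auto simp: pre_def)
  then show ?case using Int by (auto intro: bool_alg.Int)
next
  case (compl A)
  have "pre [a] (X - A) = C_set X [] [a] - pre [a] A"
    by (auto simp: pre_def C_set_def dest: shift)
  then show ?case using compl by (auto intro: bool_alg_Diff bool_alg_C_set)
qed

lemma bool_alg_pre: "A \<in> bool_alg X \<Longrightarrow> pre \<alpha> A \<in> bool_alg X"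
proof (induction \<alpha>)
  case (Cons a \<alpha>)
  then show ?case by (subst pre_Cons) (simp add: bool_alg_pre_single)
qed (simp add: pre_Nil bool_alg_subset)

section \<open>The action on functions on the shift space times the integers\<close>

text \<open>
  The integer coordinate records the degree, which makes the action faithful even at
  eventually periodic points.
\<close>

primrec gen_op :: "'a subshift_gen \<Rightarrow> ('a, 'r::field) seq_op" where
  "gen_op (Proj A) = pcomp ((A \<inter> X) \<times> UNIV) (\<lambda>q. q)"
| "gen_op (Shift a) = pcomp ({x \<in> X. x 0 = a} \<times> UNIV) (\<lambda>(x, j). (suffix 1 x, j - 1))"
| "gen_op (ShiftStar a) = pcomp ({x. a ## x \<in> X} \<times> UNIV) (\<lambda>(x, j). (a ## x, j + 1))"

text \<open>The factor \<open>gen_op (Proj X)\<close> at the end makes the empty word act as the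
  projection to \<open>X \<times> \<int>\<close> rather than as the identity on all sequences;
  otherwise \<open>p_gen X - 1\<close> would not evaluate to zero.\<close>

definition word_op :: "'a subshift_gen free_monoid \<Rightarrow> ('a, 'r::field) seq_op" where
  "word_op w = foldr (\<lambda>g T. gen_op g * T) (letters w) (gen_op (Proj X))"

lemma gen_op_left: "gen_op (Proj X) * gen_op g = gen_op g"
  by (cases g) (auto simp: pcomp_mult intro!: pcomp_cong dest: shift)

lemma gen_op_right: "gen_op g * gen_op (Proj X) = gen_op g"
  by (cases g) (auto simp: pcomp_mult suffix_closed[of _ 1, simplified] intro!: pcomp_cong)

lemma word_op_add: "word_op (u + v) = word_op u * word_op v"
proof -
  have left: "gen_op (Proj X) * foldr (\<lambda>g T. gen_op g * T) ys (gen_op (Proj X)) = foldr (\<lambda>g T. gen_op g * T) ys (gen_op (Proj X))"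
    for ys by (cases ys) (simp_all add: gen_op_left del: gen_op.simps flip: mult.assoc)
  have "foldr (\<lambda>g T. gen_op g * T) (xs @ ys) (gen_op (Proj X)) =
      foldr (\<lambda>g T. gen_op g * T) xs (gen_op (Proj X)) * foldr (\<lambda>g T. gen_op g * T) ys (gen_op (Proj X))"
    for xs ys by (induction xs) (simp_all add: left mult.assoc del: gen_op.simps)
  then show ?thesis
    by (simp add: word_op_def plus_free_monoid_def)
qed

abbreviation \<rho> :: "('r::field, 'a subshift_gen) ncpoly \<Rightarrow> ('a, 'r) seq_op" where
  "\<rho> \<equiv> lo.ev word_op"

lemmas \<rho>_mult = lo.ev_mult[of word_op, OF word_op_add]

lemma \<rho>_gen: "\<rho> (gen g) = gen_op g"
  by (simp add: gen_def word_op_def gen_op_right del: gen_op.simps)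

lemma \<rho>_one: "\<rho> 1 = gen_op (Proj X)"
  unfolding single_one[symmetric] lo.ev_single
  by (simp add: word_op_def zero_free_monoid_def del: gen_op.simps)

lemma \<rho>_p_gen: "A \<in> bool_alg X \<Longrightarrow> \<rho> (p_gen A) = pcomp (A \<times> UNIV) (\<lambda>q. q)"
  using bool_alg_subset by (simp add: \<rho>_gen inf.absorb1)

lemma s_word_Nil [simp]: "s_word [] = 1" and s_word_Cons: "s_word (a # \<alpha>) = gen (Shift a) * s_word \<alpha>"
  and s_star_word_Nil [simp]: "s_star_word [] = 1"
  and s_star_word_Cons: "s_star_word (a # \<alpha>) = s_star_word \<alpha> * gen (ShiftStar a)"
  and s_star_word_snoc: "s_star_word (\<alpha> @ [a]) = gen (ShiftStar a) * s_star_word \<alpha>"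
  and s_word_append: "s_word (\<alpha> @ \<beta>) = s_word \<alpha> * s_word \<beta>"
  and s_star_word_append: "s_star_word (\<alpha> @ \<beta>) = s_star_word \<beta> * s_star_word \<alpha>"
  by (simp_all add: s_word_def s_star_word_def)

lemma build_first': "x 0 = a \<Longrightarrow> a ## suffix (Suc 0) x = x"
  by auto

lemma \<rho>_s_word:
  "\<rho> (s_word \<alpha>) = pcomp ({\<alpha> \<frown> y |y. \<alpha> \<frown> y \<in> X} \<times> UNIV) (\<lambda>(x, j). (suffix (length \<alpha>) x, j - int (length \<alpha>)))"
proof (induction \<alpha>)
  case Nil
  show ?case by (auto simp: \<rho>_one intro!: pcomp_cong)
next
  case (Cons a \<alpha>)
  have "{x \<in> X. x 0 = a \<and> (\<exists>y. suffix (Suc 0) x = \<alpha> \<frown> y \<and> \<alpha> \<frown> y \<in> X)} = {a ## \<alpha> \<frown> y |y. a ## \<alpha> \<frown> y \<in> X}"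
    (is "?L = ?R")
  proof (intro equalityI subsetI)
    fix x assume "x \<in> ?L"
    then obtain y where y: "x \<in> X" "x 0 = a" "suffix (Suc 0) x = \<alpha> \<frown> y" by blast
    then have "x = a ## \<alpha> \<frown> y" using build_first'[of x a] by simp
    then show "x \<in> ?R" using y(1) by (intro CollectI exI[of _ y]) simp
  next
    fix x assume "x \<in> ?R"
    then obtain y where y: "x = a ## \<alpha> \<frown> y" "x \<in> X" by blast
    moreover have "suffix (Suc 0) x = \<alpha> \<frown> y" using y by (simp add: suffix_def)
    ultimately show "x \<in> ?L" using shift by auto
  qed
  then show ?case
    unfolding s_word_Cons \<rho>_mult Cons.IH \<rho>_gen gen_op.simps pcomp_mult
    by (intro pcomp_cong) auto
qed

lemma \<rho>_s_star_word:
  "\<rho> (s_star_word \<beta>) = pcomp ({x. \<beta> \<frown> x \<in> X} \<times> UNIV) (\<lambda>(x, j). (\<beta> \<frown> x, j + int (length \<beta>)))"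
proof (induction \<beta>)
  case Nil
  show ?case by (auto simp: \<rho>_one intro!: pcomp_cong)
next
  case (Cons a \<beta>)
  show ?case
    unfolding s_star_word_Cons \<rho>_mult Cons.IH \<rho>_gen gen_op.simps pcomp_mult
    by (intro pcomp_cong) (auto dest: shift)
qed

lemma \<rho>_relator: "f \<in> subshift_relators X \<Longrightarrow> \<rho> f = 0"
proof -
  have "\<rho> (gen (Shift a) * gen (ShiftStar a) * gen (Shift a)) = \<rho> (gen (Shift a))" for a
    unfolding \<rho>_mult \<rho>_gen gen_op.simps pcomp_mult
    by (intro pcomp_cong) (auto simp: build_first')
  moreover have "\<rho> (gen (ShiftStar a) * gen (Shift a) * gen (ShiftStar a)) = \<rho> (gen (ShiftStar a))" for a
    unfolding \<rho>_mult \<rho>_gen gen_op.simps pcomp_mult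
    by (intro pcomp_cong) (auto simp: suffix_def)
  moreover have "\<rho> (s_word \<beta> * s_star_word \<alpha> * s_word \<alpha> * s_star_word \<beta>) = \<rho> (p_gen (C_set X \<alpha> \<beta>))" for \<alpha> \<beta>
    unfolding \<rho>_mult \<rho>_s_word \<rho>_s_star_word \<rho>_p_gen[OF bool_alg_C_set] pcomp_mult
    by (intro pcomp_cong) (auto simp: C_set_def)
  moreover have "\<rho> (p_gen (A \<inter> B)) = \<rho> (p_gen A * p_gen B)" for A B
    unfolding \<rho>_mult \<rho>_gen gen_op.simps pcomp_mult by (intro pcomp_cong) auto
  moreover have "\<rho> (p_gen (A \<union> B)) = \<rho> (p_gen A + p_gen B - p_gen (A \<inter> B))" for A B
    unfolding lo.ev_add lo.ev_diff \<rho>_gen gen_op.simps by (rule linop_eqI) auto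
  moreover have "\<rho> (p_gen X) = \<rho> 1"
    by (simp add: \<rho>_gen \<rho>_one)
  moreover have "\<rho> (p_gen {}) = 0"
    by (simp add: \<rho>_gen)
  ultimately show "f \<in> subshift_relators X \<Longrightarrow> \<rho> f = 0"
    by (auto simp: subshift_relators_def lo.ev_diff)
qed

text \<open>Prefix replacement on \<open>B\<close>, with the degree subtracted from the integer
  coordinate. These operators span the image of the subshift algebra.\<close>

definition term_op :: "(nat \<Rightarrow> 'a) set \<Rightarrow> 'a list \<Rightarrow> 'a list \<Rightarrow> ('a, 'r::field) seq_op" where
  "term_op B \<alpha> \<beta> = pcomp (B \<times> UNIV)
     (\<lambda>(x, j). (\<beta> \<frown> suffix (length \<alpha>) x, j - int (length \<alpha>) + int (length \<beta>)))"

lemma \<rho>_term: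
  assumes "B \<in> bool_alg X" "B \<subseteq> C_set X \<beta> \<alpha>"
  shows "\<rho> (p_gen B * s_word \<alpha> * s_star_word \<beta>) = term_op B \<alpha> \<beta>"
  using assms bool_alg_subset[OF assms(1)]
  unfolding \<rho>_mult \<rho>_s_word \<rho>_s_star_word \<rho>_p_gen[OF assms(1)] pcomp_mult term_op_def
  by (intro pcomp_cong) (auto simp: C_set_def)

end

text \<open>A block of a suffix is a block of the whole sequence, so avoiding forbidden words passes
  to suffixes.\<close>

lemma subshift_shift_space:
  assumes "subshift X" "\<forall>a. \<exists>x\<in>X. a \<in> range x"
  shows "shift_space X"
proof
  have suffix: "suffix n x \<in> X" if x: "x \<in> X" for n x
  proof -
    have "occurs_in \<alpha> x" if "occurs_in \<alpha> (suffix n x)" for \<alpha>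
      using that by (auto simp: occurs_in_def)
    then show ?thesis
      using assms(1) x by (auto simp: subshift_def forbidding_def)
  qed
  show "x \<in> X" if "a ## x \<in> X" for a x
    using suffix[OF that, of 1] by (simp add: suffix_def)
  show "\<exists>x. a ## x \<in> X" for a
  proof -
    obtain x n where "x \<in> X" "a = x n" using assms(2) by blast
    then show ?thesis
      using suffix[of x n] build_first[of "suffix n x"] by (metis Nat.add_0_right suffix_nth)
  qed
qed

section \<open>The subshift algebra acts faithfully\<close>

context shift_space
begin

abbreviation \<F> :: "('r::field, 'a subshift_gen) ncpoly set" where
  "\<F> \<equiv> carrier (free_algebra (subshift_gens X))"

lemma s_word_carrier:
  "s_word \<alpha> \<in> \<F>" "s_star_word \<alpha> \<in> \<F>"
proof -
  have gens: "Shift a \<in> subshift_gens X" "ShiftStar a \<in> subshift_gens X" for a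
    by (auto simp: subshift_gens_def)
  show "s_word \<alpha> \<in> \<F>" "s_star_word \<alpha> \<in> \<F>"
    by (induction \<alpha>) (auto simp: s_word_Cons s_star_word_Cons intro!: free_algebra_closed gens)
qed

lemma p_gen_carrier: "A \<in> bool_alg X \<Longrightarrow> p_gen A \<in> \<F>"
  by (intro free_algebra_closed) (auto simp: subshift_gens_def)

lemma shift_carrier:
  "gen (Shift a) \<in> \<F>" "gen (ShiftStar a) \<in> \<F>"
  by (auto intro!: free_algebra_closed simp: subshift_gens_def)

end

text \<open>The token fixes the coefficient field, which \<open>X\<close> does not mention.\<close>

locale subshift_over = shift_space X for X :: "(nat \<Rightarrow> 'a) set" +
  fixes coefficients :: "'r::field itself"

sublocale subshift_over \<subseteq> evaluation
  "oscale :: 'r \<Rightarrow> ('a, 'r) seq_op \<Rightarrow> _" "free_algebra (subshift_gens X)" "subshift_gens X"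
  "subshift_relators X" word_op
proof
  show "subshift_relators X \<subseteq> \<F>"
    unfolding subshift_relators_def
    by (auto intro!: free_algebra_closed(2-6) s_word_carrier p_gen_carrier shift_carrier bool_alg_empty bool_alg_space
        bool_alg_C_set bool_alg.Un bool_alg.Int)
  show "\<exists>c. g - pscale c 1 \<in> \<F>"
    if "g \<in> \<F>" for g :: "('r, 'a subshift_gen) ncpoly"
    using that by (intro exI[of _ 0]) simp
qed (simp_all add: free_algebra_closed word_op_add \<rho>_relator)

section \<open>Commutation rules modulo the relations\<close>

context subshift_over
begin

abbreviation p :: "(nat \<Rightarrow> 'a) set \<Rightarrow> ('r, 'a subshift_gen) ncpoly" where "p \<equiv> p_gen"
abbreviation s :: "'a \<Rightarrow> ('r, 'a subshift_gen) ncpoly" where "s a \<equiv> gen (Shift a)"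
abbreviation t :: "'a \<Rightarrow> ('r, 'a subshift_gen) ncpoly" where "t a \<equiv> gen (ShiftStar a)"
abbreviation S :: "'a list \<Rightarrow> ('r, 'a subshift_gen) ncpoly" where "S \<equiv> s_word"
abbreviation T :: "'a list \<Rightarrow> ('r, 'a subshift_gen) ncpoly" where "T \<equiv> s_star_word"

lemma p_space: "p X \<approx> 1"
  and p_empty: "p {} \<approx> 0"
  and p_Int: "A \<in> bool_alg X \<Longrightarrow> B \<in> bool_alg X \<Longrightarrow> p A * p B \<approx> p (A \<inter> B)"
  and p_Un: "A \<in> bool_alg X \<Longrightarrow> B \<in> bool_alg X \<Longrightarrow> p (A \<union> B) \<approx> p A + p B - p (A \<inter> B)"
  and sts: "s a * t a * s a \<approx> s a"
  and tst: "t a * s a * t a \<approx> t a"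
  and STST: "\<alpha> \<in> lang X \<Longrightarrow> \<beta> \<in> lang X \<Longrightarrow> S \<beta> * T \<alpha> * S \<alpha> * T \<beta> \<approx> p (C_set X \<alpha> \<beta>)"
proof -
  show "p X \<approx> 1"
    by (rule relator_cong) (unfold subshift_relators_def, blast)
  have "p {} - 0 \<in> subshift_relators X"
    unfolding diff_zero subshift_relators_def by blast
  then show "p {} \<approx> 0" by (rule relator_cong)
  show "A \<in> bool_alg X \<Longrightarrow> B \<in> bool_alg X \<Longrightarrow> p A * p B \<approx> p (A \<inter> B)"
    by (rule cong_sym, rule relator_cong) (unfold subshift_relators_def, blast)
  show "A \<in> bool_alg X \<Longrightarrow> B \<in> bool_alg X \<Longrightarrow> p (A \<union> B) \<approx> p A + p B - p (A \<inter> B)"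
    by (rule relator_cong) (unfold subshift_relators_def, blast)
  show "s a * t a * s a \<approx> s a"
    by (rule relator_cong) (unfold subshift_relators_def, blast)
  show "t a * s a * t a \<approx> t a"
    by (rule relator_cong) (unfold subshift_relators_def, blast)
  show "\<alpha> \<in> lang X \<Longrightarrow> \<beta> \<in> lang X \<Longrightarrow> S \<beta> * T \<alpha> * S \<alpha> * T \<beta> \<approx> p (C_set X \<alpha> \<beta>)"
    by (rule relator_cong) (unfold subshift_relators_def, blast)
qed

lemma ts: "t a * s a \<approx> p (C_set X [a] [])"
  using STST[OF letter_lang[of a] Nil_lang] by (simp add: s_word_Cons s_star_word_Cons)

lemma ST: "\<gamma> \<in> lang X \<Longrightarrow> S \<gamma> * T \<gamma> \<approx> p (C_set X [] \<gamma>)"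
  using STST[OF Nil_lang, of \<gamma>] by simp

lemma st: "s a * t a \<approx> p (C_set X [] [a])"
  using ST[OF letter_lang[of a]] by (simp add: s_word_Cons s_star_word_Cons)

lemma p_comm: "A \<in> bool_alg X \<Longrightarrow> B \<in> bool_alg X \<Longrightarrow> p A * p B \<approx> p B * p A"
  using p_Int[of A B] p_Int[of B A] by (metis cong_sym cong_trans inf_commute)

lemma p_disjoint: "A \<in> bool_alg X \<Longrightarrow> B \<in> bool_alg X \<Longrightarrow> A \<inter> B = {} \<Longrightarrow> p A * p B \<approx> 0"
  using p_Int[of A B] p_empty cong_trans by metis

lemma p_subset: "A \<in> bool_alg X \<Longrightarrow> B \<in> bool_alg X \<Longrightarrow> A \<subseteq> B \<Longrightarrow> p A * p B \<approx> p A"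
  using p_Int[of A B] by (simp add: inf.absorb1)

lemma p_split: "A \<in> bool_alg X \<Longrightarrow> B \<in> bool_alg X \<Longrightarrow> p A \<approx> p (A \<inter> B) + p (A - B)"
proof -
  assume AB: "A \<in> bool_alg X" "B \<in> bool_alg X"
  have "p ((A \<inter> B) \<union> (A - B)) \<approx> p (A \<inter> B) + p (A - B) - p ((A \<inter> B) \<inter> (A - B))"
    by (rule p_Un) (use AB in \<open>auto intro: bool_alg.intros bool_alg_Diff\<close>)
  moreover have "(A \<inter> B) \<union> (A - B) = A" "(A \<inter> B) \<inter> (A - B) = {}" by auto
  moreover have "p (A \<inter> B) + p (A - B) - p {} \<approx> p (A \<inter> B) + p (A - B) - 0"
    by (intro cong_diff cong_refl p_empty)
  ultimately show ?thesis by (metis cong_trans diff_zero)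
qed

lemma p_Compl: "A \<in> bool_alg X \<Longrightarrow> p (X - A) \<approx> 1 - p A"
proof -
  assume A: "A \<in> bool_alg X"
  have "p X \<approx> p A + p (X - A)"
    using p_split[OF bool_alg_space A] bool_alg_subset[OF A] by (simp add: inf.absorb2)
  then have "1 \<approx> p A + p (X - A)"
    using p_space cong_sym cong_trans by blast
  from cong_diff[OF this cong_refl[of "p A"]] show ?thesis
    by (simp add: cong_sym)
qed

lemma p_s_self: "p (C_set X [] [a]) * s a \<approx> s a"
proof -
  have "p (C_set X [] [a]) * s a \<approx> s a * t a * s a"
    by (intro cong_intros cong_sym[OF st])
  also have "\<dots> \<approx> s a" by (rule sts)
  finally show ?thesis .
qed

lemma s_p_self: "s a * p (C_set X [a] []) \<approx> s a"
proof -
  have "s a * p (C_set X [a] []) \<approx> s a * (t a * s a)"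
    by (intro cong_intros cong_sym[OF ts])
  also have "\<dots> = s a * t a * s a" by (simp add: mult.assoc)
  also have "\<dots> \<approx> s a" by (rule sts)
  finally show ?thesis .
qed

lemma p_s_disjoint:
  assumes "A \<in> bool_alg X" "A \<inter> C_set X [] [a] = {}"
  shows "p A * s a \<approx> 0"
proof -
  have "p A * s a \<approx> p A * (p (C_set X [] [a]) * s a)"
    by (intro cong_intros cong_sym[OF p_s_self])
  also have "\<dots> = (p A * p (C_set X [] [a])) * s a" by (simp add: mult.assoc)
  also have "\<dots> \<approx> 0 * s a"
    by (intro cong_intros p_disjoint assms bool_alg_C_set)
  finally show ?thesis by simp
qed

lemma s_p_empty: "s a * p {} \<approx> 0"
  using cong_mult_left[OF p_empty, of "s a"] by simp

lemma p_s_Int: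
  assumes AB: "A \<in> bool_alg X" "B \<in> bool_alg X"
    "p A * s a \<approx> s a * p (range_set A a)" "p B * s a \<approx> s a * p (range_set B a)"
  shows "p (A \<inter> B) * s a \<approx> s a * p (range_set A a \<inter> range_set B a)"
proof -
  have "p (A \<inter> B) * s a \<approx> (p A * p B) * s a"
    by (intro cong_intros cong_sym[OF p_Int] AB)
  also have "\<dots> = p A * (p B * s a)" by (simp add: mult.assoc)
  also have "\<dots> \<approx> p A * (s a * p (range_set B a))" by (intro cong_intros AB)
  also have "\<dots> = (p A * s a) * p (range_set B a)" by (simp add: mult.assoc)
  also have "\<dots> \<approx> (s a * p (range_set A a)) * p (range_set B a)" by (intro cong_intros AB)
  also have "\<dots> = s a * (p (range_set A a) * p (range_set B a))" by (simp add: mult.assoc)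
  also have "\<dots> \<approx> s a * p (range_set A a \<inter> range_set B a)"
    by (intro cong_intros p_Int AB bool_alg_range_set)
  finally show ?thesis .
qed

text \<open>Induction on the construction of \<open>A\<close>. Generators come from the relators;
  intersections and unions are formal; complements need that \<open>s a\<close> absorbs the
  projection to the points that may follow \<open>a\<close>.\<close>

lemma p_s: "A \<in> bool_alg X \<Longrightarrow> p A * s a \<approx> s a * p (range_set A a)"
proof (induction rule: bool_alg.induct)
  case (basic \<alpha> \<beta>)
  show ?case
  proof (cases \<beta>)
    case Nil
    let ?A = "C_set X \<alpha> []" and ?Z = "C_set X [] [a]"
    have r: "range_set ?A a = C_set X (\<alpha> @ [a]) []"
      unfolding range_set_C_set_Nil by (auto simp: C_set_def dest: conc_shift)
    show ?thesis
    \<comment> \<open>If \<open>\<alpha> @ [a]\<close> is in the language, expanding both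
      projections by the relators yields \<open>s a\<close> followed by the relator for
      \<open>\<alpha> @ [a]\<close>. That relator is available only in the language; outside it both
      sides vanish.\<close>
    proof (cases "\<alpha> @ [a] \<in> lang X")
      case True
      have "p ?A * s a \<approx> p ?A * (p ?Z * s a)"
        by (intro cong_intros cong_sym[OF p_s_self])
      also have "\<dots> = (p ?A * p ?Z) * s a" by (simp add: mult.assoc)
      also have "\<dots> \<approx> (p ?Z * p ?A) * s a"
        by (intro cong_intros p_comm bool_alg_C_set)
      also have "\<dots> \<approx> ((s a * t a) * (S [] * T \<alpha> * S \<alpha> * T [])) * s a"
        by (intro cong_intros cong_sym[OF st] cong_sym[OF STST] basic Nil_lang)
      also have "\<dots> = s a * (S [] * T (\<alpha> @ [a]) * S (\<alpha> @ [a]) * T [])"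
        by (simp add: s_word_append s_star_word_snoc s_word_Cons mult.assoc)
      also have "\<dots> \<approx> s a * p (C_set X (\<alpha> @ [a]) [])"
        by (intro cong_intros STST True Nil_lang)
      finally show ?thesis using Nil r by simp
    next
      case False
      then have "C_set X (\<alpha> @ [a]) [] = {}" by (simp add: C_set_empty)
      moreover have "?A \<inter> ?Z = {}"
        using False by (auto simp: C_set_def lang_iff)
      then have "p ?A * s a \<approx> 0" by (intro p_s_disjoint bool_alg_C_set)
      ultimately show ?thesis
        using Nil r s_p_empty[of a] cong_sym cong_trans by metis
    qed
  next
    case (Cons b \<beta>')
    show ?thesis
    proof (cases "a = b")
      case True
      have \<beta>': "\<beta>' \<in> lang X"
        using basic(2) Cons by (auto simp: lang_iff dest: shift)
      have "p (C_set X \<alpha> \<beta>) * s a \<approx> (S \<beta> * T \<alpha> * S \<alpha> * T \<beta>) * s a"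
        by (intro cong_intros cong_sym[OF STST] basic)
      also have "\<dots> = s a * ((S \<beta>' * T \<alpha> * S \<alpha> * T \<beta>') * (t a * s a))"
        using Cons True by (simp add: s_word_Cons s_star_word_Cons mult.assoc)
      also have "\<dots> \<approx> s a * (p (C_set X \<alpha> \<beta>') * p (C_set X [a] []))"
        by (intro cong_intros STST basic \<beta>' ts)
      also have "\<dots> \<approx> s a * p (C_set X \<alpha> \<beta>' \<inter> C_set X [a] [])"
        by (intro cong_intros p_Int bool_alg_C_set)
      finally show ?thesis
        using Cons True by (simp add: range_set_C_set_Cons)
    next
      case False
      have "C_set X \<alpha> \<beta> \<inter> C_set X [] [a] = {}"
        using False Cons by (auto simp: C_set_def)
      then have "p (C_set X \<alpha> \<beta>) * s a \<approx> 0" by (intro p_s_disjoint bool_alg_C_set)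
      then have "p (C_set X \<alpha> \<beta>) * s a \<approx> s a * p {}"
        using cong_sym[OF s_p_empty] by (rule cong_trans)
      then show ?thesis
        using Cons False by (simp add: range_set_C_set_Cons)
    qed
  qed
next
  case (Int A B)
  then show ?case unfolding range_set_Int by (intro p_s_Int)
next
  case (compl A)
  have r: "range_set A a \<in> bool_alg X" by (intro bool_alg_range_set compl)
  have "p (X - A) * s a \<approx> (1 - p A) * s a" by (intro cong_intros p_Compl compl)
  also have "\<dots> = s a - p A * s a" by (simp add: algebra_simps)
  also have "\<dots> \<approx> s a - s a * p (range_set A a)" by (intro cong_diff cong_refl compl)
  also have "\<dots> = s a * (1 - p (range_set A a))" by (simp add: algebra_simps)
  \<comment> \<open>The inserted projection turns the complement in \<open>X\<close> into the
    complement among the points that may follow \<open>a\<close>.\<close>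
  also have "\<dots> \<approx> (s a * p (C_set X [a] [])) * p (X - range_set A a)"
    by (intro cong_mult cong_sym[OF s_p_self] cong_sym[OF p_Compl] r)
  also have "\<dots> = s a * (p (C_set X [a] []) * p (X - range_set A a))" by (simp add: mult.assoc)
  also have "\<dots> \<approx> s a * p (C_set X [a] [] \<inter> (X - range_set A a))"
    by (intro cong_intros p_Int bool_alg_C_set bool_alg.compl r)
  also have "C_set X [a] [] \<inter> (X - range_set A a) = range_set (X - A) a"
    unfolding range_set_Compl by (auto simp: C_set_def)
  finally show ?case .
next
  case (Un A B)
  note int = p_s_Int[OF Un]
  have "p (A \<union> B) * s a \<approx> (p A + p B - p (A \<inter> B)) * s a"
    by (intro cong_intros p_Un Un)
  also have "\<dots> = p A * s a + p B * s a - p (A \<inter> B) * s a" by (simp add: algebra_simps)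
  also have "\<dots> \<approx> s a * p (range_set A a) + s a * p (range_set B a) - s a * p (range_set A a \<inter> range_set B a)"
    by (intro cong_diff cong_add Un int)
  also have "\<dots> = s a * (p (range_set A a) + p (range_set B a) - p (range_set A a \<inter> range_set B a))"
    by (simp add: algebra_simps)
  also have "\<dots> \<approx> s a * p (range_set (A \<union> B) a)"
    unfolding range_set_Un by (intro cong_intros cong_sym[OF p_Un] Un bool_alg_range_set)
  finally show ?case .
qed

text \<open>Reduced to \<open>p_s\<close>: in \<open>t a * s a * t a\<close> the projection
  \<open>s a * t a\<close> commutes with \<open>p A\<close>, which brings \<open>p A\<close> to the
  left of \<open>s a\<close>.\<close>

lemma t_p:
  assumes A: "A \<in> bool_alg X"
  shows "t a * p A \<approx> p (range_set A a) * t a"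
proof -
  let ?Z = "C_set X [] [a]" and ?F = "C_set X [a] []" and ?r = "range_set A a"
  note r = bool_alg_range_set[OF A, of a]
  have "t a * p A \<approx> (t a * s a * t a) * p A" by (intro cong_intros cong_sym[OF tst])
  also have "\<dots> = t a * ((s a * t a) * p A)" by (simp add: mult.assoc)
  also have "\<dots> \<approx> t a * (p ?Z * p A)" by (intro cong_intros st)
  also have "\<dots> \<approx> t a * (p A * p ?Z)" by (intro cong_intros p_comm bool_alg_C_set A)
  also have "\<dots> \<approx> t a * (p A * (s a * t a))" by (intro cong_intros cong_sym[OF st])
  also have "\<dots> = t a * ((p A * s a) * t a)" by (simp add: mult.assoc)
  also have "\<dots> \<approx> t a * ((s a * p ?r) * t a)" by (intro cong_intros p_s A)
  also have "\<dots> = ((t a * s a) * p ?r) * t a" by (simp add: mult.assoc)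
  also have "\<dots> \<approx> (p ?F * p ?r) * t a" by (intro cong_intros ts)
  also have "\<dots> \<approx> (p ?r * p ?F) * t a" by (intro cong_intros p_comm bool_alg_C_set r)
  also have "\<dots> \<approx> (p ?r * (t a * s a)) * t a" by (intro cong_intros cong_sym[OF ts])
  also have "\<dots> = p ?r * (t a * s a * t a)" by (simp add: mult.assoc)
  also have "\<dots> \<approx> p ?r * t a" by (intro cong_intros tst)
  finally show ?thesis .
qed

text \<open>Apply \<open>p_s\<close> to the preimage. Its relative range is \<open>A\<close> cut
  down to the points that may follow \<open>a\<close>, and \<open>s a\<close> absorbs this
  cut.\<close>

lemma s_p:
  assumes A: "A \<in> bool_alg X"
  shows "s a * p A \<approx> p (pre [a] A) * s a"
proof -
  have r: "range_set (pre [a] A) a = C_set X [a] [] \<inter> A"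
    using bool_alg_subset[OF A] by (auto simp: range_set_def pre_def C_set_def)
  have "p (pre [a] A) * s a \<approx> s a * p (range_set (pre [a] A) a)"
    by (intro p_s bool_alg_pre A)
  also have "\<dots> \<approx> s a * (p (C_set X [a] []) * p A)"
    unfolding r by (intro cong_intros cong_sym[OF p_Int] bool_alg_C_set A)
  also have "\<dots> = (s a * p (C_set X [a] [])) * p A" by (simp add: mult.assoc)
  also have "\<dots> \<approx> s a * p A" by (intro cong_intros s_p_self)
  finally show ?thesis by (rule cong_sym)
qed

lemma S_p: "A \<in> bool_alg X \<Longrightarrow> S \<alpha> * p A \<approx> p (pre \<alpha> A) * S \<alpha>"
proof (induction \<alpha>)
  case Nil
  then show ?case by (simp add: pre_Nil bool_alg_subset)
next
  case (Cons a \<alpha>)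
  have "S (a # \<alpha>) * p A = s a * (S \<alpha> * p A)" by (simp add: s_word_Cons mult.assoc)
  also have "\<dots> \<approx> s a * (p (pre \<alpha> A) * S \<alpha>)" by (intro cong_intros Cons)
  also have "\<dots> = (s a * p (pre \<alpha> A)) * S \<alpha>" by (simp add: mult.assoc)
  also have "\<dots> \<approx> (p (pre [a] (pre \<alpha> A)) * s a) * S \<alpha>"
    by (intro cong_intros s_p bool_alg_pre Cons)
  also have "\<dots> = p (pre (a # \<alpha>) A) * S (a # \<alpha>)"
    unfolding pre_Cons[of a \<alpha>] by (simp add: s_word_Cons mult.assoc)
  finally show ?case .
qed

text \<open>A last letter of \<open>\<beta>\<close> becomes the leftmost factor of the star word,
  and the relative range of \<open>C_set X \<beta> []\<close> is the same set for the longer word;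
  hence induction from the right end.\<close>

lemma T_absorb: "p (C_set X \<beta> []) * T \<beta> \<approx> T \<beta>"
proof (induction \<beta> rule: rev_induct)
  case Nil
  show ?case using p_space by simp
next
  case (snoc a \<beta>)
  let ?F = "C_set X \<beta> []"
  have r: "range_set ?F a = C_set X (\<beta> @ [a]) []"
    unfolding range_set_C_set_Nil by (auto simp: C_set_def dest: conc_shift)
  have "p (C_set X (\<beta> @ [a]) []) * T (\<beta> @ [a]) = (p (range_set ?F a) * t a) * T \<beta>"
    by (simp add: r s_star_word_snoc mult.assoc)
  also have "\<dots> \<approx> (t a * p ?F) * T \<beta>" by (intro cong_intros cong_sym[OF t_p] bool_alg_C_set)
  also have "\<dots> = t a * (p ?F * T \<beta>)" by (simp add: mult.assoc)
  also have "\<dots> \<approx> t a * T \<beta>" by (intro cong_intros snoc)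
  finally show ?case by (simp add: s_star_word_snoc)
qed

text \<open>Allows the set of a term to be cut down to the domain on which its prefix replacement
  makes sense.\<close>

lemma ST_absorb: "p (C_set X \<beta> \<alpha>) * (S \<alpha> * T \<beta>) \<approx> S \<alpha> * T \<beta>"
proof -
  have pre: "pre \<alpha> (C_set X \<beta> []) = C_set X \<beta> \<alpha>"
    by (auto simp: pre_def C_set_def dest: conc_shift)
  have "p (C_set X \<beta> \<alpha>) * (S \<alpha> * T \<beta>) = (p (pre \<alpha> (C_set X \<beta> [])) * S \<alpha>) * T \<beta>"
    by (simp add: pre mult.assoc)
  also have "\<dots> \<approx> (S \<alpha> * p (C_set X \<beta> [])) * T \<beta>"
    by (intro cong_intros cong_sym[OF S_p] bool_alg_C_set)
  also have "\<dots> = S \<alpha> * (p (C_set X \<beta> []) * T \<beta>)" by (simp add: mult.assoc)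
  also have "\<dots> \<approx> S \<alpha> * T \<beta>" by (intro cong_intros T_absorb)
  finally show ?thesis .
qed

text \<open>Exactly the situation in which the term acts by prefix replacement on all of
  \<open>B\<close>, see \<open>\<rho>_term\<close>.\<close>

definition admissible :: "(nat \<Rightarrow> 'a) set \<Rightarrow> 'a list \<Rightarrow> 'a list \<Rightarrow> bool" where
  "admissible B \<alpha> \<beta> \<longleftrightarrow> B \<in> bool_alg X \<and> B \<subseteq> C_set X \<beta> \<alpha>"

lemma term_shrink:
  assumes B: "B \<in> bool_alg X"
  shows "p B * (S \<alpha> * T \<beta>) \<approx> p (B \<inter> C_set X \<beta> \<alpha>) * (S \<alpha> * T \<beta>)"
proof -
  have "p B * (S \<alpha> * T \<beta>) \<approx> p B * (p (C_set X \<beta> \<alpha>) * (S \<alpha> * T \<beta>))"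
    by (intro cong_intros cong_sym[OF ST_absorb])
  also have "\<dots> = (p B * p (C_set X \<beta> \<alpha>)) * (S \<alpha> * T \<beta>)" by (simp add: mult.assoc)
  also have "\<dots> \<approx> p (B \<inter> C_set X \<beta> \<alpha>) * (S \<alpha> * T \<beta>)"
    by (intro cong_intros p_Int B bool_alg_C_set)
  finally show ?thesis .
qed

text \<open>Letters are added on the left while the projection is kept in front. The only real case
  is a starred letter meeting \<open>S \<alpha>\<close>: it lengthens the star word if
  \<open>\<alpha>\<close> is empty, and otherwise cancels against the first letter or annihilates
  the term.\<close>

lemma word_normal_form:
  "set w \<subseteq> subshift_gens X \<Longrightarrow> \<exists>B\<in>bool_alg X. \<exists>\<alpha> \<beta>. prod_list (map gen w) \<approx> p B * (S \<alpha> * T \<beta>)"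
proof (induction w)
  case Nil
  have "1 \<approx> p X * (S [] * T [])" using cong_sym[OF p_space] by simp
  then show ?case using bool_alg_space by (simp del: s_word_Nil s_star_word_Nil) blast
next
  case (Cons g w)
  then obtain B \<alpha> \<beta> where B: "B \<in> bool_alg X" and IH: "prod_list (map gen w) \<approx> p B * (S \<alpha> * T \<beta>)"
    by auto
  have step: "prod_list (map gen (g # w)) \<approx> gen g * (p B * (S \<alpha> * T \<beta>))"
    using IH by (simp add: cong_mult_left)
  from Cons.prems consider A where "A \<in> bool_alg X" "g = Proj A" | a where "g = Shift a" | a where "g = ShiftStar a"
    by (auto simp: subshift_gens_def)
  then show ?case
  proof cases
    case 1
    have "gen g * (p B * (S \<alpha> * T \<beta>)) = (p A * p B) * (S \<alpha> * T \<beta>)" by (simp add: 1 mult.assoc)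
    also have "\<dots> \<approx> p (A \<inter> B) * (S \<alpha> * T \<beta>)" by (intro cong_intros p_Int 1 B)
    finally show ?thesis using step cong_trans bool_alg.Int[OF 1(1) B] by blast
  next
    case 2
    have "gen g * (p B * (S \<alpha> * T \<beta>)) = (s a * p B) * (S \<alpha> * T \<beta>)" by (simp add: 2 mult.assoc)
    also have "\<dots> \<approx> (p (pre [a] B) * s a) * (S \<alpha> * T \<beta>)" by (intro cong_intros s_p B)
    also have "\<dots> = p (pre [a] B) * (S (a # \<alpha>) * T \<beta>)" by (simp add: s_word_Cons mult.assoc)
    finally show ?thesis using step cong_trans bool_alg_pre[OF B] by blast
  next
    case 3
    let ?r = "range_set B a"
    note r = bool_alg_range_set[OF B, of a]
    have "gen g * (p B * (S \<alpha> * T \<beta>)) = (t a * p B) * (S \<alpha> * T \<beta>)" by (simp add: 3 mult.assoc)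
    also have "\<dots> \<approx> (p ?r * t a) * (S \<alpha> * T \<beta>)" by (intro cong_intros t_p B)
    finally have 3: "gen g * (p B * (S \<alpha> * T \<beta>)) \<approx> (p ?r * t a) * (S \<alpha> * T \<beta>)" .
    show ?thesis
    proof (cases \<alpha>)
      case Nil
      then have "(p ?r * t a) * (S \<alpha> * T \<beta>) = p ?r * (S [] * T (\<beta> @ [a]))"
        by (simp add: s_star_word_snoc mult.assoc)
      then show ?thesis using step 3 cong_trans r by metis
    next
      case (Cons b \<alpha>')
      show ?thesis
      proof (cases "a = b")
        case True
        have "(p ?r * t a) * (S \<alpha> * T \<beta>) = (p ?r * (t a * s a)) * (S \<alpha>' * T \<beta>)"
          using Cons True by (simp add: s_word_Cons mult.assoc)
        also have "\<dots> \<approx> (p ?r * p (C_set X [a] [])) * (S \<alpha>' * T \<beta>)"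
          by (intro cong_intros ts)
        also have "\<dots> \<approx> p (?r \<inter> C_set X [a] []) * (S \<alpha>' * T \<beta>)"
          by (intro cong_intros p_Int r bool_alg_C_set)
        finally show ?thesis
          using step 3 cong_trans bool_alg.Int[OF r bool_alg_C_set] by blast
      next
        case False
        \<comment> \<open>For distinct letters, \<open>t a\<close> contributes a factor
          \<open>s a * t a\<close>, the projection to the points beginning with \<open>a\<close>,
          and this kills \<open>s b\<close>. The resulting zero is written as a term over the empty
          set.\<close>
        have "(p ?r * t a) * (S \<alpha> * T \<beta>) = p ?r * (t a * s b * (S \<alpha>' * T \<beta>))"
          using Cons by (simp add: s_word_Cons mult.assoc)
        also have "\<dots> \<approx> p ?r * ((t a * s a * t a) * s b * (S \<alpha>' * T \<beta>))"
          by (intro cong_intros cong_sym[OF tst])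
        also have "\<dots> = p ?r * (t a * ((s a * t a) * s b) * (S \<alpha>' * T \<beta>))"
          by (simp add: mult.assoc)
        also have "\<dots> \<approx> p ?r * (t a * (p (C_set X [] [a]) * s b) * (S \<alpha>' * T \<beta>))"
          by (intro cong_intros st)
        also have "\<dots> \<approx> p ?r * (t a * 0 * (S \<alpha>' * T \<beta>))"
          by (intro cong_intros p_s_disjoint bool_alg_C_set) (use False in \<open>auto simp: C_set_def\<close>)
        also have "\<dots> \<approx> p {} * (S [] * T [])"
          using cong_sym[OF p_empty] by simp
        finally show ?thesis
          using step 3 cong_trans bool_alg_empty by blast
      qed
    qed
  qed
qed

end

section \<open>Independence of terms and faithfulness\<close>

context shift_space
begin

text \<open>Both \<open>\<alpha>\<close> and \<open>\<alpha>'\<close> are prefixes of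
  \<open>x\<close>, so the longer extends the shorter by some \<open>\<gamma>\<close>. Equal images
  and equal length differences then force the same \<open>\<gamma>\<close> on the other
  side.\<close>

lemma ST_key:
  assumes x: "x \<in> C_set X \<beta> \<alpha>" "x \<in> C_set X \<beta>' \<alpha>'"
    and key: "\<beta> \<frown> suffix (length \<alpha>) x = \<beta>' \<frown> suffix (length \<alpha>') x"
      "int (length \<beta>) - int (length \<alpha>) = int (length \<beta>') - int (length \<alpha>')"
    and le: "length \<alpha> \<le> length \<alpha>'"
  obtains \<gamma> where "\<alpha>' = \<alpha> @ \<gamma>" "\<beta>' = \<beta> @ \<gamma>"
proof -
  obtain z where z1: "x = \<alpha> \<frown> z" using x(1) by (auto simp: C_set_def)
  obtain z' where z2: "x = \<alpha>' \<frown> z'" using x(2) by (auto simp: C_set_def)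
  note z = z1 z2
  define \<gamma> where "\<gamma> = drop (length \<alpha>) \<alpha>'"
  have l: "length (take (length \<alpha>) \<alpha>') = length \<alpha>" using le by simp
  have "\<alpha> \<frown> z = take (length \<alpha>) \<alpha>' \<frown> (\<gamma> \<frown> z')"
    using z by (simp add: \<gamma>_def)
  with l have \<alpha>: "\<alpha>' = \<alpha> @ \<gamma>" and zz: "z = \<gamma> \<frown> z'"
    by (metis \<gamma>_def append_take_drop_id concat_eq)+
  have "suffix (length \<alpha>) x = z" "suffix (length \<alpha>') x = z'"
    using z suffix_conc_length by metis+
  with key(1) zz have "(\<beta> @ \<gamma>) \<frown> z' = \<beta>' \<frown> z'" by simp
  moreover have "length (\<beta> @ \<gamma>) = length \<beta>'"
    using key(2) \<alpha> by simp
  ultimately have "\<beta>' = \<beta> @ \<gamma>" by (metis concat_eq)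
  with \<alpha> show ?thesis by (rule that)
qed

end

context subshift_over
begin

text \<open>The inner factor \<open>S \<gamma> * T \<gamma>\<close> is the projection to the points
  beginning with \<open>\<gamma>\<close>; moved past \<open>S \<alpha>\<close> it becomes a
  projection to a superset of \<open>B\<close> and is absorbed.\<close>

lemma term_extend:
  assumes B: "admissible B (\<alpha> @ \<gamma>) (\<beta> @ \<gamma>)"
  shows "p B * (S (\<alpha> @ \<gamma>) * T (\<beta> @ \<gamma>)) \<approx> p B * (S \<alpha> * T \<beta>)"
proof (cases "B = {}")
  case True
  have "p {} * u \<approx> 0" for u using cong_mult_right[OF p_empty, of u] by simp
  then show ?thesis unfolding True by (metis cong_sym cong_trans)
next
  case False
  then obtain x where "x \<in> B" by blast
  then have \<gamma>: "\<gamma> \<in> lang X"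
    using B conc_shift by (fastforce simp: admissible_def C_set_def lang_iff simp flip: conc_conc)
  have BU: "B \<in> bool_alg X" using B by (simp add: admissible_def)
  have sub: "B \<subseteq> pre \<alpha> (C_set X [] \<gamma>)"
    using B by (fastforce simp: admissible_def C_set_def pre_def dest: conc_shift simp flip: conc_conc)
  have "p B * (S (\<alpha> @ \<gamma>) * T (\<beta> @ \<gamma>)) = p B * ((S \<alpha> * (S \<gamma> * T \<gamma>)) * T \<beta>)"
    by (simp add: s_word_append s_star_word_append mult.assoc)
  also have "\<dots> \<approx> p B * ((S \<alpha> * p (C_set X [] \<gamma>)) * T \<beta>)"
    by (intro cong_intros ST \<gamma>)
  also have "\<dots> \<approx> p B * ((p (pre \<alpha> (C_set X [] \<gamma>)) * S \<alpha>) * T \<beta>)"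
    by (intro cong_intros S_p bool_alg_C_set)
  also have "\<dots> = (p B * p (pre \<alpha> (C_set X [] \<gamma>))) * (S \<alpha> * T \<beta>)" by (simp add: mult.assoc)
  also have "\<dots> \<approx> p B * (S \<alpha> * T \<beta>)"
    by (intro cong_intros p_subset BU bool_alg_pre bool_alg_C_set sub)
  finally show ?thesis .
qed

text \<open>Agreement at a single point suffices: it makes one pair of words a common extension of
  the other, and this no longer refers to the point.\<close>

lemma term_cong_key:
  assumes "admissible B \<alpha> \<beta>" "admissible B \<alpha>' \<beta>'" "x \<in> B"
    and "\<beta> \<frown> suffix (length \<alpha>) x = \<beta>' \<frown> suffix (length \<alpha>') x"
      "int (length \<beta>) - int (length \<alpha>) = int (length \<beta>') - int (length \<alpha>')"
  shows "p B * (S \<alpha> * T \<beta>) \<approx> p B * (S \<alpha>' * T \<beta>')"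
proof -
  have x: "x \<in> C_set X \<beta> \<alpha>" "x \<in> C_set X \<beta>' \<alpha>'"
    using assms by (auto simp: admissible_def)
  show ?thesis
  proof (cases "length \<alpha> \<le> length \<alpha>'")
    case True
    then show ?thesis
      using ST_key[OF x assms(4,5)] term_extend assms(2) cong_sym by metis
  next
    case False
    then show ?thesis
      using ST_key[OF x(2,1) assms(4,5)[symmetric]] term_extend assms(1) by (metis nle_le)
  qed
qed

definition term_sum :: "'i set \<Rightarrow> ('i \<Rightarrow> 'r) \<Rightarrow> ('i \<Rightarrow> (nat \<Rightarrow> 'a) set) \<Rightarrow> ('i \<Rightarrow> 'a list) \<Rightarrow> ('i \<Rightarrow> 'a list)
    \<Rightarrow> ('r, 'a subshift_gen) ncpoly" where
  "term_sum I c B \<alpha> \<beta> = (\<Sum>i\<in>I. pscale (c i) (p (B i) * (S (\<alpha> i) * T (\<beta> i))))"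

definition op_sum :: "'i set \<Rightarrow> ('i \<Rightarrow> 'r) \<Rightarrow> ('i \<Rightarrow> (nat \<Rightarrow> 'a) set) \<Rightarrow> ('i \<Rightarrow> 'a list) \<Rightarrow> ('i \<Rightarrow> 'a list)
    \<Rightarrow> ('a, 'r) seq_op" where
  "op_sum I c B \<alpha> \<beta> = (\<Sum>i\<in>I. oscale (c i) (term_op (B i) (\<alpha> i) (\<beta> i)))"

text \<open>With one set \<open>B\<close> for all terms, a single point \<open>x\<close> of it
  decides everything: terms with the same key at \<open>x\<close> are congruent, and distinct keys
  are distinct targets of \<open>(x, 0)\<close> under the operators.\<close>

lemma term_sum_zero_base:
  assumes I: "finite I" and adm: "\<And>i. i \<in> I \<Longrightarrow> admissible B (\<alpha> i) (\<beta> i)"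
    and zero: "op_sum I c (\<lambda>_. B) \<alpha> \<beta> = 0"
  shows "term_sum I c (\<lambda>_. B) \<alpha> \<beta> \<approx> 0"
proof (cases "B = {}")
  case True
  have "term_sum I c (\<lambda>_. B) \<alpha> \<beta> \<approx> (\<Sum>i\<in>I. pscale (c i) (0 * (S (\<alpha> i) * T (\<beta> i))))"
    unfolding term_sum_def True by (intro cong_sum cong_scale cong_mult cong_refl p_empty)
  then show ?thesis by simp
next
  case False
  then obtain x where x: "x \<in> B" by blast
  define key where "key i = (\<beta> i \<frown> suffix (length (\<alpha> i)) x, int (length (\<beta> i)) - int (length (\<alpha> i)))" for i
  define rep where "rep \<kappa> = (SOME i. i \<in> I \<and> key i = \<kappa>)" for \<kappa>
  define w where "w \<kappa> = p B * (S (\<alpha> (rep \<kappa>)) * T (\<beta> (rep \<kappa>)))" for \<kappa>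
  have rep: "rep (key i) \<in> I" "key (rep (key i)) = key i" if "i \<in> I" for i
    using someI[of "\<lambda>j. j \<in> I \<and> key j = key i" i] that by (auto simp: rep_def)
  have "term_sum I c (\<lambda>_. B) \<alpha> \<beta> \<approx> (\<Sum>i\<in>I. pscale (c i) (w (key i)))"
    unfolding term_sum_def
  proof (intro cong_sum cong_scale)
    fix i assume i: "i \<in> I"
    show "p B * (S (\<alpha> i) * T (\<beta> i)) \<approx> w (key i)"
      unfolding w_def
      by (rule term_cong_key[OF adm[OF i] adm[OF rep(1)[OF i]] x]) (use rep(2)[OF i] in \<open>auto simp: key_def\<close>)
  qed
  moreover have "(\<Sum>i\<in>I. pscale (c i) (w (key i))) = 0"
  proof (rule pm.sum_group_eq_0[where key=key and c=c and w=w, OF I])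
    fix \<kappa>
    \<comment> \<open>The indicator function of the target \<open>\<kappa>\<close> reads off the
      total coefficient of the terms with that key.\<close>
    have "0 = app (op_sum I c (\<lambda>_. B) \<alpha> \<beta>) (\<lambda>q. if q = \<kappa> then 1 else 0) (x, 0)"
      by (simp add: zero)
    also have "\<dots> = (\<Sum>i\<in>I. if key i = \<kappa> then c i else 0)"
      unfolding op_sum_def app_sum by (intro sum.cong refl) (auto simp: term_op_def x key_def)
    also have "\<dots> = (\<Sum>i | i \<in> I \<and> key i = \<kappa>. c i)"
      using I by (simp add: sum.inter_filter)
    finally show "(\<Sum>i | i \<in> I \<and> key i = \<kappa>. c i) = 0" by simp
  qed
  ultimately show ?thesis by simp
qed

lemma admissible_subset: "admissible B \<alpha> \<beta> \<Longrightarrow> B' \<in> bool_alg X \<Longrightarrow> B' \<subseteq> B \<Longrightarrow> admissible B' \<alpha> \<beta>"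
  by (auto simp: admissible_def)

abbreviation P :: "(nat \<Rightarrow> 'a) set \<Rightarrow> ('a, 'r) seq_op" where
  "P B \<equiv> pcomp (B \<times> UNIV) (\<lambda>q. q)"

lemma P_mult_term_op: "P B * term_op B' \<alpha> \<beta> = term_op (B \<inter> B') \<alpha> \<beta>"
  unfolding term_op_def pcomp_mult by (intro pcomp_cong) auto

lemma P_mult_P: "P B * P B' = P (B \<inter> B')"
  unfolding pcomp_mult by (intro pcomp_cong) auto

text \<open>
  The index set \<open>I2\<close> collects the terms whose set already contains \<open>B\<close>; each term of \<open>I1\<close> is
  either moved there or dropped when \<open>B\<close> is cut along its set.
\<close>

lemma term_sum_zero_split:
  assumes "finite I1" "finite I2" "I1 \<inter> I2 = {}"
    and "\<And>i. i \<in> I1 \<union> I2 \<Longrightarrow> admissible (C i) (\<alpha> i) (\<beta> i)"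
    and "B \<in> bool_alg X" "\<And>i. i \<in> I2 \<Longrightarrow> B \<subseteq> C i"
    and "P B * op_sum (I1 \<union> I2) c C \<alpha> \<beta> = 0"
  shows "p B * term_sum (I1 \<union> I2) c C \<alpha> \<beta> \<approx> 0"
  using assms
proof (induction I1 arbitrary: I2 B rule: finite_induct)
  case empty
  have Ci: "C i \<in> bool_alg X" if "i \<in> I2" for i
    using empty that by (auto simp: admissible_def)
  have "op_sum I2 c (\<lambda>_. B) \<alpha> \<beta> = P B * op_sum I2 c C \<alpha> \<beta>"
    unfolding op_sum_def sum_distrib_left
    by (intro sum.cong refl) (use empty in \<open>simp add: lo.scale_mult_right P_mult_term_op inf.absorb1\<close>)
  with empty.prems(6) have "op_sum I2 c (\<lambda>_. B) \<alpha> \<beta> = 0"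
    unfolding Un_empty_left by (rule trans[rotated])
  then have "term_sum I2 c (\<lambda>_. B) \<alpha> \<beta> \<approx> 0"
    by (intro term_sum_zero_base) (use empty.prems in \<open>auto intro: admissible_subset\<close>)
  moreover have "p B * term_sum I2 c C \<alpha> \<beta> = (\<Sum>i\<in>I2. pscale (c i) ((p B * p (C i)) * (S (\<alpha> i) * T (\<beta> i))))"
    unfolding term_sum_def sum_distrib_left by (simp add: pm.scale_mult_right mult.assoc)
  moreover have "\<dots> \<approx> term_sum I2 c (\<lambda>_. B) \<alpha> \<beta>"
    unfolding term_sum_def by (intro cong_sum cong_scale cong_mult cong_refl p_subset empty Ci)
  ultimately show ?case
    using cong_trans by simp
next
  case (insert i I1)
  let ?U = "insert i I1 \<union> I2"
  have adm: "admissible (C j) (\<alpha> j) (\<beta> j)" if "j \<in> ?U" for j using insert.prems(3) that by blast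
  have Ci: "C i \<in> bool_alg X" using adm[of i] by (auto simp: admissible_def)
  note BCi = bool_alg.Int[OF insert.prems(4) Ci] bool_alg_Diff[OF insert.prems(4) Ci]
  have zero: "P B' * op_sum ?U c C \<alpha> \<beta> = 0" if "B' \<subseteq> B" for B'
  proof -
    have "P B' * op_sum ?U c C \<alpha> \<beta> = P B' * (P B * op_sum ?U c C \<alpha> \<beta>)"
      using that by (simp add: P_mult_P inf.absorb1 flip: mult.assoc)
    then show ?thesis unfolding insert.prems(6) by simp
  qed
  have U: "?U = I1 \<union> insert i I2" by auto
  have 1: "p (B \<inter> C i) * term_sum ?U c C \<alpha> \<beta> \<approx> 0"
    unfolding U
    by (rule insert.IH) (use insert.hyps insert.prems BCi zero[of "B \<inter> C i"] in auto)
  have fin: "finite (I1 \<union> I2)" "i \<notin> I1 \<union> I2" using insert by auto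
  have os: "op_sum ?U c C \<alpha> \<beta> = oscale (c i) (term_op (C i) (\<alpha> i) (\<beta> i)) + op_sum (I1 \<union> I2) c C \<alpha> \<beta>"
    using fin by (simp add: op_sum_def)
  have "(B - C i) \<inter> C i = {}" by blast
  then have Ci_0: "P (B - C i) * term_op (C i) (\<alpha> i) (\<beta> i) = 0"
    unfolding P_mult_term_op by (simp add: term_op_def)
  have "P (B - C i) * op_sum (I1 \<union> I2) c C \<alpha> \<beta> = P (B - C i) * op_sum ?U c C \<alpha> \<beta>"
    unfolding os by (simp add: distrib_left lo.scale_mult_right Ci_0)
  also have "\<dots> = 0" by (rule zero) blast
  finally have "p (B - C i) * term_sum (I1 \<union> I2) c C \<alpha> \<beta> \<approx> 0"
    by (intro insert.IH) (use insert.hyps insert.prems BCi in auto)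
  moreover have "p (B - C i) * pscale (c i) (p (C i) * (S (\<alpha> i) * T (\<beta> i))) \<approx> 0"
  proof -
    have "p (B - C i) * pscale (c i) (p (C i) * (S (\<alpha> i) * T (\<beta> i))) =
        pscale (c i) ((p (B - C i) * p (C i)) * (S (\<alpha> i) * T (\<beta> i)))"
      by (simp add: pm.scale_mult_right mult.assoc)
    also have "\<dots> \<approx> pscale (c i) (0 * (S (\<alpha> i) * T (\<beta> i)))"
      by (intro cong_scale cong_mult cong_refl p_disjoint BCi Ci) auto
    finally show ?thesis by simp
  qed
  moreover have "term_sum ?U c C \<alpha> \<beta> = pscale (c i) (p (C i) * (S (\<alpha> i) * T (\<beta> i))) + term_sum (I1 \<union> I2) c C \<alpha> \<beta>"
    using fin by (simp add: term_sum_def)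
  ultimately have 2: "p (B - C i) * term_sum ?U c C \<alpha> \<beta> \<approx> 0"
    using cong_add[of "p (B - C i) * pscale (c i) (p (C i) * (S (\<alpha> i) * T (\<beta> i)))" 0] by (simp add: distrib_left)
  have "p B * term_sum ?U c C \<alpha> \<beta> \<approx> (p (B \<inter> C i) + p (B - C i)) * term_sum ?U c C \<alpha> \<beta>"
    by (intro cong_intros p_split insert.prems Ci)
  also have "\<dots> = p (B \<inter> C i) * term_sum ?U c C \<alpha> \<beta> + p (B - C i) * term_sum ?U c C \<alpha> \<beta>"
    by (rule distrib_right)
  also have "\<dots> \<approx> 0 + 0" by (rule cong_add[OF 1 2])
  finally show ?case by simp
qed

lemma normal_form:
  assumes "f \<in> \<F>"
  obtains C \<alpha> \<beta> and c :: "'a subshift_gen free_monoid \<Rightarrow> 'r" where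
    "\<And>w. w \<in> keys f \<Longrightarrow> admissible (C w) (\<alpha> w) (\<beta> w)"
    "f \<approx> term_sum (keys f) c C \<alpha> \<beta>" "\<rho> f = op_sum (keys f) c C \<alpha> \<beta>"
proof -
  let ?K = "keys f"
  have "\<exists>z. admissible (fst z) (fst (snd z)) (snd (snd z)) \<and>
      single w 1 \<approx> p (fst z) * (S (fst (snd z)) * T (snd (snd z)))" if w: "w \<in> ?K" for w
  proof -
    have "set (letters w) \<subseteq> subshift_gens X" using assms w by (auto simp: free_algebra_def)
    from word_normal_form[OF this] obtain B \<alpha> \<beta> where B: "B \<in> bool_alg X"
      and "single w 1 \<approx> p B * (S \<alpha> * T \<beta>)" by (auto simp: prod_list_gen)
    then have "single w 1 \<approx> p (B \<inter> C_set X \<beta> \<alpha>) * (S \<alpha> * T \<beta>)"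
      using term_shrink[OF B] cong_trans by blast
    moreover have "admissible (B \<inter> C_set X \<beta> \<alpha>) \<alpha> \<beta>"
      using B by (auto simp: admissible_def intro: bool_alg.Int bool_alg_C_set)
    ultimately show ?thesis by (intro exI[of _ "(B \<inter> C_set X \<beta> \<alpha>, \<alpha>, \<beta>)"]) simp
  qed
  then obtain z where z: "\<And>w. w \<in> ?K \<Longrightarrow> admissible (fst (z w)) (fst (snd (z w))) (snd (snd (z w))) \<and>
      single w 1 \<approx> p (fst (z w)) * (S (fst (snd (z w))) * T (snd (snd (z w))))"
    by metis
  define C \<alpha> \<beta> where "C w = fst (z w)" and "\<alpha> w = fst (snd (z w))" and "\<beta> w = snd (snd (z w))" for w
  have adm: "admissible (C w) (\<alpha> w) (\<beta> w)" and single: "single w 1 \<approx> p (C w) * (S (\<alpha> w) * T (\<beta> w))"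
    if "w \<in> ?K" for w
    using z[OF that] by (simp_all add: C_def \<alpha>_def \<beta>_def)
  have f: "f = (\<Sum>w\<in>?K. pscale (lookup f w) (single w 1))"
    by (simp add: pscale_def mult_single poly_mapping_sum_monomials)
  have cong: "f \<approx> term_sum ?K (lookup f) C \<alpha> \<beta>"
    unfolding term_sum_def by (subst (1) f) (intro cong_sum cong_scale single)
  have carrier: "finite I \<Longrightarrow> (\<And>i. i \<in> I \<Longrightarrow> C i \<in> bool_alg X) \<Longrightarrow>
      term_sum I (lookup f) C \<alpha> \<beta> \<in> \<F>" for I
    unfolding term_sum_def
    by (induction I rule: finite_induct)
      (auto intro!: free_algebra_closed(1,3,5,6) s_word_carrier p_gen_carrier)
  have "\<rho> f = \<rho> (term_sum ?K (lookup f) C \<alpha> \<beta>)"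
    by (rule cong_ev[OF cong assms carrier]) (use adm in \<open>auto simp: admissible_def\<close>)
  also have "\<dots> = op_sum ?K (lookup f) C \<alpha> \<beta>"
    unfolding term_sum_def op_sum_def lo.ev_sum lo.ev_pscale
    by (intro sum.cong refl) (use adm in \<open>auto simp: admissible_def \<rho>_term simp flip: mult.assoc\<close>)
  finally show ?thesis
    using that[OF adm cong] by simp
qed

lemma \<rho>_faithful:
  fixes f :: "('r, 'a subshift_gen) ncpoly"
  assumes f: "f \<in> \<F>" and zero: "\<rho> f = 0"
  shows "f \<in> gen_ideal (free_algebra (subshift_gens X)) (subshift_relators X)"
proof -
  obtain C \<alpha> \<beta> c where nf:
    "\<And>w. w \<in> keys f \<Longrightarrow> admissible (C w) (\<alpha> w) (\<beta> w)"
    "f \<approx> term_sum (keys f) c C \<alpha> \<beta>" "\<rho> f = op_sum (keys f) c C \<alpha> \<beta>"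
    using normal_form[OF f] by blast
  \<comment> \<open>The cutting starts with the whole space and with every set still to be cut
    along.\<close>
  have "p X * term_sum (keys f \<union> {}) c C \<alpha> \<beta> \<approx> 0"
    by (rule term_sum_zero_split) (use nf zero bool_alg_space in auto)
  moreover have "f \<approx> 1 * term_sum (keys f \<union> {}) c C \<alpha> \<beta>"
    using nf by simp
  moreover have "\<dots> \<approx> p X * term_sum (keys f \<union> {}) c C \<alpha> \<beta>"
    by (intro cong_intros cong_sym[OF p_space])
  ultimately have "f \<approx> 0" using cong_trans by blast
  then show ?thesis using cong_0_iff[OF f] by simp
qed

end

sublocale subshift_over \<subseteq> faithful_evaluation
  "oscale :: 'r \<Rightarrow> ('a, 'r) seq_op \<Rightarrow> _" "free_algebra (subshift_gens X)" "subshift_gens X"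
  "subshift_relators X" word_op
  by unfold_locales (rule \<rho>_faithful)

section \<open>Leavitt path algebras of shift graphs\<close>

lemma (in evaluation) image_subspace: "subspace (ev \<theta> ` carrier F)"
proof (rule subspaceI)
  show "0 \<in> ev \<theta> ` carrier F" using closed(1) by (rule image_eqI[rotated]) simp
  show "x + y \<in> ev \<theta> ` carrier F" if "x \<in> ev \<theta> ` carrier F" "y \<in> ev \<theta> ` carrier F" for x y
    using that closed(2) by (auto simp flip: ev_add)
  show "scale c x \<in> ev \<theta> ` carrier F" if "x \<in> ev \<theta> ` carrier F" for c x
    using that closed(4) by (auto simp flip: ev_pscale)
qed

lemma (in scaled_ring) lin_span_alg:
  assumes "subspace N" "Q \<subseteq> N"
  shows "lin_span (alg scale N) Q = span Q"
proof
  show "lin_span (alg scale N) Q \<subseteq> span Q"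
    using assms span_minimal[OF assms(2,1)] by (auto simp: lin_span_def subspace_alg span_superset)
  show "span Q \<subseteq> lin_span (alg scale N) Q"
    by (auto simp: lin_span_def subspace_alg intro: span_minimal[THEN subsetD])
qed

text \<open>The matrix unit with row \<open>x\<close> and column \<open>y\<close>, times the
  \<open>k\<close>-th power of the translation of the integer coordinate; in Laurent notation,
  \<open>t^k\<close> at position \<open>(x, y)\<close>.\<close>

definition unit_op :: "'b \<Rightarrow> int \<Rightarrow> 'b \<Rightarrow> ('b \<times> int, 'r::field) linop" where
  "unit_op x k y = pcomp ({x} \<times> UNIV) (\<lambda>(w, j). (y, j - k))"

lemma app_unit_op [simp]: "app (unit_op x k y) h (w, j) = (if w = x then h (y, j - k) else 0)"
  by (simp add: unit_op_def)

lemma unit_op_mult: "unit_op x k y * unit_op y' l z = (if y = y' then unit_op x (k + l) z else 0)"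
  by (rule linop_eqI) (auto simp: algebra_simps)

type_synonym 'a shift_graph_gen = "(nat \<Rightarrow> 'a, nat \<Rightarrow> 'a) leavitt_gen"

text \<open>Every vertex emits exactly one arc, which is therefore named by its tail. The summation
  relation becomes \<open>v x = e x * g x\<close>.\<close>

definition shift_graph :: "(nat \<Rightarrow> 'a) set \<Rightarrow> (nat \<Rightarrow> 'a, nat \<Rightarrow> 'a) pre_digraph" where
  "shift_graph V = \<lparr>verts = V, arcs = V, tail = (\<lambda>x. x), head = suffix 1\<rparr>"

lemma shift_graph_simps [simp]:
  "verts (shift_graph V) = V" "arcs (shift_graph V) = V" "tail (shift_graph V) x = x"
  "head (shift_graph V) = suffix (Suc 0)"
  by (simp_all add: shift_graph_def)

primrec leavitt_op :: "'a shift_graph_gen \<Rightarrow> ('a, 'r::field) seq_op" where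
  "leavitt_op (Vertex x) = unit_op x 0 x"
| "leavitt_op (Edge x) = unit_op x 1 (suffix 1 x)"
| "leavitt_op (Ghost x) = unit_op (suffix 1 x) (-1) x"

definition leavitt_word_op ::
  "'a shift_graph_gen free_monoid \<Rightarrow> ('a, 'r::field) seq_op" where
  "leavitt_word_op w = prod_list (map leavitt_op (letters w))"

lemma leavitt_word_op_add: "leavitt_word_op (u + v) = leavitt_word_op u * leavitt_word_op v"
  by (simp add: leavitt_word_op_def plus_free_monoid_def)

lemma ev_leavitt_word: "lo.ev leavitt_word_op (prod_list (map gen w)) = prod_list (map leavitt_op w)"
  by (simp add: prod_list_gen leavitt_word_op_def)

lemma carrier_nonunital:
  "carrier (free_nonunital_algebra G) = {f \<in> carrier (free_algebra G). lookup f 0 = 0}"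
  by (simp add: free_nonunital_algebra_def)

lemma lookup_mult_0_free_monoid:
  fixes f g :: "('r::field, 'g) ncpoly"
  assumes "lookup f 0 = 0"
  shows "lookup (f * g) 0 = 0" "lookup (g * f) 0 = 0"
proof -
  have *: "a = 0 \<and> b = 0" if "0 = a + b" for a b :: "'g free_monoid"
    using that by (cases a; cases b) (simp add: zero_free_monoid_def plus_free_monoid_def)
  have "0 \<notin> keys f" using assms by (simp add: in_keys_iff)
  then have "0 \<notin> keys (f * g)" "0 \<notin> keys (g * f)"
    using subsetD[OF keys_mult[of f g], of 0] subsetD[OF keys_mult[of g f], of 0] * by blast+
  then show "lookup (f * g) 0 = 0" "lookup (g * f) 0 = 0"
    by (simp_all add: in_keys_iff)
qed

lemma nonunital_closed:
  shows "0 \<in> carrier (free_nonunital_algebra G)"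
    and "f \<in> carrier (free_nonunital_algebra G) \<Longrightarrow> g \<in> carrier (free_nonunital_algebra G) \<Longrightarrow> f + g \<in> carrier (free_nonunital_algebra G)"
    and "f \<in> carrier (free_nonunital_algebra G) \<Longrightarrow> g \<in> carrier (free_nonunital_algebra G) \<Longrightarrow> f - g \<in> carrier (free_nonunital_algebra G)"
    and "f \<in> carrier (free_nonunital_algebra G) \<Longrightarrow> g \<in> carrier (free_nonunital_algebra G) \<Longrightarrow> f * g \<in> carrier (free_nonunital_algebra G)"
    and "f \<in> carrier (free_nonunital_algebra G) \<Longrightarrow> pscale c f \<in> carrier (free_nonunital_algebra G)"
    and "a \<in> G \<Longrightarrow> gen a \<in> carrier (free_nonunital_algebra G)"
proof -
  assume "a \<in> G"
  then show "gen a \<in> carrier (free_nonunital_algebra G)"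
    using free_algebra_closed(7)[of a G]
    by (simp add: carrier_nonunital) (simp add: gen_def lookup_single when_def zero_free_monoid_def)
qed (auto simp: carrier_nonunital free_algebra_closed lookup_add lookup_minus lookup_pscale lookup_mult_0_free_monoid)

lemma prod_list_gen_nonunital:
  "w \<noteq> [] \<Longrightarrow> set w \<subseteq> G \<Longrightarrow> prod_list (map gen w) \<in> carrier (free_nonunital_algebra G)"
  by (auto simp: carrier_nonunital prod_list_gen free_algebra_def lookup_single when_def zero_free_monoid_def)

lemma nonunital_letters:
  assumes "f \<in> carrier (free_nonunital_algebra G)" "w \<in> keys f"
  shows "letters w \<noteq> []" "set (letters w) \<subseteq> G"
proof -
  have "w \<noteq> Word []"
    using assms by (auto simp: carrier_nonunital in_keys_iff zero_free_monoid_def)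
  then show "letters w \<noteq> []" by (cases w) simp
  show "set (letters w) \<subseteq> G"
    using assms by (auto simp: carrier_nonunital free_algebra_def)
qed

declare suffix_nth [simp del]

locale shift_graph_over =
  fixes V :: "(nat \<Rightarrow> 'a) set" and coefficients :: "'r::field itself"
  assumes shift_closed: "x \<in> V \<Longrightarrow> suffix (Suc 0) x \<in> V"
begin

abbreviation gens :: "'a shift_graph_gen set" where
  "gens \<equiv> leavitt_gens (shift_graph V)"

lemma gens_simps [simp]:
  "Vertex x \<in> gens \<longleftrightarrow> x \<in> V" "Edge x \<in> gens \<longleftrightarrow> x \<in> V" "Ghost x \<in> gens \<longleftrightarrow> x \<in> V"
  by (auto simp: leavitt_gens_def)

lemma out_arcs_simps: "x \<in> V \<Longrightarrow> out_arcs (shift_graph V) x = {x}"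
  by (auto simp: out_arcs_def)

end

sublocale shift_graph_over \<subseteq> evaluation
  "oscale :: 'r \<Rightarrow> ('a, 'r) seq_op \<Rightarrow> _" "free_nonunital_algebra gens" gens
  "leavitt_relators (shift_graph V)" leavitt_word_op
proof
  show "free_nonunital_algebra gens = (free_algebra gens)\<lparr>carrier := carrier (free_nonunital_algebra gens)\<rparr>"
    by (simp add: free_nonunital_algebra_def)
  show "leavitt_relators (shift_graph V) \<subseteq> carrier (free_nonunital_algebra gens)"
    unfolding leavitt_relators_def
    by (auto simp: out_arcs_simps shift_closed intro!: nonunital_closed)
  show "\<exists>c. g - pscale c 1 \<in> carrier (free_nonunital_algebra gens)"
    if "g \<in> carrier (free_algebra gens)" for g :: "('r, 'a shift_graph_gen) ncpoly"
    by (rule exI[of _ "lookup g 0"])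
      (use that in \<open>auto simp: carrier_nonunital lookup_minus lookup_pscale intro!: free_algebra_closed\<close>)
  have gen: "lo.ev leavitt_word_op (gen g) = leavitt_op g"
    for g :: "'a shift_graph_gen"
    by (simp add: gen_def leavitt_word_op_def)
  show "lo.ev leavitt_word_op f = 0" if "f \<in> leavitt_relators (shift_graph V)"
    for f :: "('r, 'a shift_graph_gen) ncpoly"
    using that unfolding leavitt_relators_def
    by (auto simp: lo.ev_diff lo.ev_mult[OF leavitt_word_op_add] gen unit_op_mult out_arcs_simps)
qed (auto simp: carrier_nonunital nonunital_closed[unfolded carrier_nonunital, simplified] leavitt_word_op_add
    free_algebra_closed lookup_add lookup_pscale lookup_mult_0_free_monoid)

section \<open>Normal forms in the Leavitt path algebra\<close>

context shift_graph_over
begin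

abbreviation \<F>\<^sub>0 :: "('r, 'a shift_graph_gen) ncpoly set" where
  "\<F>\<^sub>0 \<equiv> carrier (free_nonunital_algebra gens)"

abbreviation v :: "(nat \<Rightarrow> 'a) \<Rightarrow> ('r, 'a shift_graph_gen) ncpoly" where "v x \<equiv> gen (Vertex x)"
abbreviation e :: "(nat \<Rightarrow> 'a) \<Rightarrow> ('r, 'a shift_graph_gen) ncpoly" where "e x \<equiv> gen (Edge x)"
abbreviation g :: "(nat \<Rightarrow> 'a) \<Rightarrow> ('r, 'a shift_graph_gen) ncpoly" where "g x \<equiv> gen (Ghost x)"

lemma suffix_closed: "x \<in> V \<Longrightarrow> suffix m x \<in> V"
proof (induction m)
  case (Suc m)
  then have "suffix (Suc 0) (suffix m x) \<in> V" by (intro shift_closed)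
  then show ?case unfolding suffix_suffix add_Suc_right add_0_right .
qed simp

lemma vv: "x \<in> V \<Longrightarrow> v x * v x \<approx> v x"
  and vv_distinct: "x \<in> V \<Longrightarrow> y \<in> V \<Longrightarrow> x \<noteq> y \<Longrightarrow> v x * v y \<approx> 0"
  and ve: "x \<in> V \<Longrightarrow> v x * e x \<approx> e x"
  and ev_head: "x \<in> V \<Longrightarrow> e x * v (suffix (Suc 0) x) \<approx> e x"
  and vg: "x \<in> V \<Longrightarrow> v (suffix (Suc 0) x) * g x \<approx> g x"
  and gv: "x \<in> V \<Longrightarrow> g x * v x \<approx> g x"
  and ge: "x \<in> V \<Longrightarrow> g x * e x \<approx> v (suffix (Suc 0) x)"
  and eg: "x \<in> V \<Longrightarrow> v x \<approx> e x * g x"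
proof -
  have "v x * v y - (if x = y then v x else 0) \<in> leavitt_relators (shift_graph V)" if "x \<in> V" "y \<in> V" for x y
    unfolding leavitt_relators_def shift_graph_simps using that by blast
  from relator_cong[OF this] show "x \<in> V \<Longrightarrow> v x * v x \<approx> v x"
    "x \<in> V \<Longrightarrow> y \<in> V \<Longrightarrow> x \<noteq> y \<Longrightarrow> v x * v y \<approx> 0" by force+
  have "g x * e y - (if x = y then v (suffix (Suc 0) x) else 0) \<in> leavitt_relators (shift_graph V)"
    if "x \<in> V" "y \<in> V" for x y
    unfolding leavitt_relators_def shift_graph_simps using that by blast
  from relator_cong[OF this] show "x \<in> V \<Longrightarrow> g x * e x \<approx> v (suffix (Suc 0) x)" by force
  show "x \<in> V \<Longrightarrow> v x * e x \<approx> e x"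
    by (rule relator_cong, unfold leavitt_relators_def shift_graph_simps)
      (rule UnI1, rule UnI1, rule UnI1, rule UnI1, rule UnI1, rule UnI2, blast)
  show "x \<in> V \<Longrightarrow> e x * v (suffix (Suc 0) x) \<approx> e x"
    by (rule relator_cong, unfold leavitt_relators_def shift_graph_simps)
      (rule UnI1, rule UnI1, rule UnI1, rule UnI1, rule UnI2, blast)
  show "x \<in> V \<Longrightarrow> v (suffix (Suc 0) x) * g x \<approx> g x"
    by (rule relator_cong, unfold leavitt_relators_def shift_graph_simps)
      (rule UnI1, rule UnI1, rule UnI1, rule UnI2, blast)
  show "x \<in> V \<Longrightarrow> g x * v x \<approx> g x"
    by (rule relator_cong, unfold leavitt_relators_def shift_graph_simps)
      (rule UnI1, rule UnI1, rule UnI2, blast)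
  have "v x - (\<Sum>e'\<in>out_arcs (shift_graph V) x. e e' * g e') \<in> leavitt_relators (shift_graph V)" if "x \<in> V"
  proof -
    have "finite (out_arcs (shift_graph V) x)" "out_arcs (shift_graph V) x \<noteq> {}"
      using out_arcs_simps[OF that] by simp_all
    then show ?thesis
      unfolding leavitt_relators_def shift_graph_simps using that by (intro UnI2) blast
  qed
  then show "x \<in> V \<Longrightarrow> v x \<approx> e x * g x"
    by (intro relator_cong) (simp add: out_arcs_simps)
qed

text \<open>The vertex at the front keeps the word nonempty at length 0, as the non-unital free
  algebra demands; for ghost words the vertex stands at the end.\<close>

primrec path_word :: "(nat \<Rightarrow> 'a) \<Rightarrow> nat \<Rightarrow> 'a shift_graph_gen list" where
  "path_word x 0 = [Vertex x]"
| "path_word x (Suc m) = path_word x m @ [Edge (suffix m x)]"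

primrec ghost_word :: "(nat \<Rightarrow> 'a) \<Rightarrow> nat \<Rightarrow> 'a shift_graph_gen list" where
  "ghost_word y 0 = [Vertex y]"
| "ghost_word y (Suc n) = Ghost (suffix n y) # ghost_word y n"

abbreviation path :: "(nat \<Rightarrow> 'a) \<Rightarrow> nat \<Rightarrow> ('r, 'a shift_graph_gen) ncpoly" where
  "path x m \<equiv> prod_list (map gen (path_word x m))"

abbreviation ghost :: "(nat \<Rightarrow> 'a) \<Rightarrow> nat \<Rightarrow> ('r, 'a shift_graph_gen) ncpoly" where
  "ghost y n \<equiv> prod_list (map gen (ghost_word y n))"

lemma v_path: "x \<in> V \<Longrightarrow> v x * path x m \<approx> path x m"
proof (induction m)
  case (Suc m)
  then have "(v x * path x m) * e (suffix m x) \<approx> path x m * e (suffix m x)"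
    by (intro cong_intros)
  then show ?case by (simp add: mult.assoc)
qed (simp add: vv)

lemma path_v: "x \<in> V \<Longrightarrow> path x m * v (suffix m x) \<approx> path x m"
proof (induction m)
  case (Suc m)
  have "path x m * (e (suffix m x) * v (suffix (Suc m) x)) \<approx> path x m * e (suffix m x)"
    by (intro cong_intros) (use ev_head[OF suffix_closed[OF Suc.prems, of m]] in simp)
  then show ?case by (simp add: mult.assoc)
qed (simp add: vv)

lemma path_Cons: "x \<in> V \<Longrightarrow> e x * path (suffix (Suc 0) x) m \<approx> path x (Suc m)"
proof (induction m)
  case 0
  have "e x * v (suffix (Suc 0) x) \<approx> v x * e x"
    using ev_head[OF 0] cong_sym[OF ve[OF 0]] by (rule cong_trans)
  then show ?case by simp
next
  case (Suc m)
  have "(e x * path (suffix (Suc 0) x) m) * e (suffix (Suc m) x) \<approx> path x (Suc m) * e (suffix (Suc m) x)"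
    by (intro cong_intros Suc)
  then show ?case by (simp add: mult.assoc)
qed

text \<open>The two paths meet in the same vertex, which emits only one edge, so the innermost
  edge-ghost pair equals that vertex.\<close>

lemma path_ghost_Suc:
  assumes "x \<in> V" "y \<in> V" "suffix m x = suffix n y"
  shows "path x (Suc m) * ghost y (Suc n) \<approx> path x m * ghost y n"
proof -
  have z: "suffix m x \<in> V" by (rule suffix_closed) fact
  have "path x (Suc m) * ghost y (Suc n) = (path x m * (e (suffix m x) * g (suffix m x))) * ghost y n"
    using assms by (simp add: mult.assoc)
  also have "\<dots> \<approx> (path x m * v (suffix m x)) * ghost y n"
    by (intro cong_intros cong_sym[OF eg] z)
  also have "\<dots> \<approx> path x m * ghost y n"
    by (intro cong_intros path_v assms)
  finally show ?thesis .
qed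

lemma path_ghost_add:
  assumes "x \<in> V" "y \<in> V" "suffix m x = suffix n y"
  shows "path x (m + d) * ghost y (n + d) \<approx> path x m * ghost y n"
proof (induction d)
  case (Suc d)
  have "suffix (m + d) x = suffix d (suffix m x)" "suffix (n + d) y = suffix d (suffix n y)" by simp_all
  then have "suffix (m + d) x = suffix (n + d) y" using assms(3) by metis
  then show ?case
    unfolding add_Suc_right by (rule cong_trans[OF path_ghost_Suc[OF assms(1,2)] Suc])
qed simp

text \<open>With equal length differences one pair of paths is a common lengthening of the other, so
  the product depends only on \<open>x\<close>, \<open>y\<close> and the degree.\<close>

lemma path_ghost_key:
  assumes "x \<in> V" "y \<in> V" "suffix m x = suffix n y" "suffix m' x = suffix n' y"
    and "int m - int n = int m' - int n'"
  shows "path x m * ghost y n \<approx> path x m' * ghost y n'"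
proof (cases "m \<le> m'")
  case True
  then have "m' = m + (m' - m)" "n' = n + (m' - m)" using assms(5) by auto
  then show ?thesis
    using path_ghost_add[OF assms(1-3), of "m' - m"] cong_sym by metis
next
  case False
  then have "m = m' + (m - m')" "n = n' + (m - m')" using assms(5) by auto
  then show ?thesis
    using path_ghost_add[OF assms(1,2,4), of "m - m'"] by metis
qed

lemma letter_path_ghost:
  assumes a: "a \<in> gens" and xy: "x \<in> V" "y \<in> V" "suffix m x = suffix n y"
  shows "gen a * (path x m * ghost y n) \<approx> 0 \<or>
    (\<exists>x'\<in>V. \<exists>m' n'. suffix m' x' = suffix n' y \<and> int m' - int n' = leavitt_degree a + (int m - int n) \<and>
      gen a * (path x m * ghost y n) \<approx> path x' m' * ghost y n')"
proof -
  let ?t = "path x m * ghost y n"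
  have "v x * ?t = (v x * path x m) * ghost y n" by (simp add: mult.assoc)
  also have "\<dots> \<approx> ?t" by (intro cong_intros v_path xy)
  finally have vt: "v x * ?t \<approx> ?t" .
  \<comment> \<open>The vertex in which \<open>gen a\<close> ends is orthogonal to the vertex
    \<open>x\<close> in which \<open>?t\<close> starts.\<close>
  have distinct: "gen a * ?t \<approx> 0" if "w \<in> V" "w \<noteq> x" "gen a * v w \<approx> gen a" for w
  proof -
    have "gen a * ?t \<approx> (gen a * v w) * (v x * ?t)"
      by (intro cong_mult cong_sym[OF vt] cong_sym[OF that(3)])
    also have "\<dots> = gen a * ((v w * v x) * ?t)" by (simp add: mult.assoc)
    also have "\<dots> \<approx> gen a * (0 * ?t)" by (intro cong_intros vv_distinct that xy)
    finally show ?thesis by simp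
  qed
  from a consider w where "w \<in> V" "a = Vertex w" | w where "w \<in> V" "a = Edge w" | w where "w \<in> V" "a = Ghost w"
    by (auto simp: leavitt_gens_def)
  then show ?thesis
  proof cases
    case 1
    show ?thesis
    proof (cases "w = x")
      case True
      then show ?thesis using 1 vt xy by (intro disjI2 bexI[of _ x] exI[of _ m] exI[of _ n]) simp_all
    next
      case False
      then show ?thesis using distinct[of w] 1 vv by simp
    qed
  next
    case 2
    show ?thesis
    proof (cases "suffix (Suc 0) w = x")
      case True
      have "gen a * ?t = (e w * path (suffix (Suc 0) w) m) * ghost y n" using 2 True by (simp add: mult.assoc)
      also have "\<dots> \<approx> path w (Suc m) * ghost y n" by (intro cong_intros path_Cons 2)
      finally show ?thesis
        using 2 True xy by (intro disjI2 bexI[of _ w] exI[of _ "Suc m"] exI[of _ n]) auto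
    next
      case False
      then show ?thesis using distinct[of "suffix (Suc 0) w"] 2 ev_head[OF 2(1)] shift_closed[OF 2(1)] by simp
    qed
  next
    case 3
    show ?thesis
    proof (cases "w = x")
      case True
      \<comment> \<open>The path may have length 0; lengthening both paths first provides an edge
        against which the ghost edge can cancel.\<close>
      have "gen a * ?t \<approx> g x * (path x (Suc m) * ghost y (Suc n))"
        unfolding 3 True by (intro cong_intros cong_sym[OF path_ghost_Suc] xy)
      also have "\<dots> = (g x * path x (Suc m)) * ghost y (Suc n)" by (simp add: mult.assoc)
      also have "\<dots> \<approx> (g x * (e x * path (suffix (Suc 0) x) m)) * ghost y (Suc n)"
        by (intro cong_intros cong_sym[OF path_Cons] xy)
      also have "\<dots> = (g x * e x) * path (suffix (Suc 0) x) m * ghost y (Suc n)" by (simp add: mult.assoc)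
      also have "\<dots> \<approx> v (suffix (Suc 0) x) * path (suffix (Suc 0) x) m * ghost y (Suc n)"
        by (intro cong_intros ge xy)
      also have "\<dots> \<approx> path (suffix (Suc 0) x) m * ghost y (Suc n)"
        by (intro cong_intros v_path shift_closed xy)
      finally have "gen a * ?t \<approx> path (suffix (Suc 0) x) m * ghost y (Suc n)" .
      moreover have "suffix m (suffix (Suc 0) x) = suffix (Suc n) y"
      proof -
        have "suffix m (suffix (Suc 0) x) = suffix (Suc 0) (suffix m x)" by simp
        also have "\<dots> = suffix (Suc n) y" unfolding xy(3) by simp
        finally show ?thesis .
      qed
      ultimately show ?thesis
        using 3 shift_closed[OF xy(1)]
        by (intro disjI2 bexI[of _ "suffix (Suc 0) x"] exI[of _ m] exI[of _ "Suc n"]) auto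
    next
      case False
      then show ?thesis using distinct[of w] 3 gv by simp
    qed
  qed
qed

lemma gen_normal_form:
  assumes "a \<in> gens"
  shows "\<exists>x\<in>V. \<exists>y\<in>V. \<exists>m n. suffix m x = suffix n y \<and> int m - int n = leavitt_degree a \<and>
    gen a \<approx> path x m * ghost y n"
proof -
  from assms consider w where "w \<in> V" "a = Vertex w" | w where "w \<in> V" "a = Edge w" | w where "w \<in> V" "a = Ghost w"
    by (auto simp: leavitt_gens_def)
  then show ?thesis
  proof cases
    case 1
    have "v w \<approx> path w 0 * ghost w 0" using cong_sym[OF vv[OF 1(1)]] by simp
    then show ?thesis using 1
      by (intro bexI[of _ w] bexI[of _ w] exI[of _ 0] exI[of _ 0]) simp_all
  next
    case 2
    have "path w 1 * ghost (suffix (Suc 0) w) 0 = (v w * e w) * v (suffix (Suc 0) w)" by (simp add: mult.assoc)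
    also have "\<dots> \<approx> e w * v (suffix (Suc 0) w)" by (intro cong_intros ve 2)
    also have "\<dots> \<approx> e w" by (intro ev_head 2)
    finally show ?thesis using 2 shift_closed[OF 2(1)] cong_sym
      by (intro bexI[of _ w] bexI[of _ "suffix (Suc 0) w"] exI[of _ 1] exI[of _ 0]) simp_all
  next
    case 3
    have "path (suffix (Suc 0) w) 0 * ghost w 1 = v (suffix (Suc 0) w) * (g w * v w)" by simp
    also have "\<dots> \<approx> v (suffix (Suc 0) w) * g w" by (intro cong_intros gv 3)
    also have "\<dots> \<approx> g w" by (intro vg 3)
    finally show ?thesis using 3 shift_closed[OF 3(1)] cong_sym
      by (intro bexI[of _ w] bexI[of _ "suffix (Suc 0) w"] exI[of _ 0] exI[of _ 1]) simp_all
  qed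
qed

text \<open>The scalar \<open>b\<close> lets a vanishing word share this shape. Such a word
  determines no lag, hence the guard on the degree equation.\<close>

lemma word_normal_form:
  "w \<noteq> [] \<Longrightarrow> set w \<subseteq> gens \<Longrightarrow>
    \<exists>b. \<exists>x\<in>V. \<exists>y\<in>V. \<exists>m n. suffix m x = suffix n y \<and> (b \<noteq> 0 \<longrightarrow> int m - int n = sum_list (map leavitt_degree w)) \<and>
      prod_list (map gen w) \<approx> pscale b (path x m * ghost y n)"
proof (induction w rule: induct_list012)
  case (2 a)
  then show ?case
    using gen_normal_form[of a] by (intro exI[of _ 1]) simp
next
  case (3 a a' w)
  then obtain b x y m n where xy: "x \<in> V" "y \<in> V" "suffix m x = suffix n y"
    and deg: "b \<noteq> 0 \<longrightarrow> int m - int n = sum_list (map leavitt_degree (a' # w))"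
    and IH: "prod_list (map gen (a' # w)) \<approx> pscale b (path x m * ghost y n)" by fastforce
  have step: "prod_list (map gen (a # a' # w)) \<approx> pscale b (gen a * (path x m * ghost y n))"
    using cong_mult_left[OF IH, of "gen a"] by (simp add: pm.scale_mult_right)
  have a: "a \<in> gens" using 3 by simp
  from letter_path_ghost[OF a xy] show ?case
  proof
    assume "gen a * (path x m * ghost y n) \<approx> 0"
    then have "prod_list (map gen (a # a' # w)) \<approx> pscale 0 (path x m * ghost y n)"
      using cong_trans[OF step cong_scale] by fastforce
    then show ?thesis using xy by blast
  next
    assume "\<exists>x'\<in>V. \<exists>m' n'. suffix m' x' = suffix n' y \<and> int m' - int n' = leavitt_degree a + (int m - int n) \<and>
      gen a * (path x m * ghost y n) \<approx> path x' m' * ghost y n'"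
    then obtain x' m' n' where x': "x' \<in> V" "suffix m' x' = suffix n' y"
      "int m' - int n' = leavitt_degree a + (int m - int n)"
      and c: "gen a * (path x m * ghost y n) \<approx> path x' m' * ghost y n'" by blast
    show ?thesis
      by (rule exI[of _ b], rule bexI[OF _ x'(1)], rule bexI[OF _ xy(2)], rule exI[of _ m'], rule exI[of _ n'])
        (use cong_trans[OF step cong_scale[OF c]] x' deg in auto)
  qed
qed simp

lemma ev_path_ghost:
  assumes "suffix m x = suffix n y"
  shows "lo.ev leavitt_word_op (path x m * ghost y n) = unit_op x (int m - int n) y"
proof -
  have "prod_list (map leavitt_op (path_word x m)) = (unit_op x (int m) (suffix m x) :: (_, 'r) linop)" for m
    by (induction m) (simp_all add: unit_op_mult add.commute)
  moreover have "prod_list (map leavitt_op (ghost_word y n)) = (unit_op (suffix n y) (- int n) y :: (_, 'r) linop)" for n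
    by (induction n) (simp_all add: unit_op_mult)
  ultimately show ?thesis
    using assms by (simp add: lo.ev_mult[OF leavitt_word_op_add] ev_leavitt_word unit_op_mult)
qed

lemma path_ghost_gens:
  assumes "x \<in> V" "y \<in> V"
  shows "set (path_word x m @ ghost_word y n) \<subseteq> gens"
    and "sum_list (map leavitt_degree (path_word x m @ ghost_word y n)) = int m - int n"
    and "path_word x m @ ghost_word y n \<noteq> []"
proof -
  have "set (path_word x m) \<subseteq> gens" "set (ghost_word y n) \<subseteq> gens"
    using assms by (induction m; induction n; simp add: suffix_closed)+
  then show "set (path_word x m @ ghost_word y n) \<subseteq> gens" by simp
  have "sum_list (map leavitt_degree (path_word x m)) = int m" by (induction m) simp_all
  moreover have "sum_list (map leavitt_degree (ghost_word y n)) = - int n" by (induction n) simp_all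
  ultimately show "sum_list (map leavitt_degree (path_word x m @ ghost_word y n)) = int m - int n" by simp
  show "path_word x m @ ghost_word y n \<noteq> []" by (cases m) simp_all
qed

lemma path_ghost_carrier:
  "x \<in> V \<Longrightarrow> y \<in> V \<Longrightarrow> path x m * ghost y n \<in> \<F>\<^sub>0"
  using prod_list_gen_nonunital[OF path_ghost_gens(3,1), of x y m n] by simp

text \<open>Terms with the same key \<open>(x, m - n, y)\<close> are congruent by
  \<open>path_ghost_key\<close>, and each key has its own matrix unit, so the coefficients can be
  compared globally.\<close>

lemma leavitt_faithful:
  fixes f :: "('r, 'a shift_graph_gen) ncpoly"
  assumes f: "f \<in> \<F>\<^sub>0" and zero: "lo.ev leavitt_word_op f = 0"
  shows "f \<in> gen_ideal (free_nonunital_algebra gens) (leavitt_relators (shift_graph V))"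
proof -
  let ?K = "keys f"
  have f': "f \<in> carrier (free_algebra gens)" using f by (simp add: carrier_nonunital)
  have "\<exists>b x y m n. x \<in> V \<and> y \<in> V \<and> suffix m x = suffix n y \<and>
      single w (1::'r) \<approx> pscale b (path x m * ghost y n)" if w: "w \<in> ?K" for w
  proof -
    from word_normal_form[OF nonunital_letters[OF f w]] show ?thesis by (simp add: prod_list_gen) blast
  qed
  then obtain b x y m n where nf: "\<And>w. w \<in> ?K \<Longrightarrow> x w \<in> V \<and> y w \<in> V \<and> suffix (m w) (x w) = suffix (n w) (y w) \<and>
      single w (1::'r) \<approx> pscale (b w) (path (x w) (m w) * ghost (y w) (n w))"
    by metis
  define c where "c w = lookup f w * b w" for w
  define t where "t w = path (x w) (m w) * ghost (y w) (n w)" for w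
  define key where "key w = (x w, int (m w) - int (n w), y w)" for w
  define rep where "rep \<kappa> = (SOME w. w \<in> ?K \<and> key w = \<kappa>)" for \<kappa>
  have rep: "rep (key w) \<in> ?K" "key (rep (key w)) = key w" if "w \<in> ?K" for w
    using someI[of "\<lambda>j. j \<in> ?K \<and> key j = key w" w] that by (auto simp: rep_def)
  have f_eq: "f = (\<Sum>w\<in>?K. pscale (lookup f w) (single w 1))"
    by (simp add: pscale_def mult_single poly_mapping_sum_monomials)
  have "f \<approx> (\<Sum>w\<in>?K. pscale (lookup f w) (pscale (b w) (t w)))"
    unfolding t_def by (subst (1) f_eq) (intro cong_sum cong_scale, use nf in blast)
  then have cong: "f \<approx> (\<Sum>w\<in>?K. pscale (c w) (t w))"
    by (simp add: c_def)
  have tc: "t w \<in> carrier (free_algebra gens)" if "w \<in> ?K" for w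
    using path_ghost_carrier nf[OF that] by (auto simp: t_def carrier_nonunital)
  have sc: "finite I \<Longrightarrow> I \<subseteq> ?K \<Longrightarrow> (\<Sum>w\<in>I. pscale (c w) (t w)) \<in> carrier (free_algebra gens)" for I
    by (induction I rule: finite_induct) (auto intro!: free_algebra_closed(1,3,6) tc)
  have "0 = lo.ev leavitt_word_op (\<Sum>w\<in>?K. pscale (c w) (t w))"
    using cong_ev[OF cong f' sc] zero by simp
  also have "\<dots> = (\<Sum>w\<in>?K. oscale (c w) (unit_op (x w) (int (m w) - int (n w)) (y w)))"
    unfolding lo.ev_sum lo.ev_pscale t_def
    by (intro sum.cong refl arg_cong[where f = "oscale _"] ev_path_ghost) (use nf in blast)
  finally have zero': "(\<Sum>w\<in>?K. oscale (c w) (unit_op (x w) (int (m w) - int (n w)) (y w))) = 0" by simp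
  have "(\<Sum>w\<in>?K. pscale (c w) (t w)) \<approx> (\<Sum>w\<in>?K. pscale (c w) (t (rep (key w))))"
  proof (intro cong_sum cong_scale)
    fix w assume w: "w \<in> ?K"
    show "t w \<approx> t (rep (key w))"
      using nf[OF w] nf[OF rep(1)[OF w]] rep(2)[OF w] unfolding t_def
      by (simp add: key_def path_ghost_key)
  qed
  moreover have "(\<Sum>w\<in>?K. pscale (c w) (t (rep (key w)))) = 0"
  proof (rule pm.sum_group_eq_0[where key = key and c = c and w = "\<lambda>\<kappa>. t (rep \<kappa>)"])
    fix \<kappa> :: "(nat \<Rightarrow> 'a) \<times> int \<times> (nat \<Rightarrow> 'a)"
    obtain x0 k y0 where \<kappa>: "\<kappa> = (x0, k, y0)" by (cases \<kappa>)
    \<comment> \<open>At \<open>(x0, 0)\<close> the indicator of \<open>(y0, - k)\<close> detects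
      exactly \<open>unit_op x0 k y0\<close>.\<close>
    have "0 = app (\<Sum>w\<in>?K. oscale (c w) (unit_op (x w) (int (m w) - int (n w)) (y w)))
        (\<lambda>q. if q = (y0, - k) then 1 else 0) (x0, 0)"
      by (simp add: zero')
    also have "\<dots> = (\<Sum>w\<in>?K. if key w = \<kappa> then c w else 0)"
      unfolding app_sum by (intro sum.cong refl) (auto simp: key_def \<kappa>)
    also have "\<dots> = (\<Sum>w | w \<in> ?K \<and> key w = \<kappa>. c w)"
      by (simp add: sum.inter_filter)
    finally show "(\<Sum>w | w \<in> ?K \<and> key w = \<kappa>. c w) = 0" by simp
  qed simp
  ultimately have "(\<Sum>w\<in>?K. pscale (c w) (t w)) \<approx> 0" by simp
  with cong have "f \<approx> 0" by (rule cong_trans)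
  then show ?thesis using cong_0_iff[OF f'] by simp
qed

end

sublocale shift_graph_over \<subseteq> faithful_evaluation
  "oscale :: 'r \<Rightarrow> ('a, 'r) seq_op \<Rightarrow> _" "free_nonunital_algebra gens" gens
  "leavitt_relators (shift_graph V)" leavitt_word_op
  by unfold_locales (rule leavitt_faithful)

section \<open>Image and degrees of the Leavitt path algebra\<close>

context shift_graph_over
begin

definition units_deg :: "int \<Rightarrow> ('a, 'r) seq_op set" where
  "units_deg k = {unit_op x k y |x y m n. x \<in> V \<and> y \<in> V \<and> suffix m x = suffix n y \<and> k = int m - int n}"

definition units :: "('a, 'r) seq_op set" where
  "units = (\<Union>k. units_deg k)"

lemma ev_word:
  assumes "w \<noteq> []" "set w \<subseteq> gens"
  shows "lo.ev leavitt_word_op (prod_list (map gen w)) \<in> lo.span (units_deg (sum_list (map leavitt_degree w)))"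
proof -
  from word_normal_form[OF assms] obtain b x y m n where
    xy: "x \<in> V" "y \<in> V" "suffix m x = suffix n y" and b: "b \<noteq> 0 \<longrightarrow> int m - int n = sum_list (map leavitt_degree w)"
    and cong: "prod_list (map gen w) \<approx> pscale b (path x m * ghost y n)" by blast
  have "lo.ev leavitt_word_op (prod_list (map gen w)) = lo.ev leavitt_word_op (pscale b (path x m * ghost y n))"
    by (rule cong_ev[OF cong]) (use prod_list_gen_nonunital[OF assms] path_ghost_carrier[OF xy(1,2)]
        in \<open>auto simp: carrier_nonunital intro: free_algebra_closed\<close>)
  also have "\<dots> = oscale b (unit_op x (int m - int n) y)"
    using xy by (simp add: lo.ev_pscale ev_path_ghost)
  also have "\<dots> \<in> lo.span (units_deg (sum_list (map leavitt_degree w)))"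
  proof (cases "b = 0")
    case False
    with b have deg: "sum_list (map leavitt_degree w) = int m - int n" by simp
    have "unit_op x (int m - int n) y \<in> units_deg (sum_list (map leavitt_degree w))"
      unfolding units_deg_def deg using xy by blast
    then show ?thesis by (intro lo.span_scale lo.span_base)
  qed (simp add: lo.span_zero)
  finally show ?thesis .
qed

lemma units_deg_subset: "units_deg k \<subseteq> units"
  by (auto simp: units_def)

lemma units_ev:
  "units_deg k \<subseteq> (\<lambda>w. lo.ev leavitt_word_op (prod_list (map gen w))) `
     {w. w \<noteq> [] \<and> set w \<subseteq> gens \<and> sum_list (map leavitt_degree w) = k}"
proof
  fix u assume "u \<in> units_deg k"
  then obtain x y m n where xy: "x \<in> V" "y \<in> V" "suffix m x = suffix n y" "k = int m - int n" "u = unit_op x k y"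
    by (auto simp: units_deg_def)
  have "u = lo.ev leavitt_word_op (prod_list (map gen (path_word x m @ ghost_word y n)))"
    using ev_path_ghost[OF xy(3)] xy by simp
  then show "u \<in> (\<lambda>w. lo.ev leavitt_word_op (prod_list (map gen w))) `
     {w. w \<noteq> [] \<and> set w \<subseteq> gens \<and> sum_list (map leavitt_degree w) = k}"
    using path_ghost_gens[OF xy(1,2), of m n] xy(4)
    by (intro image_eqI[of _ _ "path_word x m @ ghost_word y n"]) simp_all
qed

lemma image_leavitt: "lo.ev leavitt_word_op ` \<F>\<^sub>0 = lo.span units"
proof
  show "lo.ev leavitt_word_op ` \<F>\<^sub>0 \<subseteq> lo.span units"
  proof
    fix u :: "('a, 'r) seq_op"
    assume "u \<in> lo.ev leavitt_word_op ` \<F>\<^sub>0"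
    then obtain f where f: "f \<in> \<F>\<^sub>0" and u: "u = lo.ev leavitt_word_op f" by blast
    have "leavitt_word_op w \<in> lo.span units" if w: "w \<in> keys f" for w
    proof -
      from ev_word[OF nonunital_letters[OF f w]] lo.span_mono[OF units_deg_subset] show ?thesis
        by (auto simp: ev_leavitt_word leavitt_word_op_def)
    qed
    then show "u \<in> lo.span units"
      unfolding u lo.ev_def by (intro lo.span_sum lo.span_scale)
  qed
  note image_subspace
  moreover have "units \<subseteq> lo.ev leavitt_word_op ` \<F>\<^sub>0"
  proof
    fix u assume "u \<in> units"
    then obtain k where "u \<in> units_deg k" by (auto simp: units_def)
    then show "u \<in> lo.ev leavitt_word_op ` \<F>\<^sub>0"
      using units_ev[of k] prod_list_gen_nonunital by blast
  qed
  ultimately show "lo.span units \<subseteq> lo.ev leavitt_word_op ` \<F>\<^sub>0"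
    by (rule lo.span_minimal[rotated])
qed

lemma leavitt_iso: "alg_iso (leavitt_algebra (shift_graph V)) (alg oscale (lo.span units)) image_map"
  using presented_alg_iso by (simp add: image_leavitt leavitt_algebra_def)

lemma image_leavitt_grading: "image_map ` leavitt_grading (shift_graph V) k = lo.span (units_deg k)"
proof -
  let ?W = "{w. w \<noteq> [] \<and> set w \<subseteq> gens \<and> sum_list (map leavitt_degree w) = k}"
  let ?c = "\<lambda>w. pres_class (free_nonunital_algebra gens) (leavitt_relators (shift_graph V))
    (prod_list (map gen w) :: ('r, 'a shift_graph_gen) ncpoly)"
  have W: "leavitt_grading (shift_graph V) k = lin_span (leavitt_algebra (shift_graph V)) (?c ` ?W)"
    unfolding leavitt_grading_def by (rule arg_cong[where f = "lin_span _"]) blast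
  have sub: "?c ` ?W \<subseteq> carrier (leavitt_algebra (shift_graph V))"
    unfolding leavitt_algebra_def by (auto intro!: pres_class_carrier prod_list_gen_nonunital)
  have im: "image_map ` ?c ` ?W = (\<lambda>w. lo.ev leavitt_word_op (prod_list (map gen w))) ` ?W"
    unfolding image_image by (intro image_cong refl image_map_pres_class prod_list_gen_nonunital) auto
  have "image_map ` leavitt_grading (shift_graph V) k = lin_span (alg oscale (lo.span units)) (image_map ` ?c ` ?W)"
    unfolding W by (rule lin_span_iso[OF leavitt_iso sub])
  also have "\<dots> = lo.span (image_map ` ?c ` ?W)"
  proof (rule lo.lin_span_alg)
    show "image_map ` ?c ` ?W \<subseteq> lo.span units"
      unfolding im using ev_word lo.span_mono[OF units_deg_subset] by blast
  qed simp
  also have "\<dots> = lo.span (units_deg k)"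
    unfolding im
  proof (rule lo.span_eq[THEN iffD2], intro conjI)
    show "(\<lambda>w. lo.ev leavitt_word_op (prod_list (map gen w))) ` ?W \<subseteq> lo.span (units_deg k)"
      using ev_word by blast
    show "units_deg k \<subseteq> lo.span ((\<lambda>w. lo.ev leavitt_word_op (prod_list (map gen w))) ` ?W)"
      using units_ev[of k] lo.span_superset by (rule subset_trans)
  qed
  finally show ?thesis .
qed

end

section \<open>Homogeneous operators and line points\<close>

lemma app_zero [simp]: "app f (\<lambda>_. 0) = (\<lambda>_. 0)"
proof -
  have "app f (\<lambda>q. 0 * 0) = (\<lambda>q. 0 * app f (\<lambda>_. 0) q)"
    using app[of f] by (simp only: mem_Collect_eq)
  then show ?thesis by simp
qed

lemma unit_op_inject_nonzero: "unit_op x k y \<noteq> (0 :: ('b \<times> int, 'r::field) linop)"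
proof
  assume "unit_op x k y = (0 :: ('b \<times> int, 'r) linop)"
  then have "app (unit_op x k y) (\<lambda>_. 1 :: 'r) (x, 0) = app 0 (\<lambda>_. 1) (x, 0)" by simp
  then show False by simp
qed

text \<open>Membership of \<open>(x, k, y)\<close> in the Deaconu-Renault groupoid of the shift; the
  next lemmas are its units, inverses and products.\<close>

definition lag_rel :: "(nat \<Rightarrow> 'a) \<Rightarrow> int \<Rightarrow> (nat \<Rightarrow> 'a) \<Rightarrow> bool" where
  "lag_rel x k y \<longleftrightarrow> (\<exists>m n. suffix m x = suffix n y \<and> k = int m - int n)"

lemma lag_rel_refl: "lag_rel x 0 x"
  unfolding lag_rel_def by (intro exI[of _ 0]) simp

lemma lag_rel_sym: "lag_rel x k y \<Longrightarrow> lag_rel y (- k) x"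
  unfolding lag_rel_def by (metis minus_diff_eq)

lemma suffix_add_eq: "suffix m x = suffix n y \<Longrightarrow> suffix (m + d) x = suffix (n + d) y"
  by (metis suffix_suffix)

lemma lag_rel_trans:
  assumes "lag_rel x k y" "lag_rel y l z"
  shows "lag_rel x (k + l) z"
proof -
  from assms obtain m n m' n' where *: "suffix m x = suffix n y" "k = int m - int n"
    "suffix m' y = suffix n' z" "l = int m' - int n'" by (auto simp: lag_rel_def)
  have "suffix (m + m') x = suffix (n + m') y" using *(1) by (rule suffix_add_eq)
  also have "\<dots> = suffix (n' + n) z" using suffix_add_eq[OF *(3), of n] by (simp add: add.commute)
  finally show ?thesis
    unfolding lag_rel_def using *(2,4) by (intro exI[of _ "m + m'"] exI[of _ "n' + n"]) auto
qed

lemma lag_rel_conc: "lag_rel (\<alpha> \<frown> z) (int (length \<alpha>) - int (length \<beta>)) (\<beta> \<frown> z)"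
  unfolding lag_rel_def by (intro exI[of _ "length \<alpha>"] exI[of _ "length \<beta>"]) simp

context shift_space
begin

text \<open>The injectivity condition says that \<open>x\<close> is not eventually periodic. The
  name follows graph theory: in the shift graph such a vertex starts a path without bifurcation or
  cycle.\<close>

definition line_points :: "(nat \<Rightarrow> 'a) set" where
  "line_points = {x \<in> X. {x} \<in> bool_alg X \<and> (\<forall>m n. suffix m x = suffix n x \<longrightarrow> m = n)}"

lemma line_pointsD: "x \<in> line_points \<Longrightarrow> suffix m x = suffix n x \<Longrightarrow> m = n"
  by (simp add: line_points_def)

text \<open>The difference of two lags is a lag from \<open>y\<close> to itself, which would be a
  period of a tail of \<open>y\<close> unless it is zero.\<close>

lemma lag_rel_unique:
  assumes y: "y \<in> line_points" and k: "lag_rel x k y" "lag_rel x l y"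
  shows "k = l"
proof -
  have "lag_rel y (- k + l) y" using lag_rel_trans[OF lag_rel_sym[OF k(1)] k(2)] .
  then obtain m n where "suffix m y = suffix n y" "- k + l = int m - int n" by (auto simp: lag_rel_def)
  then show ?thesis using line_pointsD[OF y, of m n] by simp
qed

lemma singleton_suffix:
  assumes "{x} \<in> bool_alg X" shows "{suffix m x} \<in> bool_alg X"
proof (induction m)
  case (Suc m)
  have "range_set {suffix m x} (suffix m x 0) = {suffix (Suc m) x}"
  proof (intro equalityI subsetI)
    fix y assume "y \<in> range_set {suffix m x} (suffix m x 0)"
    then have "suffix 1 (suffix m x 0 ## y) = suffix 1 (suffix m x)" by (simp add: range_set_def)
    moreover have "suffix 1 (suffix m x 0 ## y) = y" by (simp add: suffix_def)
    ultimately show "y \<in> {suffix (Suc m) x}" by simp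
  next
    fix y assume "y \<in> {suffix (Suc m) x}"
    then show "y \<in> range_set {suffix m x} (suffix m x 0)"
      using build_first[of "suffix m x"] by (simp add: range_set_def)
  qed
  then show ?case using bool_alg_range_set[OF Suc, of "suffix m x 0"] by simp
qed (simp add: assms)

lemma line_points_suffix: "x \<in> line_points \<Longrightarrow> suffix m x \<in> line_points"
  using line_pointsD[of x "m + _" "m + _"] by (auto simp: line_points_def suffix_closed singleton_suffix)

text \<open>Prefix replacement does not leave the line points; this is what keeps products of
  algebra elements with their matrix units, on either side, in the span of these units.\<close>

lemma line_points_conc:
  assumes "\<beta> \<frown> z \<in> line_points" "\<alpha> \<frown> z \<in> X"
  shows "\<alpha> \<frown> z \<in> line_points"
proof -
  have z: "z \<in> line_points" using line_points_suffix[OF assms(1), of "length \<beta>"] by simp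
  then have "pre \<alpha> {z} \<in> bool_alg X" by (intro bool_alg_pre) (simp add: line_points_def)
  moreover have "pre \<alpha> {z} = {\<alpha> \<frown> z}" using assms(2) by (auto simp: pre_def)
  moreover have "m = n" if "suffix m (\<alpha> \<frown> z) = suffix n (\<alpha> \<frown> z)" for m n
  proof -
    have "suffix m z = suffix n z"
      using suffix_add_eq[OF that, of "length \<alpha>"] by simp
    then show ?thesis by (rule line_pointsD[OF z])
  qed
  ultimately show ?thesis using assms(2) by (auto simp: line_points_def)
qed

section \<open>Separating points by members of the Boolean algebra\<close>

lemma cylinder_iff: "w \<in> C_set X [] (prefix N y) \<longleftrightarrow> w \<in> X \<and> (\<forall>i<N. w i = y i)"
proof
  assume "w \<in> C_set X [] (prefix N y)"
  then obtain z where w: "w = prefix N y \<frown> z" "w \<in> X" by (auto simp: C_set_def)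
  then show "w \<in> X \<and> (\<forall>i<N. w i = y i)" by simp
next
  assume w: "w \<in> X \<and> (\<forall>i<N. w i = y i)"
  then have "prefix N w = prefix N y" by (intro nth_equalityI) simp_all
  then have "w = prefix N y \<frown> suffix N w" by (metis prefix_suffix)
  then show "w \<in> C_set X [] (prefix N y)"
    using w suffix_closed[of w N] unfolding C_set_def by auto
qed

text \<open>A long cylinder separates \<open>x\<close> from finitely many points. Read
  contrapositively, a member of the Boolean algebra around a non-isolated point is infinite and
  leaves room to avoid finitely many bad points.\<close>

lemma singleton_of_finite:
  assumes "B \<in> bool_alg X" "finite B" "x \<in> B"
  shows "{x} \<in> bool_alg X"
proof -
  have "\<exists>i. w i \<noteq> x i" if "w \<in> B - {x}" for w using that by auto
  then obtain \<delta> where \<delta>: "\<And>w. w \<in> B - {x} \<Longrightarrow> w (\<delta> w) \<noteq> x (\<delta> w)" by metis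
  \<comment> \<open>The sum exceeds every single position of difference, so a prefix of length
    \<open>N\<close> sees all of them.\<close>
  define N where "N = Suc (\<Sum>w\<in>B - {x}. \<delta> w)"
  have "\<delta> w < N" if "w \<in> B - {x}" for w
    unfolding N_def less_Suc_eq_le by (rule member_le_sum) (use that assms in auto)
  then have "w = x" if "w \<in> B" "w \<in> C_set X [] (prefix N x)" for w
    using \<delta>[of w] that unfolding cylinder_iff by blast
  moreover have "x \<in> C_set X [] (prefix N x)"
    using assms bool_alg_subset[OF assms(1)] unfolding cylinder_iff by blast
  ultimately have "B \<inter> C_set X [] (prefix N x) = {x}"
    using assms(3) by blast
  then show ?thesis using bool_alg.Int[OF assms(1) bool_alg_C_set[of "[]" "prefix N x"]] by simp
qed

text \<open>On such a \<open>B\<close> the same terms of an operator sum are active at every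
  point.\<close>

lemma atom:
  assumes "finite I" "\<And>i. i \<in> I \<Longrightarrow> C i \<in> bool_alg X" "x \<in> X"
  obtains B where "B \<in> bool_alg X" "x \<in> B" "\<And>i w. i \<in> I \<Longrightarrow> w \<in> B \<Longrightarrow> w \<in> C i \<longleftrightarrow> x \<in> C i"
proof -
  have "\<exists>B\<in>bool_alg X. x \<in> B \<and> (\<forall>i\<in>I. \<forall>w\<in>B. w \<in> C i \<longleftrightarrow> x \<in> C i)"
    using assms(1,2)
  proof (induction I rule: finite_induct)
    case empty
    then show ?case using bool_alg_space assms(3) by auto
  next
    case (insert i I)
    then obtain B where B: "B \<in> bool_alg X" "x \<in> B" "\<forall>i\<in>I. \<forall>w\<in>B. w \<in> C i \<longleftrightarrow> x \<in> C i" by auto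
    have Ci: "C i \<in> bool_alg X" using insert.prems by simp
    show ?case
    proof (cases "x \<in> C i")
      case True
      then show ?thesis
        using B(2,3) by (intro bexI[OF _ bool_alg.Int[OF B(1) Ci]]) blast
    next
      case False
      then show ?thesis
        using B(2,3) by (intro bexI[OF _ bool_alg_Diff[OF B(1) Ci]]) blast
    qed
  qed
  then show ?thesis using that by blast
qed

text \<open>A point fixed by replacing a prefix with one of another length is determined by the two
  words: the longer word gives its first letters, and every later letter repeats one at the distance
  of the length difference.\<close>

lemma fixed_point_unique:
  assumes x: "x = \<alpha> \<frown> z" "x = \<beta> \<frown> z" and y: "y = \<alpha> \<frown> z'" "y = \<beta> \<frown> z'"
    and len: "length \<alpha> \<noteq> length \<beta>"
  shows "x = y"
proof
  fix i
  show "x i = y i"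
  proof (induction i rule: less_induct)
    case (less i)
    have step: "x i = y i" if "length \<alpha>' < length \<beta>'" "x = \<alpha>' \<frown> z" "x = \<beta>' \<frown> z" "y = \<alpha>' \<frown> z'" "y = \<beta>' \<frown> z'"
      for \<alpha>' \<beta>'
    proof (cases "i < length \<beta>'")
      case True
      have "x i = (\<beta>' \<frown> z) i" "y i = (\<beta>' \<frown> z') i" using that(3,5) by simp_all
      then show ?thesis using True by simp
    next
      case False
      then have i: "i - length \<beta>' + length \<alpha>' < i" using that(1) by simp
      have "x i = z (i - length \<beta>')" "y i = z' (i - length \<beta>')"
        using that(3,5) False conc_snd by metis+
      moreover have "x (i - length \<beta>' + length \<alpha>') = z (i - length \<beta>')"
        "y (i - length \<beta>' + length \<alpha>') = z' (i - length \<beta>')"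
        using that(2,4) by (metis add_diff_cancel_right' conc_snd not_add_less2)+
      ultimately show ?thesis using less[OF i] by simp
    qed
    show ?case
      using len step[of \<alpha> \<beta>] step[of \<beta> \<alpha>] x y by (cases "length \<alpha> < length \<beta>") auto
  qed
qed

end

sublocale subshift_over \<subseteq> line: shift_graph_over line_points coefficients
  by unfold_locales (rule line_points_suffix)

section \<open>The socle of the algebra of operators\<close>

context subshift_over
begin

abbreviation \<A> :: "('a, 'r) seq_op set" where
  "\<A> \<equiv> lo.ev word_op ` \<F>"

lemma \<A>_mult: "f \<in> \<A> \<Longrightarrow> h \<in> \<A> \<Longrightarrow> f * h \<in> \<A>"
  by (auto intro: free_algebra_closed simp flip: \<rho>_mult)

lemmas \<A>_add = lo.subspace_add[OF image_subspace]
  and \<A>_diff = lo.subspace_diff[OF image_subspace]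
  and \<A>_scale = lo.subspace_scale[OF image_subspace]

lemma \<A>_term_op: "admissible B \<alpha> \<beta> \<Longrightarrow> term_op B \<alpha> \<beta> \<in> \<A>"
  by (rule image_eqI[of _ _ "p_gen B * s_word \<alpha> * s_star_word \<beta>"])
    (auto simp: admissible_def \<rho>_term intro!: free_algebra_closed(5) p_gen_carrier s_word_carrier)

lemma term_op_Nil: "term_op B [] [] = P B"
  unfolding term_op_def by (intro pcomp_cong) auto

lemma \<A>_P: "B \<in> bool_alg X \<Longrightarrow> P B \<in> \<A>"
  using \<A>_term_op[of B "[]" "[]"] bool_alg_subset[of B] by (simp add: admissible_def term_op_Nil)

lemma \<A>_cases:
  assumes "f \<in> \<A>"
  obtains I :: "'a subshift_gen free_monoid set" and c C \<alpha> \<beta> where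
    "finite I" "\<And>i. i \<in> I \<Longrightarrow> admissible (C i) (\<alpha> i) (\<beta> i)" "f = op_sum I c C \<alpha> \<beta>"
proof -
  obtain f' where "f' \<in> \<F>" "f = \<rho> f'" using assms by blast
  from normal_form[OF this(1)] this(2) that show ?thesis by (metis finite_keys)
qed

lemma \<A>_unit: "f \<in> \<A> \<Longrightarrow> P X * f = f"
proof -
  assume "f \<in> \<A>"
  then obtain f' where "f = \<rho> f'" by blast
  moreover have "P X = \<rho> 1" by (simp add: \<rho>_one)
  ultimately show ?thesis by (metis \<rho>_mult mult_1)
qed

text \<open>Isolation of the row point is enough, since a term over \<open>{x}\<close> acts at
  \<open>x\<close> alone.\<close>

lemma \<A>_unit_op:
  assumes "{x} \<in> bool_alg X" "y \<in> X" "lag_rel x k y"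
  shows "unit_op x k y \<in> \<A>"
proof -
  from assms(3) obtain m n where mn: "suffix m x = suffix n y" "k = int m - int n" by (auto simp: lag_rel_def)
  have x: "x \<in> X" using bool_alg_subset[OF assms(1)] by simp
  have y: "y = prefix n y \<frown> suffix m x" using prefix_suffix[of y n] mn(1) by simp
  have adm: "admissible {x} (prefix m x) (prefix n y)"
    unfolding admissible_def C_set_def using assms x y prefix_suffix[of x m]
    by (auto intro!: exI[of _ "suffix m x"])
  have "term_op {x} (prefix m x) (prefix n y) = (unit_op x k y :: (_, 'r) linop)"
    unfolding term_op_def unit_op_def using y mn by (intro pcomp_cong) auto
  then show ?thesis using \<A>_term_op[OF adm] by simp
qed

lemma units_deg_iff:
  "u \<in> line.units_deg k \<longleftrightarrow> (\<exists>x y. u = unit_op x k y \<and> x \<in> line_points \<and> y \<in> line_points \<and> lag_rel x k y)"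
  unfolding line.units_deg_def lag_rel_def by blast

lemma units_iff:
  "u \<in> line.units \<longleftrightarrow> (\<exists>x k y. u = unit_op x k y \<and> x \<in> line_points \<and> y \<in> line_points \<and> lag_rel x k y)"
  unfolding line.units_def using units_deg_iff by blast

lemma units_subset: "line.units \<subseteq> \<A>"
  unfolding subset_iff units_iff by (auto simp: line_points_def intro!: \<A>_unit_op)

lemma span_units_subset: "lo.span line.units \<subseteq> \<A>"
  by (rule lo.span_minimal[OF units_subset image_subspace])

text \<open>Prefix replacement is injective on \<open>B\<close>, so at most one point is sent to
  \<open>y\<close>, and the product is a single matrix unit or zero.\<close>

lemma term_op_unit_op:
  assumes adm: "admissible B \<alpha> \<beta>" and y: "y \<in> line_points"
  shows "(term_op B \<alpha> \<beta> * unit_op y k z :: (_, 'r) linop) = 0 \<or>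
    (\<exists>x\<in>line_points. \<exists>l. lag_rel x l y \<and> (term_op B \<alpha> \<beta> * unit_op y k z :: (_, 'r) linop) = unit_op x (l + k) z)"
proof (cases "\<exists>x\<in>B. \<beta> \<frown> suffix (length \<alpha>) x = y")
  case False
  then have "(term_op B \<alpha> \<beta> * unit_op y k z :: (_, 'r) linop) = 0"
    unfolding term_op_def by (intro linop_eqI) auto
  then show ?thesis ..
next
  case True
  then obtain x where x: "x \<in> B" "\<beta> \<frown> suffix (length \<alpha>) x = y" by blast
  have form: "w = \<alpha> \<frown> suffix (length \<alpha>) w \<and> w \<in> X" if "w \<in> B" for w
    using that adm by (auto simp: admissible_def C_set_def)
  have uniq: "w = x" if "w \<in> B" "\<beta> \<frown> suffix (length \<alpha>) w = y" for w
    using form[OF that(1)] form[OF x(1)] that(2) x(2) by (metis same_concat_eq)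
  have "(term_op B \<alpha> \<beta> * unit_op y k z :: (_, 'r) linop) = unit_op x (int (length \<alpha>) - int (length \<beta>) + k) z"
  proof (rule linop_eqI)
    fix h :: "_ \<Rightarrow> 'r" and q
    show "app (term_op B \<alpha> \<beta> * unit_op y k z) h q = app (unit_op x (int (length \<alpha>) - int (length \<beta>) + k) z) h q"
    proof (cases "fst q = x")
      case True
      then show ?thesis using x by (cases q) (simp add: term_op_def algebra_simps)
    next
      case False
      then have "\<not> (fst q \<in> B \<and> \<beta> \<frown> suffix (length \<alpha>) (fst q) = y)" using uniq by blast
      with False show ?thesis by (cases q) (auto simp: term_op_def)
    qed
  qed
  moreover have "x \<in> line_points"
    using line_points_conc[of \<beta> "suffix (length \<alpha>) x" \<alpha>] y x form[OF x(1)] by simp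
  moreover have "lag_rel x (int (length \<alpha>) - int (length \<beta>)) y"
    using lag_rel_conc[of \<alpha> "suffix (length \<alpha>) x" \<beta>] x form[OF x(1)] by simp
  ultimately show ?thesis by blast
qed

lemma unit_op_term_op:
  assumes adm: "admissible B \<alpha> \<beta>" and y: "y \<in> line_points"
  shows "(unit_op z k y * term_op B \<alpha> \<beta> :: (_, 'r) linop) = 0 \<or>
    (\<exists>x\<in>line_points. \<exists>l. lag_rel y l x \<and> (unit_op z k y * term_op B \<alpha> \<beta> :: (_, 'r) linop) = unit_op z (k + l) x)"
proof (cases "y \<in> B")
  case False
  then have "(unit_op z k y * term_op B \<alpha> \<beta> :: (_, 'r) linop) = 0"
    unfolding term_op_def by (intro linop_eqI) auto
  then show ?thesis ..
next
  case True
  let ?x = "\<beta> \<frown> suffix (length \<alpha>) y"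
  have form: "y = \<alpha> \<frown> suffix (length \<alpha>) y" "?x \<in> X"
    using True adm by (auto simp: admissible_def C_set_def)
  have "(unit_op z k y * term_op B \<alpha> \<beta> :: (_, 'r) linop) = unit_op z (k + (int (length \<alpha>) - int (length \<beta>))) ?x"
    unfolding term_op_def
    by (rule linop_eqI) (use True in \<open>auto simp: algebra_simps\<close>)
  moreover have "?x \<in> line_points"
    using line_points_conc[of \<alpha> "suffix (length \<alpha>) y" \<beta>] y form by simp
  moreover have "lag_rel y (int (length \<alpha>) - int (length \<beta>)) ?x"
    using lag_rel_conc[of \<alpha> "suffix (length \<alpha>) y" \<beta>] form by simp
  ultimately show ?thesis by blast
qed

text \<open>Its span is the left ideal generated by \<open>P {y}\<close>.\<close>

definition column :: "(nat \<Rightarrow> 'a) \<Rightarrow> ('a, 'r) seq_op set" where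
  "column y = {unit_op x k y |x k. x \<in> line_points \<and> lag_rel x k y}"

lemma mult_column:
  assumes f: "f \<in> \<A>" and y: "y \<in> line_points" and u: "u \<in> lo.span (column y)"
  shows "f * u \<in> lo.span (column y)"
  using u
proof (induction rule: lo.span_induct_alt)
  case (step c u v)
  obtain I :: "'a subshift_gen free_monoid set" and d C \<alpha> \<beta> where I: "finite I"
    "\<And>i. i \<in> I \<Longrightarrow> admissible (C i) (\<alpha> i) (\<beta> i)" "f = op_sum I d C \<alpha> \<beta>"
    by (rule \<A>_cases[OF f]) (rule that)
  from step(1) obtain x k where x: "x \<in> line_points" "lag_rel x k y" "u = unit_op x k y"
    by (auto simp: column_def)
  have "term_op (C i) (\<alpha> i) (\<beta> i) * u \<in> lo.span (column y)" if "i \<in> I" for i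
    using term_op_unit_op[OF I(2)[OF that] x(1), of k y]
  proof
    assume "\<exists>w\<in>line_points. \<exists>l. lag_rel w l x \<and> (term_op (C i) (\<alpha> i) (\<beta> i) * unit_op x k y :: (_, 'r) linop) = unit_op w (l + k) y"
    then obtain w l where w: "w \<in> line_points" "lag_rel w l x"
      and eq: "(term_op (C i) (\<alpha> i) (\<beta> i) * unit_op x k y :: (_, 'r) linop) = unit_op w (l + k) y"
      by blast
    from w(1) lag_rel_trans[OF w(2) x(2)] have "unit_op w (l + k) y \<in> column y"
      unfolding column_def by blast
    then show ?thesis unfolding x(3) eq by (rule lo.span_base)
  qed (simp add: x(3) lo.span_zero)
  then have "f * u \<in> lo.span (column y)"
    unfolding I(3) op_sum_def sum_distrib_right lo.scale_mult_left
    by (intro lo.span_sum lo.span_scale)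
  then show ?case
    using step(2) by (simp add: distrib_left lo.scale_mult_right lo.span_add lo.span_scale)
qed (simp add: lo.span_zero)

lemma column_subset: "y \<in> line_points \<Longrightarrow> column y \<subseteq> line.units"
  unfolding column_def subset_iff units_iff by blast

lemma mult_span_units:
  assumes f: "f \<in> \<A>" and u: "u \<in> lo.span line.units"
  shows "f * u \<in> lo.span line.units"
  using u
proof (induction rule: lo.span_induct_alt)
  case (step c u v)
  then obtain x k y where x: "x \<in> line_points" "y \<in> line_points" "lag_rel x k y" "u = unit_op x k y"
    by (auto simp: units_iff)
  then have "u \<in> lo.span (column y)" by (auto simp: column_def intro: lo.span_base)
  from mult_column[OF f x(2) this] have "f * u \<in> lo.span line.units"
    using lo.span_mono[OF column_subset[OF x(2)]] by blast
  then show ?case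
    using step(2) by (simp add: distrib_left lo.scale_mult_right lo.span_add lo.span_scale)
qed (simp add: lo.span_zero)

text \<open>Used to bring an element of a minimal left ideal into the span by multiplying it on the
  left.\<close>

lemma unit_mult_span_units:
  assumes f: "f \<in> \<A>" and x: "x \<in> line_points"
  shows "unit_op x 0 x * f \<in> lo.span line.units"
proof -
  obtain I :: "'a subshift_gen free_monoid set" and d C \<alpha> \<beta> where I: "finite I"
    "\<And>i. i \<in> I \<Longrightarrow> admissible (C i) (\<alpha> i) (\<beta> i)" "f = op_sum I d C \<alpha> \<beta>"
    by (rule \<A>_cases[OF f]) (rule that)
  have "unit_op x 0 x * term_op (C i) (\<alpha> i) (\<beta> i) \<in> lo.span line.units" if "i \<in> I" for i
    using unit_op_term_op[OF I(2)[OF that] x, of x 0]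
  proof
    assume "\<exists>w\<in>line_points. \<exists>l. lag_rel x l w \<and> (unit_op x 0 x * term_op (C i) (\<alpha> i) (\<beta> i) :: (_, 'r) linop) = unit_op x (0 + l) w"
    then obtain w l where w: "w \<in> line_points" "lag_rel x l w"
      and eq: "(unit_op x 0 x * term_op (C i) (\<alpha> i) (\<beta> i) :: (_, 'r) linop) = unit_op x (0 + l) w"
      by blast
    from w x have "unit_op x (0 + l) w \<in> line.units"
      unfolding units_iff by auto
    then show ?thesis unfolding eq by (rule lo.span_base)
  qed (simp add: lo.span_zero)
  then show ?thesis
    unfolding I(3) op_sum_def sum_distrib_left lo.scale_mult_right
    by (intro lo.span_sum lo.span_scale)
qed

lemma left_ideal_alg_iff:
  "left_ideal (alg oscale \<A>) J \<longleftrightarrow> J \<subseteq> \<A> \<and> lo.subspace J \<and> (\<forall>f\<in>\<A>. \<forall>h\<in>J. f * h \<in> J)"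
  by (auto simp: left_ideal_def lo.subspace_alg)

text \<open>The lag from \<open>x\<close> to a line point \<open>y\<close> is unique, so row
  \<open>x\<close> of this column is at most one-dimensional. \<open>SOME\<close> names that lag,
  and the coefficient 0 covers rows outside the class of \<open>y\<close>.\<close>

lemma column_entry:
  assumes y: "y \<in> line_points" and f: "f \<in> lo.span (column y)"
  shows "\<exists>c. unit_op x 0 x * f = oscale c (unit_op x (SOME k. lag_rel x k y) y) \<and>
    (c \<noteq> 0 \<longrightarrow> x \<in> line_points \<and> lag_rel x (SOME k. lag_rel x k y) y)"
  using f
proof (induction rule: lo.span_induct_alt)
  case base
  show ?case by (intro exI[of _ 0]) simp
next
  case (step c u v)
  let ?k = "SOME k. lag_rel x k y"
  from step(1) obtain x' l where x': "x' \<in> line_points" "lag_rel x' l y" "u = unit_op x' l y"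
    by (auto simp: column_def)
  from step(2) obtain d where d: "unit_op x 0 x * v = oscale d (unit_op x ?k y)"
    "d \<noteq> 0 \<longrightarrow> x \<in> line_points \<and> lag_rel x ?k y" by blast
  show ?case
  proof (cases "x = x'")
    case True
    then have k: "lag_rel x ?k y" using x'(2) by (intro someI) simp
    then have "?k = l" using lag_rel_unique[OF y] x'(2) True by simp
    then have "unit_op x 0 x * (oscale c u + v) = oscale (c + d) (unit_op x ?k y)"
      using d(1) x'(3) True
      by (simp add: distrib_left lo.scale_mult_right unit_op_mult lo.scale_left_distrib)
    then show ?thesis using k x'(1) True by blast
  next
    case False
    then have "unit_op x 0 x * (oscale c u + v) = oscale d (unit_op x ?k y)"
      using d(1) x'(3) by (simp add: distrib_left lo.scale_mult_right unit_op_mult)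
    then show ?thesis using d(2) by blast
  qed
qed

text \<open>Some row of a nonzero element is nonzero. Isolated by a diagonal unit and rescaled, it
  is one matrix unit, which further units carry to every other row.\<close>

lemma column_minimal:
  assumes y: "y \<in> line_points"
  shows "minimal_left_ideal (alg oscale \<A>) (lo.span (column y))"
proof -
  let ?J = "lo.span (column y)"
  have sub: "?J \<subseteq> \<A>"
    using lo.span_mono[OF column_subset[OF y]] span_units_subset by blast
  have ideal: "left_ideal (alg oscale \<A>) ?J"
    unfolding left_ideal_alg_iff using sub mult_column[OF _ y] by simp
  have "unit_op y 0 y \<in> ?J"
    using y lag_rel_refl by (intro lo.span_base) (auto simp: column_def)
  then have nz: "?J \<noteq> {0}" using unit_op_inject_nonzero[of y 0 y, where 'r = 'r] by (metis singletonD)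
  have "K = ?J" if K: "left_ideal (alg oscale \<A>) K" "K \<subseteq> ?J" "K \<noteq> {0}" for K
  proof -
    have K': "lo.subspace K" "\<And>f h. f \<in> \<A> \<Longrightarrow> h \<in> K \<Longrightarrow> f * h \<in> K"
      using K(1) by (auto simp: left_ideal_alg_iff)
    then have "0 \<in> K" by (simp add: lo.subspace_0)
    with K(3) obtain f where f: "f \<in> K" "f \<noteq> 0" by blast
    obtain h q where "app f h q \<noteq> 0" using f(2) linop_eqI[of f 0] by auto
    then obtain x j where "app f h (x, j) \<noteq> 0" by (cases q) auto
    then have "app (unit_op x 0 x * f) h (x, j) \<noteq> app 0 h (x, j)" by simp
    then have nz: "unit_op x 0 x * f \<noteq> 0" by metis
    define k where "k = (SOME k. lag_rel x k y)"
    obtain c where c: "unit_op x 0 x * f = oscale c (unit_op x k y)" "c \<noteq> 0 \<longrightarrow> x \<in> line_points \<and> lag_rel x k y"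
      using column_entry[OF y subsetD[OF K(2) f(1)], of x] unfolding k_def by (elim exE conjE)
    with nz have c0: "c \<noteq> 0" and x: "x \<in> line_points" "lag_rel x k y" by auto
    have "unit_op x 0 x \<in> \<A>" using x by (intro \<A>_unit_op lag_rel_refl) (auto simp: line_points_def)
    from K'(2)[OF this f(1)] have "oscale (inverse c) (oscale c (unit_op x k y)) \<in> K"
      unfolding c(1) by (rule lo.subspace_scale[OF K'(1)])
    then have xK: "unit_op x k y \<in> K" using c0 by simp
    have "column y \<subseteq> K"
    proof
      fix u assume "u \<in> column y"
      then obtain w l where w: "w \<in> line_points" "lag_rel w l y" "u = unit_op w l y" by (auto simp: column_def)
      have "lag_rel w (l + - k) x" using lag_rel_trans[OF w(2) lag_rel_sym[OF x(2)]] .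
      then have "unit_op w (l + - k) x \<in> \<A>" using w(1) x(1) by (intro \<A>_unit_op) (auto simp: line_points_def)
      from K'(2)[OF this xK] show "u \<in> K" by (simp add: unit_op_mult w(3))
    qed
    then show ?thesis using K(2) K'(1) lo.span_minimal by blast
  qed
  then show ?thesis
    using ideal nz by (auto simp: minimal_left_ideal_def)
qed

lemma span_units_socle: "lo.span line.units \<subseteq> socle (alg oscale \<A>)"
proof -
  have "line.units \<subseteq> \<Union>{J. minimal_left_ideal (alg oscale \<A>) J}"
  proof
    fix u assume "u \<in> line.units"
    then obtain x k y where "x \<in> line_points" "y \<in> line_points" "lag_rel x k y" "u = unit_op x k y"
      by (auto simp: units_iff)
    then have "u \<in> lo.span (column y)" "y \<in> line_points"
      by (auto simp: column_def intro: lo.span_base)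
    then show "u \<in> \<Union>{J. minimal_left_ideal (alg oscale \<A>) J}" using column_minimal by blast
  qed
  moreover have "\<Union>{J. minimal_left_ideal (alg oscale \<A>) J} \<subseteq> \<A>"
    by (auto simp: minimal_left_ideal_def left_ideal_alg_iff)
  then have "socle (alg oscale \<A>) = lo.span (\<Union>{J. minimal_left_ideal (alg oscale \<A>) J})"
    unfolding socle_def by (rule lo.lin_span_alg[OF image_subspace])
  ultimately show ?thesis using lo.span_mono by metis
qed

end

section \<open>Corners and elements of minimal left ideals\<close>

context subshift_over
begin

abbreviation delta :: "(nat \<Rightarrow> 'a) \<Rightarrow> int \<Rightarrow> (nat \<Rightarrow> 'a) \<times> int \<Rightarrow> 'r" where
  "delta y j \<equiv> (\<lambda>q. if q = (y, j) then 1 else 0)"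

lemma P_singleton: "P {x} = unit_op x 0 x"
  by (rule linop_eqI) (auto split: if_splits)

lemma app_op_sum:
  "app (op_sum I c C \<alpha> \<beta>) h (x, j) = (\<Sum>i\<in>I. if x \<in> C i then
     c i * h (\<beta> i \<frown> suffix (length (\<alpha> i)) x, j - int (length (\<alpha> i)) + int (length (\<beta> i))) else 0)"
  unfolding op_sum_def app_sum by (intro sum.cong refl) (simp add: term_op_def)

lemma admissibleD:
  assumes "admissible B \<alpha> \<beta>" "x \<in> B"
  shows "x = \<alpha> \<frown> suffix (length \<alpha>) x" "x \<in> X" "\<beta> \<frown> suffix (length \<alpha>) x \<in> X"
  using assms by (auto simp: admissible_def C_set_def)

lemma same_length_fixed:
  assumes "admissible B \<alpha> \<beta>" "x \<in> B" "length \<alpha> = length \<beta>"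
  shows "\<beta> \<frown> suffix (length \<alpha>) x = x \<longleftrightarrow> \<alpha> = \<beta>"
  using admissibleD(1)[OF assms(1,2)] concat_eq[OF assms(3)] by metis

text \<open>A term that returns to \<open>(x, 0)\<close> has words of equal length, and both are
  then the same prefix of \<open>x\<close>.\<close>

lemma diagonal_coefficient:
  assumes "\<And>i. i \<in> I \<Longrightarrow> admissible (C i) (\<alpha> i) (\<beta> i)"
  shows "app (op_sum I c C \<alpha> \<beta>) (delta x 0) (x, 0) = (\<Sum>i\<in>I. if x \<in> C i \<and> \<alpha> i = \<beta> i then c i else 0)"
  unfolding app_op_sum
proof (intro sum.cong refl)
  fix i assume i: "i \<in> I"
  show "(if x \<in> C i then c i * delta x 0 (\<beta> i \<frown> suffix (length (\<alpha> i)) x, 0 - int (length (\<alpha> i)) + int (length (\<beta> i))) else 0)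
      = (if x \<in> C i \<and> \<alpha> i = \<beta> i then c i else 0)"
  proof (cases "x \<in> C i")
    case True
    show ?thesis
      using same_length_fixed[OF assms[OF i] True] True by (cases "length (\<alpha> i) = length (\<beta> i)") auto
  qed simp
qed

text \<open>Some target of a point \<open>x\<close> has nonzero total coefficient; composing with
  the inverse prefix replacement brings that target back to \<open>x\<close> itself.\<close>

lemma nonzero_coefficient:
  assumes f: "f \<in> \<A>" "f \<noteq> 0"
  obtains x e where "x \<in> X" "e \<in> \<A>" "app (f * e) (delta x 0) (x, 0) \<noteq> 0"
proof -
  obtain I :: "'a subshift_gen free_monoid set" and c C \<alpha> \<beta> where I: "finite I"
    "\<And>i. i \<in> I \<Longrightarrow> admissible (C i) (\<alpha> i) (\<beta> i)" "f = op_sum I c C \<alpha> \<beta>"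
    by (rule \<A>_cases[OF f(1)]) (rule that)
  obtain h q where "app f h q \<noteq> 0" using f(2) linop_eqI[of f 0] by auto
  then obtain x j where nz: "app f h (x, j) \<noteq> 0" by (cases q) auto
  define I' where "I' = {i \<in> I. x \<in> C i}"
  define key where "key i = (\<beta> i \<frown> suffix (length (\<alpha> i)) x, int (length (\<alpha> i)) - int (length (\<beta> i)))" for i
  \<comment> \<open>If all totals vanished, \<open>f\<close> would be zero at \<open>x\<close> for
    every argument function.\<close>
  have "\<exists>\<kappa>. (\<Sum>i | i \<in> I' \<and> key i = \<kappa>. c i) \<noteq> 0"
  proof (rule ccontr)
    assume no: "\<nexists>\<kappa>. (\<Sum>i | i \<in> I' \<and> key i = \<kappa>. c i) \<noteq> 0"
    have fin: "finite I'" using I(1) by (simp add: I'_def)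
    have "(\<Sum>i\<in>I'. oscale (c i) (unit_op x (snd (key i)) (fst (key i)))) = 0"
      by (rule lo.sum_group_eq_0[where key = key and c = c and w = "\<lambda>\<kappa>. unit_op x (snd \<kappa>) (fst \<kappa>)", OF fin])
        (use no in blast)
    then have "0 = app (\<Sum>i\<in>I'. oscale (c i) (unit_op x (snd (key i)) (fst (key i)))) h (x, j)" by simp
    also have "\<dots> = (\<Sum>i\<in>I'. c i * h (\<beta> i \<frown> suffix (length (\<alpha> i)) x, j - int (length (\<alpha> i)) + int (length (\<beta> i))))"
      unfolding app_sum by (intro sum.cong refl) (simp add: key_def algebra_simps)
    also have "\<dots> = app f h (x, j)"
      unfolding I(3) app_op_sum I'_def using I(1) by (simp add: sum.inter_filter)
    finally show False using nz by simp
  qed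
  then obtain \<kappa> where \<kappa>: "(\<Sum>i | i \<in> I' \<and> key i = \<kappa>. c i) \<noteq> 0" by blast
  then have "{i. i \<in> I' \<and> key i = \<kappa>} \<noteq> {}" by (metis sum.empty)
  then obtain i where i: "i \<in> I" "x \<in> C i" "key i = \<kappa>" by (auto simp: I'_def)
  define a b where "a = \<alpha> i" and "b = \<beta> i"
  define z where "z = suffix (length a) x"
  have x: "x = a \<frown> z" "x \<in> X" and y: "b \<frown> z \<in> X"
    using admissibleD[OF I(2)[OF i(1)] i(2)] by (auto simp: a_def b_def z_def)
  have key: "\<kappa> = (b \<frown> z, int (length a) - int (length b))"
    using i(3) by (simp add: key_def a_def b_def z_def)
  \<comment> \<open>The reverse of the chosen term, replacing the prefix \<open>b\<close> by
    \<open>a\<close>; it pulls the indicator at \<open>x\<close> back to the indicator at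
    \<open>b \<frown> z\<close>.\<close>
  define e where "e = (term_op (C_set X a b) b a :: (_, 'r) linop)"
  have e: "e \<in> \<A>" unfolding e_def by (intro \<A>_term_op) (simp add: admissible_def bool_alg_C_set)
  have "app e (delta x 0) = delta (b \<frown> z) (int (length b) - int (length a))"
  proof
    fix q :: "(nat \<Rightarrow> 'a) \<times> int"
    obtain w l where q: "q = (w, l)" by (cases q)
    show "app e (delta x 0) q = delta (b \<frown> z) (int (length b) - int (length a)) q"
    proof (cases "w = b \<frown> z")
      case True
      have "w \<in> C_set X a b" unfolding C_set_def True using x y by auto
      then show ?thesis using True x by (auto simp: q e_def term_op_def)
    next
      case False
      have "\<not> (w \<in> C_set X a b \<and> a \<frown> suffix (length b) w = x)"
      proof
        assume "w \<in> C_set X a b \<and> a \<frown> suffix (length b) w = x"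
        then obtain z' where "w = b \<frown> z'" "a \<frown> suffix (length b) w = a \<frown> z" using x by (auto simp: C_set_def)
        then show False using False by simp
      qed
      then show ?thesis using False by (auto simp: q e_def term_op_def)
    qed
  qed
  then have "app (f * e) (delta x 0) (x, 0) = app f (delta (b \<frown> z) (int (length b) - int (length a))) (x, 0)"
    by simp
  also have "\<dots> = (\<Sum>i\<in>I. if x \<in> C i \<and> key i = \<kappa> then c i else 0)"
    unfolding I(3) app_op_sum by (intro sum.cong refl) (auto simp: key_def key)
  also have "\<dots> = (\<Sum>i | i \<in> I' \<and> key i = \<kappa>. c i)"
    using I(1) by (simp add: I'_def sum.inter_filter conj_assoc)
  finally show ?thesis using that[OF x(2) e] \<kappa> by simp
qed

text \<open>Every active off-diagonal term moves \<open>y\<close>, and by continuity it moves a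
  whole neighbourhood \<open>W\<close> of \<open>y\<close> off itself. Compression to
  \<open>W\<close> removes these terms, and the diagonal ones act as scalars there.\<close>

lemma corner_at_point:
  assumes I: "finite I" "\<And>i. i \<in> I \<Longrightarrow> admissible (C i) (\<alpha> i) (\<beta> i)" and y: "y \<in> X"
    and good: "\<And>i. i \<in> I \<Longrightarrow> y \<in> C i \<Longrightarrow> \<alpha> i \<noteq> \<beta> i \<Longrightarrow> \<beta> i \<frown> suffix (length (\<alpha> i)) y \<noteq> y"
  obtains W where "W \<in> bool_alg X" "y \<in> W"
    "P W * op_sum I c C \<alpha> \<beta> * P W = oscale (\<Sum>i\<in>I. if y \<in> C i \<and> \<alpha> i = \<beta> i then c i else 0) (P W)"
proof -
  have "\<exists>l. (\<beta> i \<frown> suffix (length (\<alpha> i)) y) l \<noteq> y l" if "i \<in> I" "y \<in> C i" "\<alpha> i \<noteq> \<beta> i" for i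
    using good[OF that] by auto
  then obtain \<delta> where \<delta>: "\<And>i. i \<in> I \<Longrightarrow> y \<in> C i \<Longrightarrow> \<alpha> i \<noteq> \<beta> i \<Longrightarrow>
      (\<beta> i \<frown> suffix (length (\<alpha> i)) y) (\<delta> i) \<noteq> y (\<delta> i)" by metis
  \<comment> \<open>\<open>N\<close> must reach the position where the moved point differs from
    \<open>y\<close>. That letter may be read further right in \<open>w\<close>, by up to the length
    of the removed prefix.\<close>
  define N where "N = Suc (\<Sum>i\<in>I. \<delta> i + length (\<alpha> i))"
  have N: "\<delta> i + length (\<alpha> i) < N" if "i \<in> I" for i
    unfolding N_def less_Suc_eq_le by (rule member_le_sum) (use that I in auto)
  have CU: "C i \<in> bool_alg X" if "i \<in> I" for i
    using I(2)[OF that] by (simp add: admissible_def)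
  obtain B where B: "B \<in> bool_alg X" "y \<in> B" "\<And>i w. i \<in> I \<Longrightarrow> w \<in> B \<Longrightarrow> w \<in> C i \<longleftrightarrow> y \<in> C i"
    by (rule atom[OF I(1) CU y]) (assumption, rule that)
  define W where "W = B \<inter> C_set X [] (prefix N y)"
  have W: "W \<in> bool_alg X" "y \<in> W"
    using B(1,2) y bool_alg.Int[OF B(1) bool_alg_C_set] cylinder_iff[where w = y and y = y and N = N] by (auto simp: W_def)
  have Wy: "w l = y l" if "w \<in> W" "l < N" for w l
    using that unfolding W_def Int_iff cylinder_iff by blast
  have moved: "\<beta> i \<frown> suffix (length (\<alpha> i)) w \<notin> W" if i: "i \<in> I" "y \<in> C i" "\<alpha> i \<noteq> \<beta> i" and w: "w \<in> W" for i w
  proof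
    assume in_W: "\<beta> i \<frown> suffix (length (\<alpha> i)) w \<in> W"
    have "(\<beta> i \<frown> suffix (length (\<alpha> i)) w) (\<delta> i) = (\<beta> i \<frown> suffix (length (\<alpha> i)) y) (\<delta> i)"
      using Wy[OF w, of "length (\<alpha> i) + (\<delta> i - length (\<beta> i))"] N[OF i(1)]
      by (cases "\<delta> i < length (\<beta> i)") (simp_all add: suffix_nth)
    moreover have "(\<beta> i \<frown> suffix (length (\<alpha> i)) w) (\<delta> i) = y (\<delta> i)"
      using Wy[OF in_W] N[OF i(1)] by simp
    ultimately show False using \<delta>[OF i] by simp
  qed
  have "P W * op_sum I c C \<alpha> \<beta> * P W = oscale (\<Sum>i\<in>I. if y \<in> C i \<and> \<alpha> i = \<beta> i then c i else 0) (P W)"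
  proof (rule linop_eqI)
    fix h :: "(nat \<Rightarrow> 'a) \<times> int \<Rightarrow> 'r" and q :: "(nat \<Rightarrow> 'a) \<times> int"
    obtain w j where q: "q = (w, j)" by (cases q)
    show "app (P W * op_sum I c C \<alpha> \<beta> * P W) h q =
        app (oscale (\<Sum>i\<in>I. if y \<in> C i \<and> \<alpha> i = \<beta> i then c i else 0) (P W)) h q"
    proof (cases "w \<in> W")
      case True
      then have "w \<in> B" by (simp add: W_def)
      have "app (P W * op_sum I c C \<alpha> \<beta> * P W) h q = app (op_sum I c C \<alpha> \<beta>) (app (P W) h) (w, j)"
        using True by (simp add: q)
      also have "\<dots> = (\<Sum>i\<in>I. if y \<in> C i \<and> \<alpha> i = \<beta> i then c i * h (w, j) else 0)"
        unfolding app_op_sum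
      proof (intro sum.cong refl)
        fix i assume i: "i \<in> I"
        show "(if w \<in> C i then c i * app (P W) h (\<beta> i \<frown> suffix (length (\<alpha> i)) w,
              j - int (length (\<alpha> i)) + int (length (\<beta> i))) else 0) =
            (if y \<in> C i \<and> \<alpha> i = \<beta> i then c i * h (w, j) else 0)"
        proof (cases "y \<in> C i")
          case yC: True
          then have wC: "w \<in> C i" using B(3)[OF i \<open>w \<in> B\<close>] by simp
          show ?thesis
          proof (cases "\<alpha> i = \<beta> i")
            case True
            have "\<alpha> i \<frown> suffix (length (\<alpha> i)) w = w"
              using admissibleD(1)[OF I(2)[OF i] wC] by simp
            then show ?thesis using True yC wC \<open>w \<in> W\<close> by simp
          next
            case False
            then show ?thesis using moved[OF i yC False True] by simp
          qed
        next
          case False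
          then show ?thesis using B(3)[OF i \<open>w \<in> B\<close>] by simp
        qed
      qed
      also have "\<dots> = (\<Sum>i\<in>I. if y \<in> C i \<and> \<alpha> i = \<beta> i then c i else 0) * h (w, j)"
        unfolding sum_distrib_right by (intro sum.cong refl) simp
      finally show ?thesis using True by (simp add: q)
    qed (simp add: q)
  qed
  then show ?thesis using that W by blast
qed

text \<open>Sought is a point fixed by no active term with words of unequal length. An isolated
  aperiodic \<open>x\<close> is one itself. Around a non-isolated \<open>x\<close> an atom is
  infinite while each such term fixes at most one point, and the diagonal coefficient is constant on
  the atom.\<close>

lemma reduction:
  assumes f: "f \<in> \<A>" and x: "x \<in> X" and nz: "app f (delta x 0) (x, 0) \<noteq> 0"
    and not_periodic: "{x} \<notin> bool_alg X \<or> (\<forall>m n. suffix m x = suffix n x \<longrightarrow> m = n)"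
  obtains W y c where "W \<in> bool_alg X" "y \<in> W" "c \<noteq> 0" "P W * f * P W = oscale c (P W)"
proof -
  obtain I :: "'a subshift_gen free_monoid set" and c C \<alpha> \<beta> where I: "finite I"
    "\<And>i. i \<in> I \<Longrightarrow> admissible (C i) (\<alpha> i) (\<beta> i)" "f = op_sum I c C \<alpha> \<beta>"
    by (rule \<A>_cases[OF f]) (rule that)
  define D where "D y = (\<Sum>i\<in>I. if y \<in> C i \<and> \<alpha> i = \<beta> i then c i else 0)" for y
  have Dx: "D x \<noteq> 0" using nz unfolding D_def I(3)
    by (simp only: diagonal_coefficient[where I = I and C = C and \<alpha> = \<alpha> and \<beta> = \<beta>, OF I(2)] not_False_eq_True)
  have "\<exists>y\<in>X. D y = D x \<and> (\<forall>i\<in>I. y \<in> C i \<longrightarrow> length (\<alpha> i) \<noteq> length (\<beta> i) \<longrightarrow> \<beta> i \<frown> suffix (length (\<alpha> i)) y \<noteq> y)"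
  proof (cases "{x} \<in> bool_alg X")
    case True
    have "\<beta> i \<frown> suffix (length (\<alpha> i)) x \<noteq> x" if "length (\<alpha> i) \<noteq> length (\<beta> i)" for i
    proof
      assume "\<beta> i \<frown> suffix (length (\<alpha> i)) x = x"
      then have "suffix (length (\<beta> i)) x = suffix (length (\<alpha> i)) x" by (metis suffix_conc_length)
      then show False using not_periodic True that by metis
    qed
    then show ?thesis using x by blast
  next
    case False
    have CU: "C i \<in> bool_alg X" if "i \<in> I" for i
      using I(2)[OF that] by (simp add: admissible_def)
    obtain B where B: "B \<in> bool_alg X" "x \<in> B" "\<And>i w. i \<in> I \<Longrightarrow> w \<in> B \<Longrightarrow> w \<in> C i \<longleftrightarrow> x \<in> C i"
      by (rule atom[OF I(1) CU x]) (assumption, rule that)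
    have inf: "infinite B" using singleton_of_finite[OF B(1) _ B(2)] False by blast
    let ?bad = "\<lambda>i. {y \<in> C i. length (\<alpha> i) \<noteq> length (\<beta> i) \<and> \<beta> i \<frown> suffix (length (\<alpha> i)) y = y}"
    have "y = y'" if "i \<in> I" "y \<in> ?bad i" "y' \<in> ?bad i" for i y y'
      by (rule fixed_point_unique[of y "\<alpha> i" "suffix (length (\<alpha> i)) y" "\<beta> i" y' "suffix (length (\<alpha> i)) y'"])
        (use that admissibleD(1)[OF I(2)[OF that(1)]] in simp_all)
    then have "finite (?bad i)" if "i \<in> I" for i
      using that by (metis (no_types, lifting) finite.simps finite_subset insertCI subsetI)
    then have "finite (\<Union>i\<in>I. ?bad i)" using I(1) by blast
    then obtain y where y: "y \<in> B" "y \<notin> (\<Union>i\<in>I. ?bad i)"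
      using inf by (meson finite_subset subsetI)
    have "D y = D x" unfolding D_def using B(3)[OF _ y(1)] by (intro sum.cong refl) simp
    then show ?thesis using y bool_alg_subset[OF B(1)] by blast
  qed
  then obtain y where y: "y \<in> X" "D y = D x"
    and good: "\<And>i. i \<in> I \<Longrightarrow> y \<in> C i \<Longrightarrow> length (\<alpha> i) \<noteq> length (\<beta> i) \<Longrightarrow> \<beta> i \<frown> suffix (length (\<alpha> i)) y \<noteq> y"
    by blast
  have moved: "\<beta> i \<frown> suffix (length (\<alpha> i)) y \<noteq> y" if "i \<in> I" "y \<in> C i" "\<alpha> i \<noteq> \<beta> i" for i
    using good[OF that(1,2)] same_length_fixed[OF I(2)[OF that(1)] that(2)] that(3) by blast
  obtain W where W: "W \<in> bool_alg X" "y \<in> W"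
    "P W * op_sum I c C \<alpha> \<beta> * P W = oscale (\<Sum>i\<in>I. if y \<in> C i \<and> \<alpha> i = \<beta> i then c i else 0) (P W)"
    by (rule corner_at_point[where I = I and C = C and \<alpha> = \<alpha> and \<beta> = \<beta> and c = c, OF I(1,2) y(1) moved]) blast+
  then have "P W * f * P W = oscale (D y) (P W)" by (simp only: I(3) D_def)
  then show ?thesis using that W(1,2) Dx y(2) by metis
qed

text \<open>
  At an isolated eventually periodic point the corner is a ring of Laurent polynomials, which
  has no zero divisors, and in which \<open>1 - t\<close> is not invertible, being killed by \<open>t \<mapsto> 1\<close>.
\<close>

lemma periodic_corner:
  assumes x: "{x} \<in> bool_alg X" "suffix m x = suffix n x" "m \<noteq> n"
    and d: "d \<in> \<A>" "d \<noteq> 0" "P {x} * d * P {x} = d"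
  obtains e where "e \<in> \<A>" "e * d \<noteq> 0" "\<And>b. b \<in> \<A> \<Longrightarrow> b * (e * d) \<noteq> d"
proof -
  \<comment> \<open>\<open>int \<Rightarrow>\<^sub>0 'r\<close> serves as the Laurent polynomial
    ring. The image of \<open>L\<close> may exceed the corner, in which only lags from
    \<open>x\<close> to itself occur; it is enough that it contains the corner.\<close>
  define L :: "(int \<Rightarrow>\<^sub>0 'r) \<Rightarrow> ('a, 'r) seq_op" where "L = lo.ev (\<lambda>k. unit_op x k x)"
  have L_mult: "L (g * h) = L g * L h" for g h
    unfolding L_def by (rule lo.ev_mult) (simp add: unit_op_mult)
  have L_single: "L (single k c) = oscale c (unit_op x k x)" for k c by (simp add: L_def)
  have L_1: "L 1 = P {x}" using L_single[of 0 1] by (simp add: P_singleton)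
  have coeff: "app (L g) (delta x (- k)) (x, 0) = lookup g k" for g k
  proof -
    have "app (L g) (delta x (- k)) (x, 0) = (\<Sum>l\<in>keys g. if l = k then lookup g l else 0)"
      unfolding L_def lo.ev_def app_sum by (intro sum.cong refl) auto
    then show ?thesis by (simp add: in_keys_iff)
  qed
  have L_eq: "g = h" if "L g = L h" for g h
    using coeff[of g] coeff[of h] that by (intro poly_mapping_eqI) metis
  have corner: "\<exists>g. P {x} * f * P {x} = L g" if f: "f \<in> \<A>" for f
  proof -
    obtain I :: "'a subshift_gen free_monoid set" and c C \<alpha> \<beta> where I: "finite I"
      "\<And>i. i \<in> I \<Longrightarrow> admissible (C i) (\<alpha> i) (\<beta> i)" "f = op_sum I c C \<alpha> \<beta>"
      by (rule \<A>_cases[OF f]) (rule that)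
    define g where "g i = (if x \<in> C i \<and> \<beta> i \<frown> suffix (length (\<alpha> i)) x = x
      then single (int (length (\<alpha> i)) - int (length (\<beta> i))) (1 :: 'r) else 0)" for i
    have "P {x} * term_op (C i) (\<alpha> i) (\<beta> i) * P {x} = L (g i)" for i
    proof (rule linop_eqI)
      fix h :: "(nat \<Rightarrow> 'a) \<times> int \<Rightarrow> 'r" and q :: "(nat \<Rightarrow> 'a) \<times> int"
      obtain w j where q: "q = (w, j)" by (cases q)
      have Lg: "L (g i) = (if x \<in> C i \<and> \<beta> i \<frown> suffix (length (\<alpha> i)) x = x
          then unit_op x (int (length (\<alpha> i)) - int (length (\<beta> i))) x else 0)"
        by (simp add: g_def L_def)
      show "app (P {x} * term_op (C i) (\<alpha> i) (\<beta> i) * P {x}) h q = app (L (g i)) h q"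
      proof (cases "w = x")
        case True
        then show ?thesis by (simp add: q Lg term_op_def algebra_simps)
      qed (simp add: q Lg)
    qed
    then have "P {x} * f * P {x} = L (\<Sum>i\<in>I. pscale (c i) (g i))"
      unfolding I(3) op_sum_def L_def
      by (simp add: sum_distrib_left sum_distrib_right lo.scale_mult_right lo.scale_mult_left lo.ev_sum lo.ev_pscale)
    then show ?thesis ..
  qed
  \<comment> \<open>\<open>k\<close> is a nonzero lag from \<open>x\<close> to itself, so
    \<open>1 - t^k\<close> evaluates to an element of the algebra and has constant coefficient
    1.\<close>
  define k where "k = int m - int n"
  define F where "F = 1 - single k (1 :: 'r)"
  define e where "e = L F"
  have e_eq: "e = P {x} - unit_op x k x"
    using L_single[of k 1] L_1 by (simp add: e_def F_def L_def lo.ev_diff)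
  have e: "e \<in> \<A>"
    unfolding e_eq
    using x bool_alg_subset[OF x(1)] by (intro \<A>_diff \<A>_P \<A>_unit_op) (auto simp: lag_rel_def k_def)
  have "lookup F 0 = 1"
    using x(3) by (simp add: F_def k_def lookup_minus lookup_one lookup_single when_def)
  then have "F \<noteq> 0" by auto
  obtain D where D: "d = L D" using corner[OF d(1)] d(3) by auto
  then have "D \<noteq> 0" using d(2) by (auto simp: L_def)
  \<comment> \<open>Laurent polynomials over a field have no zero divisors.\<close>
  then have "F * D \<noteq> 0" using \<open>F \<noteq> 0\<close> by simp
  moreover have "e * d = L (F * D)" by (simp only: L_mult e_def D)
  moreover have "L 0 = 0" by (simp add: L_def)
  ultimately have ed: "e * d \<noteq> 0" using L_eq[of "F * D" 0] by metis
  have "b * (e * d) \<noteq> d" if b: "b \<in> \<A>" for b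
  proof
    assume eq: "b * (e * d) = d"
    obtain g where g: "P {x} * b * P {x} = L g" using corner[OF b] by blast
    have Pe: "P {x} * e = e" using L_mult[of 1 F] by (simp add: L_1 e_def)
    have Pd: "P {x} * d = d" using L_mult[of 1 D] by (simp add: L_1 D)
    \<comment> \<open>Both \<open>e\<close> and \<open>d\<close> are fixed by \<open>P {x}\<close>
      on the left, so \<open>b\<close> may be replaced by its compression to the corner.\<close>
    have "L (g * F * D) = P {x} * b * (P {x} * e) * d" by (simp add: L_mult D e_def mult.assoc flip: g)
    also have "\<dots> = P {x} * (b * (e * d))" by (simp only: Pe mult.assoc)
    also have "\<dots> = L D" unfolding eq Pd by (rule D)
    finally have "g * F * D = D" by (rule L_eq)
    then have "(g * F - 1) * D = 0" by (simp add: algebra_simps)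
    then have "g * F = 1" using \<open>D \<noteq> 0\<close> by simp
    then have "P {x} = L g * e" using L_mult[of g F] by (simp add: L_1 e_def)
    \<comment> \<open>The constant function realises \<open>t \<mapsto> 1\<close>: both terms of
      \<open>e\<close> give the same value on it, while \<open>P {x}\<close> does not kill
      it.\<close>
    moreover have "app e (\<lambda>_. 1) = (\<lambda>_. 0)" by (auto simp: e_eq fun_eq_iff)
    ultimately have "app (P {x}) (\<lambda>_. 1) (x, 0) = 0" by simp
    then show False by simp
  qed
  with e ed show ?thesis using that by blast
qed

text \<open>Right factors lead out of \<open>J\<close>, so they are applied to equations only: by
  minimality each nonzero element of \<open>J\<close> yields every other by left multiplication, and
  such an equation may be multiplied on the right by anything.\<close>

lemma minimal_subset_span_units:
  assumes J: "minimal_left_ideal (alg oscale \<A>) J"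
  shows "J \<subseteq> lo.span line.units"
proof -
  have ideal: "J \<subseteq> \<A>" "lo.subspace J" "\<And>f h. f \<in> \<A> \<Longrightarrow> h \<in> J \<Longrightarrow> f * h \<in> J" and J0: "J \<noteq> {0}"
    and min: "\<And>K. left_ideal (alg oscale \<A>) K \<Longrightarrow> K \<subseteq> J \<Longrightarrow> K = {0} \<or> K = J"
    using J by (auto simp: minimal_left_ideal_def left_ideal_alg_iff)
  have gen: "\<exists>b\<in>\<A>. r = b * e" if e: "e \<in> J" "e \<noteq> 0" and r: "r \<in> J" for e r
  proof -
    let ?K = "(\<lambda>b. b * e) ` \<A>"
    have "lo.subspace ?K"
    proof (rule lo.subspaceI)
      show "0 \<in> ?K" using lo.subspace_0[OF image_subspace] by (rule image_eqI[rotated]) simp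
      show "u + v \<in> ?K" if "u \<in> ?K" "v \<in> ?K" for u v
        using that \<A>_add by (auto simp flip: distrib_right)
      show "oscale c u \<in> ?K" if "u \<in> ?K" for c u
        using that \<A>_scale by (auto simp flip: lo.scale_mult_left)
    qed
    moreover have "f * u \<in> ?K" if "f \<in> \<A>" "u \<in> ?K" for f u
      using that \<A>_mult by (auto simp flip: mult.assoc)
    moreover have "?K \<subseteq> J" using ideal(3) e(1) by blast
    ultimately have "?K = {0} \<or> ?K = J"
      using ideal(1) by (intro min) (auto simp: left_ideal_alg_iff)
    moreover have "e \<in> ?K"
      using \<A>_unit[of e] ideal(1) e(1) \<A>_P[OF bool_alg_space] by (intro image_eqI[of _ _ "P X"]) auto
    ultimately show ?thesis using e(2) r by blast
  qed
  have main: "J \<subseteq> lo.span line.units" if e: "e \<in> J" "e \<noteq> 0" "e \<in> lo.span line.units" for e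
    using gen[OF e(1,2)] mult_span_units[OF _ e(3)] by blast
  have "0 \<in> J" using ideal(2) by (rule lo.subspace_0)
  with J0 obtain f where f: "f \<in> J" "f \<noteq> 0" by blast
  then have fA: "f \<in> \<A>" using ideal(1) by blast
  obtain x e where x: "x \<in> X" and e: "e \<in> \<A>" and nz: "app (f * e) (delta x 0) (x, 0) \<noteq> 0"
    by (rule nonzero_coefficient[OF fA f(2)])
  have fe: "f * e \<in> \<A>" by (intro \<A>_mult fA e)
  have periodic: False
    if z: "{z} \<in> bool_alg X" "suffix m z = suffix n z" "m \<noteq> n" and b: "b \<in> \<A>" and c: "c \<in> \<A>"
      and bc: "b * f * c \<noteq> 0" "P {z} * (b * f * c) * P {z} = b * f * c" for z m n b c
  proof -
    have "b * f * c \<in> \<A>" by (intro \<A>_mult b c fA)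
    from periodic_corner[OF z this bc] obtain u where u: "u \<in> \<A>" "u * (b * f * c) \<noteq> 0"
      "\<And>v. v \<in> \<A> \<Longrightarrow> v * (u * (b * f * c)) \<noteq> b * f * c" by blast
    \<comment> \<open>The right factor \<open>c\<close> is left off to stay in \<open>J\<close>. It
      is restored in the equation \<open>b * f = v * (u * (b * f))\<close>, which then contradicts
      the choice of \<open>u\<close>.\<close>
    have "u * (b * f) \<in> J" "b * f \<in> J" by (intro ideal(3) u b f)+
    moreover have "u * (b * f) \<noteq> 0" using u(2) by (metis mult.assoc mult_zero_left)
    ultimately obtain v where "v \<in> \<A>" "b * f = v * (u * (b * f))" using gen by blast
    then show False using u(3)[of v] by (metis mult.assoc)
  qed
  have P_idem: "P B * (P B * v) = P B * v" for B and v :: "('a, 'r) seq_op"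
    by (simp add: P_mult_P flip: mult.assoc)
  show ?thesis
  proof (cases "{x} \<notin> bool_alg X \<or> (\<forall>m n. suffix m x = suffix n x \<longrightarrow> m = n)")
    case False
    then obtain m n where z: "{x} \<in> bool_alg X" "suffix m x = suffix n x" "m \<noteq> n" by blast
    \<comment> \<open>Compression to the corner at \<open>x\<close> keeps the diagonal coefficient,
      so the compressed element is still nonzero.\<close>
    have "app (P {x} * f * (e * P {x})) (delta x 0) (x, 0) = app (f * e) (delta x 0) (x, 0)"
    proof -
      have "app (P {x}) (delta x 0) = delta x 0" by (auto simp: fun_eq_iff)
      then show ?thesis by simp
    qed
    then have "app (P {x} * f * (e * P {x})) (delta x 0) (x, 0) \<noteq> app 0 (delta x 0) (x, 0)"
      using nz by simp
    then have "P {x} * f * (e * P {x}) \<noteq> 0" by metis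
    moreover have "P {x} * (P {x} * f * (e * P {x})) * P {x} = P {x} * f * (e * P {x})"
      by (simp add: P_idem P_mult_P mult.assoc)
    ultimately have False using periodic[OF z \<A>_P[OF z(1)] \<A>_mult[OF e \<A>_P[OF z(1)]]] by blast
    then show ?thesis ..
  next
    case True
    obtain W y c where W: "W \<in> bool_alg X" "y \<in> W" "c \<noteq> 0" "P W * (f * e) * P W = oscale c (P W)"
      by (rule reduction[OF fe x nz True])
    define b where "b = P W * f"
    define d where "d = e * P W"
    have b: "b \<in> J" unfolding b_def by (intro ideal(3) \<A>_P W f)
    have bd: "b * d = oscale c (P W)" using W(4) by (simp add: b_def d_def mult.assoc)
    have nonzero: "P B * b \<in> J \<and> P B * b \<noteq> 0" if "B \<in> bool_alg X" "w \<in> B" "w \<in> W" for B w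
    proof
      show "P B * b \<in> J" by (intro ideal(3) \<A>_P that b)
      have "app (P B * b * d) (\<lambda>_. 1) (w, 0) = c"
        unfolding mult.assoc bd using that by simp
      then have "app (P B * b * d) (\<lambda>_. 1) (w, 0) \<noteq> app 0 (\<lambda>_. 1) (w, 0)" using W(3) by simp
      then show "P B * b \<noteq> 0" by (metis mult_zero_left)
    qed
    \<comment> \<open>If a cylinder \<open>B\<close> contained \<open>y\<close> but missed some
      \<open>w\<close> in \<open>W\<close>, then \<open>b\<close> would be a left multiple of
      \<open>P B * b\<close>; multiplied by \<open>d\<close>, this makes a nonzero multiple of
      \<open>P W\<close> factor through \<open>P B * P W\<close>, which kills the indicator at
      \<open>w\<close>.\<close>
    have single: "W = {y}"
    proof (rule ccontr)
      assume "W \<noteq> {y}"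
      then obtain w where w: "w \<in> W" "w \<noteq> y" using W(2) by blast
      then obtain l where l: "w l \<noteq> y l" by auto
      define B where "B = C_set X [] (prefix (Suc l) y)"
      have B: "B \<in> bool_alg X" "y \<in> B" "w \<notin> B"
        using l bool_alg_C_set W(2) bool_alg_subset[OF W(1)] unfolding B_def cylinder_iff by auto
      obtain v where v: "b = v * (P B * b)"
        using gen[OF _ _ b, of "P B * b"] nonzero[OF B(1,2) W(2)] by blast
      have "app (P B) (app (P W) (delta w 0)) = (\<lambda>_. 0)"
        by (intro ext) (use B(3) in auto)
      have "oscale c (P W) = v * (P B * b) * d" unfolding bd[symmetric] by (rule arg_cong[OF v])
      also have "\<dots> = v * (P B * (b * d))" by (simp only: mult.assoc)
      also have "\<dots> = oscale c (v * (P B * P W))" unfolding bd by (simp add: lo.scale_mult_right)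
      finally have "app (oscale c (P W)) (delta w 0) (w, 0) = app (oscale c (v * (P B * P W))) (delta w 0) (w, 0)"
        by (rule arg_cong)
      also have "\<dots> = 0" using \<open>app (P B) (app (P W) (delta w 0)) = (\<lambda>_. 0)\<close> by simp
      finally show False using W(3) w(1) by simp
    qed
    have y: "{y} \<in> bool_alg X" "y \<in> X" using W(1) single bool_alg_subset[OF W(1)] by auto
    show ?thesis
    proof (cases "y \<in> line_points")
      case True
      have "P {y} * b \<in> lo.span line.units"
        unfolding P_singleton by (rule unit_mult_span_units[OF subsetD[OF ideal(1) b] True])
      then show ?thesis using main nonzero[OF y(1) _ W(2)] by blast
    next
      case False
      then obtain m n where "suffix m y = suffix n y" "m \<noteq> n" using y by (auto simp: line_points_def)
      moreover have "P W * f * d \<noteq> 0"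
      proof
        assume "P W * f * d = 0"
        then have "oscale c (P W) = 0" using bd by (simp only: b_def)
        then have "app (oscale c (P W)) (\<lambda>_. 1) (y, 0) = app 0 (\<lambda>_. 1) (y, 0 :: int)"
          by (simp only:)
        then show False using W(2,3) by simp
      qed
      moreover have "P {y} * (P W * f * d) * P {y} = P W * f * d"
        unfolding single d_def by (simp add: P_idem P_mult_P mult.assoc)
      moreover have "d \<in> \<A>" unfolding d_def by (intro \<A>_mult e \<A>_P W)
      ultimately have False using periodic[OF y(1) _ _ \<A>_P[OF W(1)]] by blast
      then show ?thesis ..
    qed
  qed
qed

lemma socle_eq: "socle (alg oscale \<A>) = lo.span line.units"
proof
  have "\<Union>{J. minimal_left_ideal (alg oscale \<A>) J} \<subseteq> \<A>"
    by (auto simp: minimal_left_ideal_def left_ideal_alg_iff)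
  then have "socle (alg oscale \<A>) = lo.span (\<Union>{J. minimal_left_ideal (alg oscale \<A>) J})"
    unfolding socle_def by (rule lo.lin_span_alg[OF image_subspace])
  also have "\<dots> \<subseteq> lo.span line.units"
    by (rule lo.span_minimal) (use minimal_subset_span_units in auto)
  finally show "socle (alg oscale \<A>) \<subseteq> lo.span line.units" .
qed (rule span_units_socle)

end

section \<open>Comparison of the gradings\<close>

context subshift_over
begin

definition deg_terms :: "int \<Rightarrow> ('r, 'a subshift_gen) ncpoly set" where
  "deg_terms k = {s_word \<alpha> * p_gen A * s_star_word \<beta> |\<alpha> A \<beta>.
     \<alpha> \<in> lang X \<and> \<beta> \<in> lang X \<and> A \<in> bool_alg X \<and> int (length \<alpha>) - int (length \<beta>) = k}"

lemma deg_terms_carrier: "deg_terms k \<subseteq> \<F>"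
  by (auto simp: deg_terms_def intro!: free_algebra_closed(5) s_word_carrier p_gen_carrier)

definition level :: "int \<Rightarrow> ((nat \<Rightarrow> 'a) \<times> int \<Rightarrow> 'r) \<Rightarrow> (nat \<Rightarrow> 'a) \<times> int \<Rightarrow> 'r" where
  "level l h = (\<lambda>(y, j). if j = l then h (y, j) else 0)"

text \<open>An operator of degree \<open>k\<close> sees its argument, from \<open>(x, j)\<close>,
  only on level \<open>j - k\<close>; this detects degrees without first decomposing into
  homogeneous parts.\<close>

lemma deg_terms_level:
  assumes "u \<in> lo.span (\<rho> ` deg_terms k)"
  shows "app u h (x, j) = app u (level (j - k) h) (x, j)"
  using assms
proof (induction rule: lo.span_induct_alt)
  case (step c u v)
  then obtain \<alpha> A \<beta> where "A \<in> bool_alg X" "int (length \<alpha>) - int (length \<beta>) = k"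
    "u = \<rho> (s_word \<alpha> * p_gen A * s_star_word \<beta>)" by (auto simp: deg_terms_def)
  then have "app u h (x, j) = app u (level (j - k) h) (x, j)"
    by (auto simp: \<rho>_mult \<rho>_s_word \<rho>_s_star_word \<rho>_p_gen level_def)
  then show ?case using step(2) by simp
qed simp

text \<open>Restricting the argument to one level acts as the projection to degree \<open>k\<close>:
  matrix units of any other lag become zero.\<close>

lemma units_level:
  assumes "u \<in> lo.span line.units"
  shows "\<exists>u'\<in>lo.span (line.units_deg k). \<forall>h x j. app u (level (j - k) h) (x, j) = app u' h (x, j)"
  using assms
proof (induction rule: lo.span_induct_alt)
  case base
  show ?case by (intro bexI[of _ 0]) (simp_all add: lo.span_zero)
next
  case (step c u v)
  then obtain l where l: "u \<in> line.units_deg l" by (auto simp: line.units_def)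
  from step(2) obtain v' where v': "v' \<in> lo.span (line.units_deg k)"
    "\<And>h x j. app v (level (j - k) h) (x, j) = app v' h (x, j)" by blast
  obtain x0 y0 where u: "u = unit_op x0 l y0" using l by (auto simp: line.units_deg_def)
  define u' where "u' = (if l = k then u else 0)"
  have "u' \<in> lo.span (line.units_deg k)"
    using l by (auto simp: u'_def lo.span_zero intro: lo.span_base)
  moreover have "app u (level (j - k) h) (x, j) = app u' h (x, j)" for h x j
    by (auto simp: u'_def u level_def)
  ultimately show ?case
    using v' by (intro bexI[of _ "oscale c u' + v'"]) (simp_all add: lo.span_add lo.span_scale)
qed

lemma units_deg_terms: "line.units_deg k \<subseteq> \<rho> ` deg_terms k"
proof
  fix u assume "u \<in> line.units_deg k"
  then obtain x y m n where xy: "u = unit_op x k y" "x \<in> line_points" "y \<in> line_points"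
    "suffix m x = suffix n y" "k = int m - int n" by (auto simp: line.units_deg_def)
  \<comment> \<open>In the graded spans the projection stands between the two words, so its
    singleton is the common tail \<open>z\<close> and not \<open>x\<close>.\<close>
  define a b z where "a = prefix m x" and "b = prefix n y" and "z = suffix m x"
  have z: "x = a \<frown> z" "y = b \<frown> z" "length a = m" "length b = n"
    using prefix_suffix[of x m] prefix_suffix[of y n] xy(4) by (simp_all add: a_def b_def z_def)
  have X: "x \<in> X" "y \<in> X" and zU: "{z} \<in> bool_alg X"
    using xy(2,3) line_points_suffix[OF xy(2), of m] by (simp_all add: line_points_def z_def)
  have lang: "a \<in> lang X" "b \<in> lang X"
    using X z unfolding lang_iff by metis+
  have "\<rho> (s_word a * p_gen {z} * s_star_word b) = u"
  proof (rule linop_eqI)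
    fix h :: "(nat \<Rightarrow> 'a) \<times> int \<Rightarrow> 'r" and q :: "(nat \<Rightarrow> 'a) \<times> int"
    obtain w j where q: "q = (w, j)" by (cases q)
    show "app (\<rho> (s_word a * p_gen {z} * s_star_word b)) h q = app u h q"
    proof (cases "w = x")
      case True
      have "\<exists>v. a \<frown> z = a \<frown> v \<and> a \<frown> v \<in> X" using X z by blast
      then show ?thesis
        using X by (simp add: True q xy(1,5) \<rho>_mult \<rho>_s_word \<rho>_s_star_word \<rho>_p_gen[OF zU] z algebra_simps)
    next
      case False
      then have "\<not> (\<exists>v. w = a \<frown> v \<and> v = z)" using z(1) by blast
      then show ?thesis
        using False by (auto simp: q xy(1) \<rho>_mult \<rho>_s_word \<rho>_s_star_word \<rho>_p_gen[OF zU])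
    qed
  qed
  moreover have "s_word a * p_gen {z} * s_star_word b \<in> deg_terms k"
    unfolding deg_terms_def using lang zU z(3,4) xy(5) by blast
  ultimately show "u \<in> \<rho> ` deg_terms k" by blast
qed

text \<open>For an element of both spans, cutting the argument to one level changes nothing by
  \<open>deg_terms_level\<close>, while by \<open>units_level\<close> it leaves only the part of
  degree \<open>k\<close>.\<close>

lemma units_deg_eq: "lo.span (line.units_deg k) = lo.span line.units \<inter> lo.span (\<rho> ` deg_terms k)"
proof
  show "lo.span (line.units_deg k) \<subseteq> lo.span line.units \<inter> lo.span (\<rho> ` deg_terms k)"
    using lo.span_mono[OF line.units_deg_subset] lo.span_mono[OF units_deg_terms] by blast
  show "lo.span line.units \<inter> lo.span (\<rho> ` deg_terms k) \<subseteq> lo.span (line.units_deg k)"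
  proof
    fix u assume u: "u \<in> lo.span line.units \<inter> lo.span (\<rho> ` deg_terms k)"
    then obtain u' where u': "u' \<in> lo.span (line.units_deg k)"
      "\<And>h x j. app u (level (j - k) h) (x, j) = app u' h (x, j)" using units_level by blast
    have "u = u'"
    proof (rule linop_eqI)
      fix h :: "(nat \<Rightarrow> 'a) \<times> int \<Rightarrow> 'r" and q :: "(nat \<Rightarrow> 'a) \<times> int"
      obtain x j where q: "q = (x, j)" by (cases q)
      show "app u h q = app u' h q"
        using deg_terms_level[of u k h x j] u u'(2)[of j h x] by (simp add: q)
    qed
    with u'(1) show "u \<in> lo.span (line.units_deg k)" by simp
  qed
qed

section \<open>The graded isomorphism\<close>

abbreviation \<Q> :: "('r, ('r, 'a subshift_gen) ncpoly set) module" where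
  "\<Q> \<equiv> subshift_algebra X"

lemma subshift_iso: "alg_iso \<Q> (alg oscale \<A>) image_map"
  using presented_alg_iso by (simp add: subshift_algebra_def)

lemma image_subshift_grading: "image_map ` subshift_algebra_grading X k = lo.span (\<rho> ` deg_terms k)"
proof -
  let ?c = "pres_class (free_algebra (subshift_gens X)) (subshift_relators X)"
  have grading: "subshift_algebra_grading X k = lin_span \<Q> (?c ` deg_terms k)"
    unfolding subshift_algebra_grading_def deg_terms_def by (rule arg_cong[where f = "lin_span _"]) blast
  have sub: "?c ` deg_terms k \<subseteq> carrier \<Q>"
    unfolding subshift_algebra_def using pres_class_carrier deg_terms_carrier by blast
  have im: "image_map ` ?c ` deg_terms k = \<rho> ` deg_terms k"
    unfolding image_image
    by (intro image_cong refl image_map_pres_class) (use deg_terms_carrier in blast)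
  have "image_map ` subshift_algebra_grading X k = lin_span (alg oscale \<A>) (\<rho> ` deg_terms k)"
    unfolding grading lin_span_iso[OF subshift_iso sub] im ..
  also have "\<dots> = lo.span (\<rho> ` deg_terms k)"
    by (rule lo.lin_span_alg[OF image_subspace]) (use deg_terms_carrier in blast)
  finally show ?thesis .
qed

lemma grading_carrier: "subshift_algebra_grading X k \<subseteq> carrier \<Q>"
proof -
  have "Defs.subspace \<Q> (carrier \<Q>)"
    using alg_isoD[OF subshift_iso] by (simp add: Defs.subspace_def)
  moreover have "pres_class (free_algebra (subshift_gens X)) (subshift_relators X) ` deg_terms k \<subseteq> carrier \<Q>"
    unfolding subshift_algebra_def using pres_class_carrier deg_terms_carrier by blast
  ultimately show ?thesis
    unfolding subshift_algebra_grading_def lin_span_def deg_terms_def by blast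
qed

lemma socle_carrier: "socle \<Q> \<subseteq> carrier \<Q>"
proof -
  have "Defs.subspace \<Q> (carrier \<Q>)"
    using alg_isoD[OF subshift_iso] by (simp add: Defs.subspace_def)
  then show ?thesis
    unfolding socle_def lin_span_def using minimal_left_ideal_subset_carrier[of \<Q>] by blast
qed

lemma leavitt_socle_iso:
  "graded_algebra_iso (leavitt_algebra (shift_graph line_points) :: ('r, _) module) (leavitt_grading (shift_graph line_points))
    (subshift_socle_algebra X) (subshift_socle_grading X) (inv_into (carrier \<Q>) image_map \<circ> line.image_map)"
proof -
  let ?\<chi> = "inv_into (carrier \<Q>) image_map"
  note \<chi> = alg_isoD[OF alg_iso_inv[OF subshift_iso], simplified]
  note \<psi> = alg_isoD[OF line.leavitt_iso, simplified]
  have N: "lo.span line.units = image_map ` socle \<Q>"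
    using socle_iso[OF subshift_iso] socle_eq by simp
  have \<chi>N: "?\<chi> ` lo.span line.units = socle \<Q>"
    unfolding N by (rule iso_inv_image[OF subshift_iso socle_carrier])
  have in_A: "line.image_map u \<in> \<A>" if "u \<in> carrier (leavitt_algebra (shift_graph line_points))" for u
    using \<psi>(10)[OF that] span_units_subset by blast
  have "bij_betw ?\<chi> (lo.span line.units) (socle \<Q>)"
    using bij_betw_subset[OF \<chi>(1) span_units_subset \<chi>N] .
  then have bij: "bij_betw (?\<chi> \<circ> line.image_map) (carrier (leavitt_algebra (shift_graph line_points))) (socle \<Q>)"
    using \<psi>(1) by (rule bij_betw_trans[rotated])
  have "(?\<chi> \<circ> line.image_map) ` leavitt_grading (shift_graph line_points) k = subshift_socle_grading X k" for k
  proof -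
    have "inj_on image_map (carrier \<Q>)"
      using alg_isoD(1)[OF subshift_iso] by (rule bij_betw_imp_inj_on)
    then have "image_map ` (socle \<Q> \<inter> subshift_algebra_grading X k) = lo.span (line.units_deg k)"
      unfolding units_deg_eq N image_subshift_grading[symmetric]
      by (rule inj_on_image_Int[OF _ socle_carrier grading_carrier])
    then have "?\<chi> ` lo.span (line.units_deg k) = ?\<chi> ` image_map ` (socle \<Q> \<inter> subshift_algebra_grading X k)"
      by simp
    also have "\<dots> = socle \<Q> \<inter> subshift_algebra_grading X k"
      by (rule iso_inv_image[OF subshift_iso]) (use socle_carrier in blast)
    finally show ?thesis
      unfolding image_comp[symmetric] line.image_leavitt_grading subshift_socle_grading_def .
  qed
  then show ?thesis
    unfolding graded_algebra_iso_def
    using bij \<psi>(5-7) \<chi>(5-7) in_A by (auto simp: subshift_socle_algebra_def)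
qed

end

lemma wf_shift_graph: "(\<And>x. x \<in> V \<Longrightarrow> suffix 1 x \<in> V) \<Longrightarrow> wf_digraph (shift_graph V)"
  by (simp add: wf_digraph_def)

theorem corollary5p7:
  fixes X :: "(nat \<Rightarrow> 'a) set"
  assumes "subshift X"
    and "\<forall>a. \<exists>x\<in>X. a \<in> range x"
  shows "\<exists>E :: (nat \<Rightarrow> 'a, nat \<Rightarrow> 'a) pre_digraph. wf_digraph E \<and>
    (\<exists>\<phi>. graded_algebra_iso
      (leavitt_algebra E :: ('r::field, _) module) (leavitt_grading E)
      (subshift_socle_algebra X) (subshift_socle_grading X) \<phi>)"
proof -
  interpret shift_space X using assms by (rule subshift_shift_space)
  interpret subshift_over X "TYPE('r)" by unfold_locales
  show ?thesis
    using wf_shift_graph[of line_points] line_points_suffix leavitt_socle_iso by blast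
qed

end
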